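(* Consider the system $\dot x=f(t,x)$, $t\ge t_0$, on $\mathbb{R}^n$, with $f(t,x)$ piecewise continuous in $t$, continuously differentiable in $x$, and forward complete, and let $K\subset\mathbb{R}^n$ be a compact set with nonempty interior. Let $\mu$ be the matrix measure associated with an induced norm on $\mathbb{R}^{n\times n}$. Then the topological entropy $h(f,t_0,K)$ of the system with initial set $K$ at initial time $t_0$ is upper bounded by $$h(f,t_0,K)\le n\max\{\hat\mu,\,0\},\qquad \hat\mu:=\limsup_{t\to\infty}\ \max_{v\in\operatorname{co}(\xi(t,t_0,K))}\mu\big(J_xf(t,v)\big),$$ and lower bounded by $$h(f,t_0,K)\ge \max\{\check\chi,\,0\},\qquad \check\chi:=\liminf_{t\to\infty}\ \min_{v\in\xi(t,t_0,K)}\operatorname{tr}\big(J_xf(t,v)\big).$$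
   Context: $\xi(t,t_0,x)$ denotes the solution at time $t$ with state $x$ at time $t_0$, and $\xi(t,t_0,K):=\{\xi(t,t_0,x):x\in K\}$ is the reachable set. $J_xf(t,v)$ is the Jacobian matrix of $f(t,x)$ with respect to $x$ evaluated at $x=v$. $\operatorname{co}$ denotes convex hull and $\operatorname{tr}$ the trace. Topological entropy: fix a norm $|\cdot|$ on $\mathbb{R}^n$ (the entropy does not depend on this choice). For $T\ge0$, $\varepsilon>0$, let $B_{f,t_0}(x,\varepsilon,T):=\{\bar x\in\mathbb{R}^n:\max_{t\in[t_0,t_0+T]}|\xi(t,t_0,\bar x)-\xi(t,t_0,x)|<\varepsilon\}$. A subset $E\subset K$ is $(T,\varepsilon)$-spanning if $K\subset\bigcup_{x\in E}B_{f,t_0}(x,\varepsilon,T)$; $S(f,t_0,\varepsilon,T,K)$ is the minimal cardinality of a $(T,\varepsilon)$-spanning set. Then $h(f,t_0,K):=\lim_{\varepsilon\searrow0}\limsup_{T\to\infty}\frac1T\log S(f,t_0,\varepsilon,T,K)$ (natural logarithm). Matrix measure: for an induced norm $\|\cdot\|$ on $\mathbb{R}^{n\times n}$, $\mu(A):=\lim_{t\searrow0}\frac{\|I+tA\|-1}{t}$.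
   Formalization: "Continuously differentiable in x" is taken to include that the Jacobian J_x f is bounded on bounded sets of states over compact time intervals; without such uniformity K can collapse to a point in finite time and the lower bound fails. *)

theory Defs
  imports "HOL-Analysis.Analysis"
begin

definition piecewise_continuous_from :: "real \<Rightarrow> (real \<Rightarrow> 'a::topological_space) \<Rightarrow> bool" where
  "piecewise_continuous_from a g \<longleftrightarrow>
    (\<exists>D. (\<forall>b. finite (D \<inter> {a..b})) \<and>
         (\<forall>t\<in>{a..} - D. continuous (at t within {a..}) g) \<and>
         (\<forall>d\<in>D \<inter> {a..}. \<exists>l. (g \<longlongrightarrow> l) (at_right d)) \<and>
         (\<forall>d\<in>D \<inter> {a<..}. \<exists>l. (g \<longlongrightarrow> l) (at_left d)))"

text \<open>
  The last conjunct makes \<open>f\<close> Lipschitz in the state on bounded sets, uniformly over bounded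
  time intervals, the usual condition for a time-varying vector field to have unique solutions.
  Without it, even with unique forward solutions, a whole interval of initial states can collapse
  to one point in finite time, and the trace of the Jacobian afterwards then no longer bounds the
  entropy from below.
\<close>

definition C1_in_state :: "real \<Rightarrow> (real \<Rightarrow> real^'n \<Rightarrow> real^'n) \<Rightarrow> bool" where
  "C1_in_state t0 f \<longleftrightarrow>
    (\<forall>t\<ge>t0. (\<forall>v. f t differentiable (at v)) \<and>
            continuous_on UNIV (\<lambda>v. jacobian (f t) (at v))) \<and>
    (\<forall>T r. bounded ((\<lambda>(t, v). jacobian (f t) (at v)) ` ({t0..T} \<times> cball 0 r)))"

text \<open>
  As \<open>f\<close> may jump in time, the differential equation is read as an integral equation; the
  continuity of \<open>\<phi>\<close> on \<open>{t0..}\<close> and \<open>\<phi> t0 = x\<close> are consequences. Values of \<open>\<phi>\<close> before \<open>t0\<close> are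
  irrelevant, so \<open>flow\<close> chooses the value at time \<open>t\<close> and not the function \<open>\<phi>\<close>.
\<close>

definition solution_from ::
  "(real \<Rightarrow> real^'n \<Rightarrow> real^'n) \<Rightarrow> real \<Rightarrow> real^'n \<Rightarrow> (real \<Rightarrow> real^'n) \<Rightarrow> bool" where
  "solution_from f t0 x \<phi> \<longleftrightarrow>
    (\<forall>t\<ge>t0. ((\<lambda>s. f s (\<phi> s)) has_integral (\<phi> t - x)) {t0..t})"

definition forward_complete :: "(real \<Rightarrow> real^'n \<Rightarrow> real^'n) \<Rightarrow> real \<Rightarrow> bool" where
  "forward_complete f t0 \<longleftrightarrow> (\<forall>x. \<exists>\<phi>. solution_from f t0 x \<phi>)"

definition flow :: "(real \<Rightarrow> real^'n \<Rightarrow> real^'n) \<Rightarrow> real \<Rightarrow> real \<Rightarrow> real^'n \<Rightarrow> real^'n" where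
  "flow f t t0 x = (THE y. \<exists>\<phi>. solution_from f t0 x \<phi> \<and> y = \<phi> t)"

definition is_norm :: "(real^'n \<Rightarrow> real) \<Rightarrow> bool" where
  "is_norm N \<longleftrightarrow>
    (\<forall>x. N x = 0 \<longleftrightarrow> x = 0) \<and>
    (\<forall>c x. N (c *\<^sub>R x) = \<bar>c\<bar> * N x) \<and>
    (\<forall>x y. N (x + y) \<le> N x + N y)"

definition induced_norm :: "(real^'n \<Rightarrow> real) \<Rightarrow> real^'n^'n \<Rightarrow> real" where
  "induced_norm N A = (SUP x\<in>{x. N x = 1}. N (A *v x))"

definition matrix_measure :: "(real^'n \<Rightarrow> real) \<Rightarrow> real^'n^'n \<Rightarrow> real" where
  "matrix_measure N A = Lim (at_right 0) (\<lambda>t. (induced_norm N (mat 1 + t *\<^sub>R A) - 1) / t)"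

definition entropy_ball ::
  "(real^'n \<Rightarrow> real) \<Rightarrow> (real \<Rightarrow> real^'n \<Rightarrow> real^'n) \<Rightarrow> real \<Rightarrow> real^'n \<Rightarrow> real \<Rightarrow> real \<Rightarrow> (real^'n) set" where
  "entropy_ball N f t0 x \<epsilon> T =
    {y. (SUP t\<in>{t0..t0 + T}. N (flow f t t0 y - flow f t t0 x)) < \<epsilon>}"

definition spanning ::
  "(real^'n \<Rightarrow> real) \<Rightarrow> (real \<Rightarrow> real^'n \<Rightarrow> real^'n) \<Rightarrow> real \<Rightarrow> real \<Rightarrow> real \<Rightarrow> (real^'n) set \<Rightarrow> (real^'n) set \<Rightarrow> bool" where
  "spanning N f t0 \<epsilon> T K E \<longleftrightarrow> E \<subseteq> K \<and> K \<subseteq> (\<Union>x\<in>E. entropy_ball N f t0 x \<epsilon> T)"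

text \<open>
  Finiteness is required explicitly because \<open>card\<close> is \<open>0\<close> on infinite sets. For compact \<open>K\<close> a
  finite spanning set exists by continuity of the flow in the initial state.
\<close>

definition min_spanning_card ::
  "(real^'n \<Rightarrow> real) \<Rightarrow> (real \<Rightarrow> real^'n \<Rightarrow> real^'n) \<Rightarrow> real \<Rightarrow> real \<Rightarrow> real \<Rightarrow> (real^'n) set \<Rightarrow> nat" where
  "min_spanning_card N f t0 \<epsilon> T K = Inf (card ` {E. finite E \<and> spanning N f t0 \<epsilon> T K E})"

definition topological_entropy ::
  "(real^'n \<Rightarrow> real) \<Rightarrow> (real \<Rightarrow> real^'n \<Rightarrow> real^'n) \<Rightarrow> real \<Rightarrow> (real^'n) set \<Rightarrow> ereal" where
  "topological_entropy N f t0 K =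
    Lim (at_right 0) (\<lambda>\<epsilon>. Limsup at_top
      (\<lambda>T. ereal (1 / T * ln (real (min_spanning_card N f t0 \<epsilon> T K)))))"

definition mu_hat ::
  "(real^'n \<Rightarrow> real) \<Rightarrow> (real \<Rightarrow> real^'n \<Rightarrow> real^'n) \<Rightarrow> real \<Rightarrow> (real^'n) set \<Rightarrow> ereal" where
  "mu_hat N f t0 K = Limsup at_top
    (\<lambda>t. SUP v\<in>convex hull (flow f t t0 ` K). ereal (matrix_measure N (jacobian (f t) (at v))))"

definition chi_check :: "(real \<Rightarrow> real^'n \<Rightarrow> real^'n) \<Rightarrow> real \<Rightarrow> (real^'n) set \<Rightarrow> ereal" where
  "chi_check f t0 K = Liminf at_top
    (\<lambda>t. INF v\<in>flow f t t0 ` K. ereal (trace (jacobian (f t) (at v))))"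

end

theory Submission
  imports Defs
begin

text \<open>
  For the upper bound, let \<open>\<delta>\<close> be the difference of two solutions and \<open>w\<close> a functional supporting \<open>\<nu>\<close> at
  \<open>\<delta> v\<close>. The mean value theorem and \<open>w \<bullet> (A *v \<delta> v) \<le> \<mu> A * \<nu> (\<delta> v)\<close> bound \<open>\<nu> (\<delta> v) - \<nu> (\<delta> u)\<close> by
  \<open>c * (v - u) * \<nu> (\<delta> v)\<close> up to an error of second order in \<open>v - u\<close>, so two solutions separate at most
  like \<open>exp (c * t)\<close> for every \<open>c > max mu_hat 0\<close>, and a net of mesh proportional to
  \<open>exp (- c * T)\<close> is spanning.

  For the lower bound, the flow is differentiable in the initial state and its Jacobian determinant
  grows at least like \<open>exp (c * t)\<close> when \<open>c\<close> is below \<open>chi_check\<close>. So does the volume of the reachable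
  set, which is covered by as many balls of fixed radius as a spanning set has points.
\<close>

subsection \<open>Growth estimates and the determinant near the identity\<close>

text \<open>As \<open>f\<close> may jump in time, solutions satisfy the differential equation only
  in integral form, and the Jacobian need not be continuous in the state uniformly over time. Growth
  is therefore estimated over short intervals, with errors of second order in their length, and
  composed to exponential growth by bisection; linearisation errors are controlled in the mean over
  time, by dominated convergence.

  \<open>mu_hat\<close> and \<open>chi_check\<close> constrain only late times. What happens before
  changes distances and volumes by a constant factor, which disappears under
  \<open>1 / T * ln\<close>.

  The maximum with \<open>0\<close> has two origins. Above, an entropy ball watches the whole time
  window, so the expansion factor must not decay with the length of the window; below, a nonempty
  \<open>K\<close> needs at least one centre. The dimension enters the upper bound as the exponent
  in the number of points of a net, whereas the trace measures the growth of volume in all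
  directions together.\<close>

lemma gronwall_integral:
  fixes g :: "real \<Rightarrow> real"
  assumes g: "continuous_on {a..b} g" and L: "0 \<le> L"
    and le: "\<And>t. t \<in> {a..b} \<Longrightarrow> g t \<le> \<alpha> + L * integral {a..t} g"
    and t: "t \<in> {a..b}"
  shows "g t \<le> \<alpha> * exp (L * (t - a))"
proof -
  \<comment> \<open>Unlike \<open>g\<close>, the majorant \<open>G\<close> is differentiable; the
    integrating factor in \<open>H\<close> makes it nonincreasing.\<close>
  define G where "G s = \<alpha> + L * integral {a..s} g" for s
  define H where "H s = G s * exp (- L * (s - a))" for s
  have ab: "a \<le> b" using t by auto
  have dG: "(G has_real_derivative L * g s) (at s within {a..b})" if "s \<in> {a..b}" for s
    unfolding G_def
    by (rule derivative_eq_intros integral_has_real_derivative[OF g that] | simp)+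
  have dH: "(H has_real_derivative (L * g s - L * G s) * exp (- L * (s - a))) (at s within {a..b})"
    if "s \<in> {a..b}" for s
    unfolding H_def
    by (auto intro!: derivative_eq_intros dG[OF that] simp: algebra_simps)
  have "H t \<le> H a"
  proof (rule DERIV_nonpos_imp_decreasing_open[where f = H])
    show "a \<le> t" using t by simp
    have "continuous_on {a..b} H"
      using dH by (meson DERIV_continuous continuous_on_eq_continuous_within)
    then show "continuous_on {a..t} H" by (rule continuous_on_subset) (use t in auto)
    fix s assume s: "a < s" "s < t"
    then have sab: "s \<in> {a..b}" and "s \<in> interior {a..b}" using t by auto
    then have "(H has_real_derivative (L * g s - L * G s) * exp (- L * (s - a))) (at s)"
      using dH[OF sab] at_within_interior by metis
    moreover have "(L * g s - L * G s) * exp (- L * (s - a)) \<le> 0"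
      using le[OF sab] L by (simp add: mult_le_0_iff mult_left_mono G_def)
    ultimately show "\<exists>y. DERIV H s :> y \<and> y \<le> 0" by blast
  qed
  then have "G t * exp (- L * (t - a)) \<le> \<alpha>" by (simp add: H_def G_def)
  then have "G t * exp (- L * (t - a)) * exp (L * (t - a)) \<le> \<alpha> * exp (L * (t - a))"
    by (intro mult_right_mono) auto
  then have "G t \<le> \<alpha> * exp (L * (t - a))"
    by (simp add: mult.assoc flip: exp_add)
  with le[OF t] show ?thesis by (simp add: G_def)
qed

text \<open>Both sides agree at \<open>h = 0\<close>, and the slope of the affine one is larger by
  \<open>\<eta> / 2\<close>, which decides the order on a short interval to the right.\<close>

lemma exp_le_affine_right:
  fixes c \<eta> :: real
  assumes "0 < \<eta>"
  obtains d where "0 < d" "\<And>h. 0 \<le> h \<Longrightarrow> h < d \<Longrightarrow> exp ((c - \<eta>) * h) \<le> 1 + (c - \<eta> / 2) * h"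
proof -
  define f where "f h = 1 + (c - \<eta> / 2) * h - exp ((c - \<eta>) * h)" for h :: real
  have "(f has_real_derivative \<eta> / 2) (at 0)"
    unfolding f_def by (rule derivative_eq_intros | simp)+
  from DERIV_pos_inc_right[OF this] assms obtain d where d: "d > 0"
    "\<And>h. 0 < h \<Longrightarrow> h < d \<Longrightarrow> f 0 < f (0 + h)" by auto
  show ?thesis
  proof (rule that[OF d(1)])
    fix h :: real assume "0 \<le> h" "h < d"
    then show "exp ((c - \<eta>) * h) \<le> 1 + (c - \<eta> / 2) * h"
      using d(2)[of h] by (cases "h = 0") (auto simp: f_def)
  qed
qed

text \<open>A substitute for integrating a differential inequality when \<open>g\<close> is known
  only through its increments. With \<open>exp\<close> in place of the affine factor the bound is
  stable under concatenation of intervals, so bisection carries it from short intervals to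
  \<open>{a..b}\<close>; letting \<open>\<eta>\<close> tend to \<open>0\<close> removes the
  loss.\<close>

lemma exponential_growth_of_increments:
  fixes g :: "real \<Rightarrow> real"
  assumes ab: "a \<le> b" and pos: "\<And>t. t \<in> {a..b} \<Longrightarrow> 0 \<le> g t"
    and inc: "\<And>\<eta>. 0 < \<eta> \<Longrightarrow> \<exists>d>0. \<forall>u v. a \<le> u \<longrightarrow> u \<le> v \<longrightarrow> v \<le> b \<longrightarrow> v - u < d \<longrightarrow>
      g u * (1 + (c - \<eta>) * (v - u)) \<le> g v"
  shows "g a * exp (c * (b - a)) \<le> g b"
proof -
  have *: "g a * exp ((c - \<eta>) * (b - a)) \<le> g b" if \<eta>: "0 < \<eta>" for \<eta>
  proof -
    \<comment> \<open>Half of \<open>\<eta>\<close> is spent on the increment, the other half on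
      replacing the affine factor by the exponential.\<close>
    from inc[of "\<eta> / 2"] \<eta> obtain d1 where d1: "d1 > 0"
      "\<And>u v. a \<le> u \<Longrightarrow> u \<le> v \<Longrightarrow> v \<le> b \<Longrightarrow> v - u < d1 \<Longrightarrow> g u * (1 + (c - \<eta> / 2) * (v - u)) \<le> g v"
      by auto
    obtain d2 where d2: "d2 > 0"
      "\<And>h. 0 \<le> h \<Longrightarrow> h < d2 \<Longrightarrow> exp ((c - \<eta>) * h) \<le> 1 + (c - \<eta> / 2) * h"
      using exp_le_affine_right[OF \<eta>] by metis
    define P where "P u v \<longleftrightarrow> (a \<le> u \<longrightarrow> v \<le> b \<longrightarrow> g u * exp ((c - \<eta>) * (v - u)) \<le> g v)" for u v
    have "P a b"
    proof (rule Bolzano[OF ab])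
      fix u v w assume P: "P u v" "P v w" and uv: "u \<le> v" "v \<le> w"
      show "P u w" unfolding P_def
      proof (intro impI)
        assume "a \<le> u" "w \<le> b"
        then have 1: "g u * exp ((c - \<eta>) * (v - u)) \<le> g v" and 2: "g v * exp ((c - \<eta>) * (w - v)) \<le> g w"
          using P uv by (auto simp: P_def)
        have "g u * exp ((c - \<eta>) * (w - u)) = g u * exp ((c - \<eta>) * (v - u)) * exp ((c - \<eta>) * (w - v))"
          by (simp add: mult.assoc algebra_simps flip: exp_add)
        also have "\<dots> \<le> g v * exp ((c - \<eta>) * (w - v))" by (intro mult_right_mono 1) auto
        finally show "g u * exp ((c - \<eta>) * (w - u)) \<le> g w" using 2 by simp
      qed
    next
      fix x
      have "P u v" if "u \<le> x" "x \<le> v" "v - u < min d1 d2" for u v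
        unfolding P_def
      proof (intro impI)
        assume u: "a \<le> u" "v \<le> b"
        have "g u * exp ((c - \<eta>) * (v - u)) \<le> g u * (1 + (c - \<eta> / 2) * (v - u))"
          using that u pos d2(2)[of "v - u"] by (intro mult_left_mono) auto
        also have "\<dots> \<le> g v" using that u d1(2)[of u v] by auto
        finally show "g u * exp ((c - \<eta>) * (v - u)) \<le> g v" .
      qed
      then show "\<exists>d>0. \<forall>u v. u \<le> x \<and> x \<le> v \<and> v - u < d \<longrightarrow> P u v"
        using d1(1) d2(1) by (intro exI[of _ "min d1 d2"]) auto
    qed
    then show ?thesis by (simp add: P_def)
  qed
  have "((\<lambda>\<eta>. g a * exp ((c - \<eta>) * (b - a))) \<longlongrightarrow> g a * exp ((c - 0) * (b - a))) (at_right 0)"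
    by (intro tendsto_intros)
  then show ?thesis
    by (intro tendsto_upperbound[where F = "at_right 0"])
       (auto simp: eventually_at_right_field intro!: exI[of _ "1::real"] *)
qed

text \<open>The product rule is applied to the Leibniz formula. At the identity matrix only the
  identity permutation survives, and it contributes the sum of the diagonal entries.\<close>

lemma has_derivative_det_mat_1:
  "((det :: real^'n^'n \<Rightarrow> real) has_derivative trace) (at (mat 1))"
proof -
  let ?S = "{p :: 'n \<Rightarrow> 'n. p permutes UNIV}"
  have entry: "((\<lambda>A :: real^'n^'n. A $ i $ j) has_derivative (\<lambda>A. A $ i $ j)) (at (mat 1))" for i j
    by (intro bounded_linear_imp_has_derivative bounded_linear_intros)
       (auto intro!: bounded_linear_compose[OF bounded_linear_vec_nth] bounded_linear_vec_nth)
  have "((\<lambda>A :: real^'n^'n. \<Sum>p\<in>?S. of_int (sign p) * (\<Prod>i\<in>UNIV. A $ i $ p i)) has_derivative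
     (\<lambda>B. \<Sum>p\<in>?S. of_int (sign p) *
       (\<Sum>i\<in>UNIV. B $ i $ p i * (\<Prod>j\<in>UNIV - {i}. (mat 1 :: real^'n^'n) $ j $ p j)))) (at (mat 1))"
    by (intro has_derivative_sum has_derivative_mult_right has_derivative_prod entry)
  moreover have "(\<Sum>p\<in>?S. of_int (sign p) *
       (\<Sum>i\<in>UNIV. B $ i $ p i * (\<Prod>j\<in>UNIV - {i}. (mat 1 :: real^'n^'n) $ j $ p j))) = trace B"
    for B :: "real^'n^'n"
  proof -
    \<comment> \<open>A permutation other than \<open>id\<close> moves some \<open>k\<close> and
      also \<open>p k\<close>, so after removal of the factor with index \<open>i\<close> there
      still is an off-diagonal one, which is \<open>0\<close>.\<close>
    have vanish: "(\<Prod>j\<in>UNIV - {i}. (mat 1 :: real^'n^'n) $ j $ p j) = 0" if p: "p \<in> ?S - {id}" for p i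
    proof -
      from p obtain k where k: "p k \<noteq> k" by (auto simp: fun_eq_iff)
      from p have "inj p" by (auto dest: permutes_inj)
      then have "p (p k) \<noteq> p k" using k by (auto dest: injD)
      with k obtain j where "j \<noteq> i" "p j \<noteq> j" by metis
      then show ?thesis by (intro prod_zero) (auto simp: mat_def intro!: bexI[of _ j])
    qed
    have "(\<Sum>p\<in>?S. of_int (sign p) *
       (\<Sum>i\<in>UNIV. B $ i $ p i * (\<Prod>j\<in>UNIV - {i}. (mat 1 :: real^'n^'n) $ j $ p j)))
       = (\<Sum>p\<in>{id}. of_int (sign p) *
       (\<Sum>i\<in>UNIV. B $ i $ p i * (\<Prod>j\<in>UNIV - {i}. (mat 1 :: real^'n^'n) $ j $ p j)))"
      by (intro sum.mono_neutral_right ballI)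
         (simp_all add: permutes_id vanish del: prod_zero_iff)
    also have "\<dots> = trace B" by (simp add: sign_id trace_def mat_def)
    finally show ?thesis .
  qed
  ultimately show ?thesis by (simp add: det_def[abs_def])
qed

text \<open>First-order expansion at the identity with a freely chosen error constant. The absolute
  value anticipates the change of variables.\<close>

lemma det_perturb_identity_lower:
  assumes "0 < \<eta>"
  obtains d where "0 < d"
    "\<And>B :: real^'n^'n. norm B < d \<Longrightarrow> 1 + trace B - \<eta> * norm B \<le> \<bar>det (mat 1 + B)\<bar>"
proof -
  from has_derivative_det_mat_1[where 'n = 'n, unfolded has_derivative_at_alt] assms
  obtain d where d: "d > 0" "\<And>A :: real^'n^'n. norm (A - mat 1) < d \<Longrightarrow>
     norm (det A - det (mat 1 :: real^'n^'n) - trace (A - mat 1)) \<le> \<eta> * norm (A - mat 1)"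
    by blast
  show ?thesis
  proof (rule that[OF d(1)])
    fix B :: "real^'n^'n" assume "norm B < d"
    with d(2)[of "mat 1 + B"] show "1 + trace B - \<eta> * norm B \<le> \<bar>det (mat 1 + B)\<bar>" by auto
  qed
qed

subsection \<open>Norms, matrix measures and nets\<close>

text \<open>\<open>N\<close> is a plain function and not the \<open>norm\<close> of the type class,
  so its elementary properties and its equivalence with the Euclidean norm are derived from
  \<open>is_norm\<close>.\<close>

lemma is_norm_zero: "is_norm N \<Longrightarrow> N 0 = 0"
  and is_norm_eq_zero: "is_norm N \<Longrightarrow> N x = 0 \<longleftrightarrow> x = 0"
  and is_norm_scaleR: "is_norm N \<Longrightarrow> N (c *\<^sub>R x) = \<bar>c\<bar> * N x"
  and is_norm_triangle: "is_norm N \<Longrightarrow> N (x + y) \<le> N x + N y"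
  by (auto simp: is_norm_def)

lemma is_norm_minus: "is_norm N \<Longrightarrow> N (- x) = N x"
  using is_norm_scaleR[of N "-1" x] by simp

lemma is_norm_nonneg: "is_norm N \<Longrightarrow> 0 \<le> N x"
  using is_norm_triangle[of N x "- x"] by (simp add: is_norm_minus is_norm_zero)

lemma is_norm_pos: "is_norm N \<Longrightarrow> x \<noteq> 0 \<Longrightarrow> 0 < N x"
  by (metis is_norm_nonneg is_norm_eq_zero order_less_le)

lemma is_norm_diff_commute: "is_norm N \<Longrightarrow> N (x - y) = N (y - x)"
  using is_norm_minus[of N "x - y"] by simp

lemma is_norm_sum: "is_norm N \<Longrightarrow> N (sum g A) \<le> (\<Sum>i\<in>A. N (g i))"
proof (induction A rule: infinite_finite_induct)
  case (insert x A)
  then show ?case using is_norm_triangle[of N "g x" "sum g A"] by simp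
qed (auto simp: is_norm_zero)

lemma is_norm_le_norm:
  fixes N :: "real^'n \<Rightarrow> real"
  assumes N: "is_norm N"
  obtains b where "0 < b" "\<And>x. N x \<le> b * norm x"
proof -
  define b where "b = (\<Sum>i\<in>UNIV. N (axis i 1)) + 1"
  have "N x \<le> b * norm x" for x
  proof -
    have "N x = N (\<Sum>i\<in>UNIV. (x $ i) *\<^sub>R axis i 1)"
      using basis_expansion[of x] by (simp add: scalar_mult_eq_scaleR)
    also have "\<dots> \<le> (\<Sum>i\<in>UNIV. \<bar>x $ i\<bar> * N (axis i 1))"
      using is_norm_sum[OF N, of "\<lambda>i. (x $ i) *\<^sub>R axis i 1" UNIV] by (simp add: is_norm_scaleR[OF N])
    also have "\<dots> \<le> (\<Sum>i\<in>UNIV. norm x * N (axis i 1))"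
      by (intro sum_mono mult_right_mono component_le_norm_cart is_norm_nonneg[OF N])
    also have "\<dots> \<le> b * norm x" by (simp add: b_def algebra_simps sum_distrib_left)
    finally show ?thesis .
  qed
  moreover have "0 < b" unfolding b_def by (intro add_nonneg_pos sum_nonneg is_norm_nonneg[OF N]) auto
  ultimately show ?thesis using that by blast
qed

lemma is_norm_continuous_on:
  fixes N :: "real^'n \<Rightarrow> real"
  assumes N: "is_norm N"
  shows "continuous_on S N"
proof -
  obtain b where b: "0 < b" "\<And>x. N x \<le> b * norm x" using is_norm_le_norm[OF N] by blast
  have "dist (N x) (N y) \<le> b * dist x y" for x y
    using is_norm_triangle[OF N, of "x - y" y] is_norm_triangle[OF N, of "y - x" x] b(2)[of "x - y"]
      is_norm_diff_commute[OF N, of x y]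
    by (simp add: dist_norm abs_real_def)
  then have "b-lipschitz_on S N" using b(1) by (intro lipschitz_onI) auto
  then show ?thesis by (rule lipschitz_on_continuous_on)
qed

text \<open>\<open>N\<close> attains a positive minimum on the compact Euclidean unit sphere;
  homogeneity extends the bound to all vectors.\<close>

lemma norm_le_is_norm:
  fixes N :: "real^'n \<Rightarrow> real"
  assumes N: "is_norm N"
  obtains a where "0 < a" "\<And>x. a * norm x \<le> N x"
proof -
  have "\<exists>z\<in>sphere 0 1. \<forall>y\<in>sphere 0 1. N z \<le> N (y :: real^'n)"
    by (rule continuous_attains_inf) (auto intro: is_norm_continuous_on[OF N])
  then obtain z :: "real^'n" where z: "norm z = 1" "\<And>y. norm y = 1 \<Longrightarrow> N z \<le> N y" by auto
  have "N z * norm x \<le> N x" for x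
  proof (cases "x = 0")
    case False
    then have "N z * norm x \<le> N ((1 / norm x) *\<^sub>R x) * norm x"
      by (intro mult_right_mono z(2)) auto
    also have "\<dots> = N x" using False by (simp add: is_norm_scaleR[OF N])
    finally show ?thesis .
  qed (simp add: is_norm_zero[OF N])
  moreover have "0 < N z" using z(1) by (intro is_norm_pos[OF N]) auto
  ultimately show ?thesis using that by blast
qed

text \<open>Hahn-Banach in finite dimension: the normal of a hyperplane separating the open
  \<open>N\<close>-ball of radius \<open>N x\<close> from \<open>x\<close> is rescaled to take the
  value \<open>N x\<close> at \<open>x\<close>. As \<open>N\<close> need not be differentiable,
  \<open>w\<close> takes the place of its gradient.\<close>

lemma is_norm_support_functional:
  fixes N :: "real^'n \<Rightarrow> real"
  assumes N: "is_norm N" and x: "x \<noteq> 0"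
  obtains w where "w \<bullet> x = N x" "\<And>y. w \<bullet> y \<le> N y"
proof -
  let ?S = "{y. N y < N x}"
  have "convex ?S"
  proof (rule convexI)
    fix y z and u v :: real
    assume y: "y \<in> ?S" and z: "z \<in> ?S" and uv: "0 \<le> u" "0 \<le> v" "u + v = 1"
    have "N (u *\<^sub>R y + v *\<^sub>R z) \<le> u * N y + v * N z"
      using is_norm_triangle[OF N, of "u *\<^sub>R y" "v *\<^sub>R z"] uv by (simp add: is_norm_scaleR[OF N])
    also have "\<dots> < N x" using y z uv by (intro convex_bound_lt) auto
    finally show "u *\<^sub>R y + v *\<^sub>R z \<in> ?S" by simp
  qed
  moreover have "0 \<in> ?S" using is_norm_pos[OF N x] by (simp add: is_norm_zero[OF N])
  ultimately obtain a b where a: "a \<noteq> 0" "\<And>y. y \<in> ?S \<Longrightarrow> a \<bullet> y \<le> b" "b \<le> a \<bullet> x"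
    using separating_hyperplane_sets[of ?S "{x}"] by auto
  have S: "a \<bullet> y \<le> a \<bullet> x" if "N y < N x" for y using a that by force
  have "a \<bullet> y * N x \<le> a \<bullet> x * N y" if "y \<noteq> 0" for y
  proof -
    have Ny: "0 < N y" and Nx: "0 < N x" using is_norm_pos[OF N] that x by auto
    \<comment> \<open>\<open>y\<close> is scaled to lie just inside the ball; letting
      \<open>s\<close> tend to \<open>1\<close> reaches the boundary.\<close>
    have "s * (a \<bullet> y * N x) \<le> a \<bullet> x * N y" if "0 < s" "s < 1" for s
    proof -
      have "N ((s * N x / N y) *\<^sub>R y) < N x" using that Ny Nx by (simp add: is_norm_scaleR[OF N])
      from S[OF this] show ?thesis using Ny by (simp add: field_simps)
    qed
    then show ?thesis by (rule field_le_mult_one_interval)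
  qed
  then have le: "a \<bullet> y * N x \<le> a \<bullet> x * N y" for y by (cases "y = 0") (auto simp: is_norm_zero[OF N])
  have Nx: "0 < N x" using is_norm_pos[OF N x] .
  \<comment> \<open>Testing the bound with the normal \<open>a\<close> itself shows that the divisor
    \<open>a \<bullet> x\<close> is positive.\<close>
  have "0 < a \<bullet> a * N x" using a(1) Nx by simp
  also have "\<dots> \<le> a \<bullet> x * N a" by (rule le)
  finally have pos: "0 < a \<bullet> x" using is_norm_nonneg[OF N, of a] by (simp add: zero_less_mult_iff)
  show ?thesis
  proof (rule that[of "(N x / (a \<bullet> x)) *\<^sub>R a"])
    show "(N x / (a \<bullet> x)) *\<^sub>R a \<bullet> y \<le> N y" for y
      using le[of y] pos by (simp add: field_simps)
  qed (use pos in auto)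
qed

section \<open>Induced norms and matrix measures\<close>

lemma induced_norm_properties:
  fixes N :: "real^'n \<Rightarrow> real"
  assumes N: "is_norm N"
  shows induced_norm_bdd: "bdd_above ((\<lambda>x. N (A *v x)) ` {x. N x = 1})"
    and induced_norm_unit_nonempty: "{x. N x = 1} \<noteq> {}"
proof -
  obtain b where b: "0 < b" "\<And>x. N x \<le> b * norm x" using is_norm_le_norm[OF N] by blast
  obtain a where a: "0 < a" "\<And>x. a * norm x \<le> N x" using norm_le_is_norm[OF N] by blast
  have "N (A *v x) \<le> b * (onorm ((*v) A) * (1 / a))" if "N x = 1" for x
  proof -
    have "norm x \<le> 1 / a" using a that by (simp add: field_simps) (metis mult.commute)
    then have "norm (A *v x) \<le> onorm ((*v) A) * (1 / a)"
      using onorm[of "(*v) A" x] onorm_pos_le[of "(*v) A"]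
      by (meson matrix_vector_mul_bounded_linear mult_left_mono order_trans)
    then show ?thesis using b(2)[of "A *v x"] b(1) by (meson mult_left_mono less_imp_le order_trans)
  qed
  then show "bdd_above ((\<lambda>x. N (A *v x)) ` {x. N x = 1})" by (intro bdd_aboveI2) auto
  have ax: "axis undefined 1 \<noteq> (0 :: real^'n)" by (simp add: axis_eq_0_iff)
  have "N ((1 / N (axis undefined 1)) *\<^sub>R axis undefined 1) = 1"
    using is_norm_pos[OF N ax] by (simp add: is_norm_scaleR[OF N])
  then show "{x. N x = 1} \<noteq> {}" by blast
qed

lemma induced_norm_bound:
  fixes N :: "real^'n \<Rightarrow> real"
  assumes N: "is_norm N"
  shows "N (A *v x) \<le> induced_norm N A * N x"
proof (cases "x = 0")
  case False
  have Nx: "0 < N x" using is_norm_pos[OF N False] .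
  have "N (A *v ((1 / N x) *\<^sub>R x)) \<le> induced_norm N A"
    unfolding induced_norm_def
    by (rule cSUP_upper) (use Nx induced_norm_bdd[OF N] in \<open>auto simp: is_norm_scaleR[OF N]\<close>)
  then show ?thesis using Nx
    by (simp add: matrix_vector_mult_scaleR is_norm_scaleR[OF N] field_simps)
qed (simp add: is_norm_zero[OF N])

lemma induced_norm_le:
  fixes N :: "real^'n \<Rightarrow> real"
  assumes N: "is_norm N" and "\<And>x. N (A *v x) \<le> c * N x"
  shows "induced_norm N A \<le> c"
  unfolding induced_norm_def
proof (rule cSUP_least)
  show "N (A *v x) \<le> c" if "x \<in> {x. N x = 1}" for x using assms(2)[of x] that by simp
qed (rule induced_norm_unit_nonempty[OF N])

text \<open>\<open>Lim\<close> denotes the limit only if there is one. The quotient is monotone in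
  \<open>t\<close>, by convexity of the norm, and bounded below by
  \<open>- induced_norm N A\<close>; hence it converges from the right to its infimum.\<close>

lemma matrix_measure_tendsto:
  fixes N :: "real^'n \<Rightarrow> real"
  assumes N: "is_norm N"
  shows "((\<lambda>t. (induced_norm N (mat 1 + t *\<^sub>R A) - 1) / t) \<longlongrightarrow> matrix_measure N A) (at_right 0)"
proof -
  define q where "q t = (induced_norm N (mat 1 + t *\<^sub>R A) - 1) / t" for t
  have mono: "q s \<le> q t" if "0 < s" "s \<le> t" for s t
  proof -
    \<comment> \<open>With this ratio, \<open>mat 1 + s *\<^sub>R A\<close> is a convex combination
      of \<open>mat 1\<close> and \<open>mat 1 + t *\<^sub>R A\<close>.\<close>
    define \<theta> where "\<theta> = s / t"
    have \<theta>: "0 < \<theta>" "\<theta> \<le> 1" "s = \<theta> * t" using that by (auto simp: \<theta>_def)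
    have "induced_norm N (mat 1 + s *\<^sub>R A) \<le> (1 - \<theta>) + \<theta> * induced_norm N (mat 1 + t *\<^sub>R A)"
    proof (rule induced_norm_le[OF N])
      fix x
      have "(mat 1 + s *\<^sub>R A) *v x = (1 - \<theta>) *\<^sub>R x + \<theta> *\<^sub>R ((mat 1 + t *\<^sub>R A) *v x)"
        by (simp add: \<theta>(3) algebra_simps matrix_vector_mult_add_rdistrib scaleR_matrix_vector_assoc[symmetric])
      then have "N ((mat 1 + s *\<^sub>R A) *v x) \<le> N ((1 - \<theta>) *\<^sub>R x) + N (\<theta> *\<^sub>R ((mat 1 + t *\<^sub>R A) *v x))"
        by (simp add: is_norm_triangle[OF N])
      also have "\<dots> = (1 - \<theta>) * N x + \<theta> * N ((mat 1 + t *\<^sub>R A) *v x)"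
        using \<theta> by (simp add: is_norm_scaleR[OF N])
      also have "\<dots> \<le> (1 - \<theta>) * N x + \<theta> * (induced_norm N (mat 1 + t *\<^sub>R A) * N x)"
        using \<theta> induced_norm_bound[OF N] by (intro add_left_mono mult_left_mono) auto
      finally show "N ((mat 1 + s *\<^sub>R A) *v x) \<le> ((1 - \<theta>) + \<theta> * induced_norm N (mat 1 + t *\<^sub>R A)) * N x"
        by (simp add: algebra_simps)
    qed
    then have "induced_norm N (mat 1 + s *\<^sub>R A) - 1 \<le> \<theta> * (induced_norm N (mat 1 + t *\<^sub>R A) - 1)"
      by (simp add: algebra_simps)
    then show ?thesis using that unfolding q_def \<theta>_def by (simp add: field_simps)
  qed
  have bnd: "- induced_norm N A \<le> q t" if t: "0 < t" for t
  proof -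
    obtain x where x: "N x = 1" using induced_norm_unit_nonempty[OF N] by auto
    have "x = (mat 1 + t *\<^sub>R A) *v x + (- t) *\<^sub>R (A *v x)"
      by (simp add: algebra_simps matrix_vector_mult_add_rdistrib scaleR_matrix_vector_assoc[symmetric])
    then have "N x \<le> N ((mat 1 + t *\<^sub>R A) *v x) + N ((- t) *\<^sub>R (A *v x))"
      using is_norm_triangle[OF N] by metis
    also have "\<dots> \<le> induced_norm N (mat 1 + t *\<^sub>R A) + t * induced_norm N A"
      using t induced_norm_bound[OF N, of _ x] x
      by (intro add_mono) (auto simp: is_norm_scaleR[OF N] is_norm_minus[OF N])
    finally show ?thesis using t x by (simp add: q_def field_simps)
  qed
  have "(q \<longlongrightarrow> Inf (q ` ({0<..} \<inter> UNIV))) (at 0 within ({0<..} \<inter> UNIV))"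
    by (rule Lim_right_bound[where K = "- induced_norm N A"]) (use mono bnd in auto)
  then have "(q \<longlongrightarrow> Inf (q ` {0<..})) (at_right 0)" by simp
  moreover from this have "matrix_measure N A = Inf (q ` {0<..})"
    unfolding matrix_measure_def q_def by (intro tendsto_Lim) auto
  ultimately show ?thesis by (simp add: q_def[abs_def])
qed

text \<open>Applying \<open>w\<close> to \<open>(mat 1 + t *\<^sub>R A) *v x\<close> gives
  \<open>N x + t * (w \<bullet> (A *v x))\<close>, which is at most
  \<open>induced_norm N (mat 1 + t *\<^sub>R A) * N x\<close>. Subtracting \<open>N x\<close> and
  dividing by \<open>t\<close> leaves the quotient that defines the matrix measure, which unlike a
  norm can be negative.\<close>

lemma support_functional_matrix_measure:
  fixes N :: "real^'n \<Rightarrow> real"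
  assumes N: "is_norm N" and w: "w \<bullet> x = N x" "\<And>y. w \<bullet> y \<le> N y"
  shows "w \<bullet> (A *v x) \<le> matrix_measure N A * N x"
proof (rule tendsto_lowerbound)
  show "((\<lambda>t. (induced_norm N (mat 1 + t *\<^sub>R A) - 1) / t * N x) \<longlongrightarrow> matrix_measure N A * N x) (at_right 0)"
    by (intro tendsto_intros matrix_measure_tendsto N)
  have "w \<bullet> (A *v x) \<le> (induced_norm N (mat 1 + t *\<^sub>R A) - 1) / t * N x" if t: "0 < t" for t
  proof -
    have "N x + t * (w \<bullet> (A *v x)) = w \<bullet> ((mat 1 + t *\<^sub>R A) *v x)"
      by (simp add: algebra_simps matrix_vector_mult_add_rdistrib scaleR_matrix_vector_assoc[symmetric] w(1))
    also have "\<dots> \<le> induced_norm N (mat 1 + t *\<^sub>R A) * N x"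
      using w(2) induced_norm_bound[OF N] order_trans by blast
    finally show ?thesis using t by (simp add: field_simps)
  qed
  then show "\<forall>\<^sub>F t in at_right 0. w \<bullet> (A *v x) \<le> (induced_norm N (mat 1 + t *\<^sub>R A) - 1) / t * N x"
    by (auto simp: eventually_at_right_field intro!: exI[of _ "1::real"])
qed auto

section \<open>Packing and covering by volume\<close>

lemma compact_subset_cball_0:
  fixes K :: "'a::real_normed_vector set"
  assumes "compact K"
  obtains r where "0 \<le> r" "K \<subseteq> cball 0 r"
proof -
  obtain b where "0 < b" "\<forall>x\<in>K. norm x \<le> b"
    using compact_imp_bounded[OF assms] unfolding bounded_pos by blast
  then show ?thesis by (intro that[of b]) auto
qed

text \<open>The balls of radius \<open>\<rho> / 2\<close> around the points are disjoint and lie in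
  a ball of radius \<open>r + \<rho>\<close>; comparing volumes bounds their number.\<close>

lemma separated_set_card_le:
  fixes E :: "'a::euclidean_space set"
  assumes E: "finite E" "E \<subseteq> cball 0 r" and r: "0 \<le> r" and \<rho>: "0 < \<rho>"
    and sep: "\<And>x y. x \<in> E \<Longrightarrow> y \<in> E \<Longrightarrow> x \<noteq> y \<Longrightarrow> \<rho> \<le> dist x y"
  shows "real (card E) \<le> (2 * (r + \<rho>) / \<rho>) ^ DIM('a)"
proof -
  let ?V = "unit_ball_vol (real DIM('a))"
  have V: "0 < ?V" by simp
  have disj: "disjoint_family_on (\<lambda>x. ball x (\<rho> / 2)) E"
    unfolding disjoint_family_on_def
  proof (intro ballI impI)
    fix x y assume "x \<in> E" "y \<in> E" "x \<noteq> y"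
    from sep[OF this] show "ball x (\<rho> / 2) \<inter> ball y (\<rho> / 2) = {}" by (intro disjoint_ballI) auto
  qed
  have "real (card E) * (?V * (\<rho> / 2) ^ DIM('a)) = (\<Sum>x\<in>E. measure lebesgue (ball x (\<rho> / 2)))"
    using \<rho> by (simp add: content_ball)
  also have "\<dots> = measure lebesgue (\<Union>x\<in>E. ball x (\<rho> / 2))"
    by (rule measure_finite_Union[symmetric]) (use E disj emeasure_lborel_ball_finite in \<open>auto simp: less_top\<close>)
  also have "\<dots> \<le> measure lebesgue (ball (0::'a) (r + \<rho>))"
  proof (rule measure_mono_fmeasurable)
    show "(\<Union>x\<in>E. ball x (\<rho> / 2)) \<subseteq> ball 0 (r + \<rho>)"
    proof safe
      fix x y assume "x \<in> E" "y \<in> ball x (\<rho> / 2)"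
      then show "y \<in> ball 0 (r + \<rho>)"
        using E(2) \<rho> dist_triangle[of 0 y x] by (auto simp: subset_iff)
    qed
  next
    show "(\<Union>x\<in>E. ball x (\<rho> / 2)) \<in> sets lebesgue"
      by (intro sets_completionI_sets) (simp add: borel_open open_UN)
  qed simp
  also have "\<dots> = ?V * (r + \<rho>) ^ DIM('a)" using r \<rho> by (simp add: content_ball)
  finally have "real (card E) * (\<rho> / 2) ^ DIM('a) \<le> (r + \<rho>) ^ DIM('a)"
    using V by (simp add: mult.left_commute)
  then have "real (card E) \<le> (r + \<rho>) ^ DIM('a) / (\<rho> / 2) ^ DIM('a)"
    using \<rho> by (subst pos_le_divide_eq) auto
  then show ?thesis by (simp add: mult.commute flip: power_divide)
qed

text \<open>A separated set of maximal cardinality is a net, as a point far from all its members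
  could be added. The packing bound shows that a maximum exists and also counts the net.\<close>

lemma finite_net:
  fixes K :: "'a::euclidean_space set"
  assumes K: "K \<subseteq> cball 0 r" and r: "0 \<le> r" and \<rho>: "0 < \<rho>"
  obtains E where "finite E" "E \<subseteq> K" "\<And>x. x \<in> K \<Longrightarrow> \<exists>y\<in>E. dist x y < \<rho>"
    "real (card E) \<le> (2 * (r + \<rho>) / \<rho>) ^ DIM('a)"
proof -
  define P where "P E \<longleftrightarrow> finite E \<and> E \<subseteq> K \<and> (\<forall>x\<in>E. \<forall>y\<in>E. x \<noteq> y \<longrightarrow> \<rho> \<le> dist x y)" for E
  have bound: "real (card E) \<le> (2 * (r + \<rho>) / \<rho>) ^ DIM('a)" if "P E" for E
    using that K r \<rho> by (intro separated_set_card_le) (auto simp: P_def)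
  then have le: "card E \<le> nat \<lceil>(2 * (r + \<rho>) / \<rho>) ^ DIM('a)\<rceil>" if "P E" for E
    using bound[OF that] by (meson of_nat_le_iff order_trans real_nat_ceiling_ge)
  have "P {}" by (simp add: P_def)
  then have "\<exists>E. P E \<and> (\<forall>F. P F \<longrightarrow> card F \<le> card E)"
    by (rule ex_has_greatest_nat) (use le le_imp_less_Suc in blast)
  then obtain E where E: "P E" "\<And>F. P F \<Longrightarrow> card F \<le> card E" by blast
  have "\<exists>y\<in>E. dist x y < \<rho>" if x: "x \<in> K" for x
  proof (rule ccontr)
    assume *: "\<not> (\<exists>y\<in>E. dist x y < \<rho>)"
    then have "x \<notin> E" using \<rho> by auto
    moreover have "finite E" using E(1) by (simp add: P_def)
    moreover have "P (insert x E)" using E(1) x * by (auto simp: P_def dist_commute not_less)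
    ultimately show False using E(2)[of "insert x E"] by simp
  qed
  then show ?thesis using that[of E] E(1) bound[OF E(1)] unfolding P_def by blast
qed

subsection \<open>The flow\<close>

lemma has_integral_increment:
  fixes g :: "real \<Rightarrow> 'a::banach"
  assumes inc: "\<And>t. t \<in> {a..b} \<Longrightarrow> (g has_integral (\<delta> t - \<delta> a)) {a..t}"
    and uv: "a \<le> u" "u \<le> v" "v \<le> b"
  shows "(g has_integral (\<delta> v - \<delta> u)) {u..v}"
proof -
  have v: "(g has_integral (\<delta> v - \<delta> a)) {a..v}" and u: "(g has_integral (\<delta> u - \<delta> a)) {a..u}"
    using inc uv by auto
  then have "g integrable_on {u..v}"
    using uv by (meson has_integral_integrable integrable_on_subinterval atLeastatMost_subset_iff order_refl)
  moreover have "integral {a..u} g + integral {u..v} g = integral {a..v} g"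
    by (rule Henstock_Kurzweil_Integration.integral_combine) (use uv v in auto)
  then have "integral {u..v} g = \<delta> v - \<delta> u"
    using integral_unique[OF u] integral_unique[OF v] by (simp add: algebra_simps)
  ultimately show ?thesis using integrable_integral by metis
qed

lemma continuous_on_has_integral_increment:
  fixes g :: "real \<Rightarrow> 'a::banach"
  assumes inc: "\<And>t. t \<in> {a..b} \<Longrightarrow> (g has_integral (\<delta> t - \<delta> a)) {a..t}"
  shows "continuous_on {a..b} \<delta>"
proof (cases "a \<le> b")
  case True
  then have "g integrable_on {a..b}" using inc[of b] by auto
  then have "continuous_on {a..b} (\<lambda>t. \<delta> a + integral {a..t} g)"
    by (intro continuous_intros indefinite_integral_continuous_1)
  then show ?thesis
  proof (rule continuous_on_cong[THEN iffD1, rotated -1])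
    show "\<delta> a + integral {a..t} g = \<delta> t" if "t \<in> {a..b}" for t
      using integral_unique[OF inc[OF that]] by simp
  qed simp
qed auto

lemma gronwall_forward:
  fixes \<delta> :: "real \<Rightarrow> 'a::euclidean_space"
  assumes inc: "\<And>t. t \<in> {a..b} \<Longrightarrow> (g has_integral (\<delta> t - \<delta> a)) {a..t}"
    and g: "\<And>s. s \<in> {a..b} \<Longrightarrow> norm (g s) \<le> L * norm (\<delta> s)" and L: "0 \<le> L" and t: "t \<in> {a..b}"
  shows "norm (\<delta> t) \<le> norm (\<delta> a) * exp (L * (t - a))"
proof -
  have c: "continuous_on {a..b} (\<lambda>s. norm (\<delta> s))"
    by (intro continuous_intros continuous_on_has_integral_increment[OF inc])
  show ?thesis
  proof (rule gronwall_integral[OF c L _ t])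
    fix t assume t: "t \<in> {a..b}"
    have "norm (integral {a..t} g) \<le> integral {a..t} (\<lambda>s. L * norm (\<delta> s))"
    proof (rule Henstock_Kurzweil_Integration.integral_norm_bound_integral)
      show "(\<lambda>s. L * norm (\<delta> s)) integrable_on {a..t}"
        by (intro integrable_continuous_real continuous_intros continuous_on_subset[OF c]) (use t in auto)
    qed (use t inc[OF t] g in auto)
    then show "norm (\<delta> t) \<le> norm (\<delta> a) + L * integral {a..t} (\<lambda>s. norm (\<delta> s))"
      using integral_unique[OF inc[OF t]] norm_triangle_sub[of "\<delta> t" "\<delta> a"] by simp
  qed
qed

text \<open>The forward estimate for the reversed curve. It keeps solutions apart, which later gives
  injectivity of the flow and invertibility of the variational matrices.\<close>

lemma gronwall_backward:
  fixes \<delta> :: "real \<Rightarrow> 'a::euclidean_space"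
  assumes inc: "\<And>t. t \<in> {a..b} \<Longrightarrow> (g has_integral (\<delta> t - \<delta> a)) {a..t}"
    and g: "\<And>s. s \<in> {a..b} \<Longrightarrow> norm (g s) \<le> L * norm (\<delta> s)" and L: "0 \<le> L" and t: "t \<in> {a..b}"
  shows "norm (\<delta> a) \<le> norm (\<delta> t) * exp (L * (t - a))"
proof -
  have "norm (\<delta> (- (- a))) \<le> norm (\<delta> (- (- t))) * exp (L * ((- a) - (- t)))"
  proof (rule gronwall_forward[where \<delta> = "\<lambda>s. \<delta> (- s)" and g = "\<lambda>s. - g (- s)" and b = "- a"])
    fix s assume s: "s \<in> {- t..- a}"
    have "(g has_integral (\<delta> t - \<delta> (- s))) {- s..t}"
      by (rule has_integral_increment[OF inc]) (use s t in auto)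
    then have "((\<lambda>x. g (- x)) has_integral (\<delta> t - \<delta> (- s))) {- t..- (- s)}"
      by (subst has_integral_reflect_real)
    from has_integral_neg[OF this]
    show "((\<lambda>x. - g (- x)) has_integral (\<delta> (- s) - \<delta> (- (- t)))) {- t..s}" by simp
  qed (use g L t in auto)
  then show ?thesis by simp
qed

lemma solution_from_initial:
  assumes "solution_from f t0 x \<phi>"
  shows "\<phi> t0 = x"
proof -
  have "((\<lambda>s. f s (\<phi> s)) has_integral (\<phi> t0 - x)) {t0..t0}"
    using assms by (auto simp: solution_from_def)
  moreover have "((\<lambda>s. f s (\<phi> s)) has_integral 0) {t0..t0}"
    using has_integral_refl(2)[of "\<lambda>s. f s (\<phi> s)" t0] by simp
  ultimately have "\<phi> t0 - x = 0" by (rule has_integral_unique)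
  then show ?thesis by simp
qed

lemma solution_from_increment:
  assumes "solution_from f t0 x \<phi>" "t0 \<le> u" "u \<le> v"
  shows "((\<lambda>s. f s (\<phi> s)) has_integral (\<phi> v - \<phi> u)) {u..v}"
  by (rule has_integral_increment[where a = t0 and b = v])
     (use assms solution_from_initial[OF assms(1)] in \<open>auto simp: solution_from_def\<close>)

lemma solution_from_continuous_on:
  assumes "solution_from f t0 x \<phi>"
  shows "continuous_on {t0..T} \<phi>"
  by (rule continuous_on_has_integral_increment[where g = "\<lambda>s. f s (\<phi> s)"])
     (use solution_from_increment[OF assms] in auto)

lemma solution_from_bounded:
  fixes f :: "real \<Rightarrow> real^'n \<Rightarrow> real^'n"
  assumes "solution_from f t0 x \<phi>"
  obtains R where "0 < R" "\<And>t. t \<in> {t0..T} \<Longrightarrow> norm (\<phi> t) \<le> R"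
proof -
  have "bounded (\<phi> ` {t0..T})"
    by (intro compact_imp_bounded compact_continuous_image solution_from_continuous_on[OF assms]) auto
  then show ?thesis using that by (auto simp: bounded_pos)
qed

text \<open>Only the vector field and the initial time are fixed here. Sets of initial states stay
  arguments of the lemmas, because the estimates are also applied to two-point sets and closed
  balls.\<close>

locale C1_system =
  fixes f :: "real \<Rightarrow> real^'n \<Rightarrow> real^'n" and t0 :: real
  assumes pc: "\<And>x. piecewise_continuous_from t0 (\<lambda>t. f t x)"
    and C1: "C1_in_state t0 f" and fc: "forward_complete f t0"
begin

abbreviation J :: "real \<Rightarrow> real^'n \<Rightarrow> real^'n^'n" where "J t v \<equiv> jacobian (f t) (at v)"

abbreviation \<Phi> :: "real \<Rightarrow> real^'n \<Rightarrow> real^'n" where "\<Phi> t x \<equiv> flow f t t0 x"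

lemma has_derivative_J: "t0 \<le> t \<Longrightarrow> (f t has_derivative (\<lambda>h. J t v *v h)) (at v)"
  using C1 by (auto simp: C1_in_state_def jacobian_works[symmetric])

text \<open>The uniform bound on the Jacobian gives one constant for a whole time interval; as
  \<open>cball 0 r\<close> is convex, it is also a Lipschitz constant of \<open>f t\<close>
  there.\<close>

lemma J_bound:
  obtains L where "0 < L" "\<And>t v w. t \<in> {t0..T} \<Longrightarrow> norm v \<le> r \<Longrightarrow> norm (J t v *v w) \<le> L * norm w"
    "\<And>t x y. t \<in> {t0..T} \<Longrightarrow> norm x \<le> r \<Longrightarrow> norm y \<le> r \<Longrightarrow> norm (f t x - f t y) \<le> L * norm (x - y)"
proof -
  have "bounded ((\<lambda>(t, v). J t v) ` ({t0..T} \<times> cball 0 r))" using C1 by (simp add: C1_in_state_def)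
  then obtain B where B0: "0 < B"
    and "\<forall>A\<in>(\<lambda>(t, v). J t v) ` ({t0..T} \<times> cball 0 r). norm A \<le> B"
    unfolding bounded_pos by blast
  then have B: "norm (J t v) \<le> B" if "t \<in> {t0..T}" "norm v \<le> r" for t v
    using that by simp
  define L where "L = real CARD('n) * real CARD('n) * B"
  have on: "onorm ((*v) (J t v)) \<le> L" if "t \<in> {t0..T}" "norm v \<le> r" for t v
    unfolding L_def
  proof (rule onorm_le_matrix_component)
    fix i j
    show "\<bar>J t v $ i $ j\<bar> \<le> B"
      using component_le_norm_cart[of "J t v $ i" j] Finite_Cartesian_Product.norm_nth_le[of "J t v" i] B[OF that] by linarith
  qed
  show ?thesis
  proof (rule that)
    show "0 < L" using B0 by (simp add: L_def)
    show "norm (J t v *v w) \<le> L * norm w" if "t \<in> {t0..T}" "norm v \<le> r" for t v w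
    proof -
      have "norm (J t v *v w) \<le> onorm ((*v) (J t v)) * norm w" by (rule onorm) simp
      also have "\<dots> \<le> L * norm w" by (intro mult_right_mono on[OF that]) simp
      finally show ?thesis .
    qed
    show "norm (f t x - f t y) \<le> L * norm (x - y)"
      if "t \<in> {t0..T}" "norm x \<le> r" "norm y \<le> r" for t x y
      by (rule differentiable_bound[where S = "cball 0 r" and f' = "\<lambda>v. (*v) (J t v)"])
         (use that on has_derivative_J in \<open>auto intro: has_derivative_at_withinI\<close>)
  qed
qed

text \<open>The Lipschitz bound is asked only along the two solutions, since \<open>f\<close> need
  not have a global Lipschitz constant.\<close>

lemma solutions_gronwall:
  assumes \<phi>: "solution_from f t0 x \<phi>" and \<psi>: "solution_from f t0 y \<psi>"
    and u: "t0 \<le> u" "u \<le> v" and L: "0 \<le> L"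
    and lip: "\<And>s. s \<in> {u..v} \<Longrightarrow> norm (f s (\<psi> s) - f s (\<phi> s)) \<le> L * norm (\<psi> s - \<phi> s)"
  shows "norm (\<psi> v - \<phi> v) \<le> norm (\<psi> u - \<phi> u) * exp (L * (v - u))"
    and "norm (\<psi> u - \<phi> u) \<le> norm (\<psi> v - \<phi> v) * exp (L * (v - u))"
proof -
  have "((\<lambda>s. f s (\<psi> s) - f s (\<phi> s)) has_integral ((\<psi> t - \<phi> t) - (\<psi> u - \<phi> u))) {u..t}" if "t \<in> {u..v}" for t
    using has_integral_diff[OF solution_from_increment[OF \<psi>, of u t] solution_from_increment[OF \<phi>, of u t]]
      that u by (simp add: algebra_simps)
  note * = this
  show "norm (\<psi> v - \<phi> v) \<le> norm (\<psi> u - \<phi> u) * exp (L * (v - u))"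
    by (rule gronwall_forward[where \<delta> = "\<lambda>t. \<psi> t - \<phi> t", OF * lip L]) (use u in auto)
  show "norm (\<psi> u - \<phi> u) \<le> norm (\<psi> v - \<phi> v) * exp (L * (v - u))"
    by (rule gronwall_backward[where \<delta> = "\<lambda>t. \<psi> t - \<phi> t", OF * lip L]) (use u in auto)
qed

text \<open>Up to time \<open>t\<close> both solutions stay in one ball, where \<open>f\<close> has
  a Lipschitz constant. This makes the \<open>THE\<close> in \<open>flow\<close> well
  defined.\<close>

lemma solution_unique:
  assumes \<phi>: "solution_from f t0 x \<phi>" and \<psi>: "solution_from f t0 x \<psi>" and t: "t0 \<le> t"
  shows "\<psi> t = \<phi> t"
proof -
  obtain R1 where R1: "0 < R1" "\<And>s. s \<in> {t0..t} \<Longrightarrow> norm (\<phi> s) \<le> R1"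
    by (rule solution_from_bounded[OF \<phi>, where T = t]) blast
  obtain R2 where R2: "0 < R2" "\<And>s. s \<in> {t0..t} \<Longrightarrow> norm (\<psi> s) \<le> R2"
    by (rule solution_from_bounded[OF \<psi>, where T = t]) blast
  obtain L where L: "0 < L"
    "\<And>s x y. s \<in> {t0..t} \<Longrightarrow> norm x \<le> max R1 R2 \<Longrightarrow> norm y \<le> max R1 R2 \<Longrightarrow> norm (f s x - f s y) \<le> L * norm (x - y)"
    by (rule J_bound[where T = t and r = "max R1 R2"]) blast
  have "norm (\<psi> t - \<phi> t) \<le> norm (\<psi> t0 - \<phi> t0) * exp (L * (t - t0))"
  proof (rule solutions_gronwall(1)[OF \<phi> \<psi>])
    show "norm (f s (\<psi> s) - f s (\<phi> s)) \<le> L * norm (\<psi> s - \<phi> s)" if "s \<in> {t0..t}" for s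
      using R1(2)[OF that] R2(2)[OF that] by (intro L(2) that) linarith+
  qed (use t L(1) in auto)
  then show ?thesis using solution_from_initial[OF \<phi>] solution_from_initial[OF \<psi>] by simp
qed

lemma flow_eq: "solution_from f t0 x \<phi> \<Longrightarrow> t0 \<le> t \<Longrightarrow> \<Phi> t x = \<phi> t"
  unfolding flow_def by (rule the_equality) (use solution_unique in blast)+

lemma flow_solution: "solution_from f t0 x (\<lambda>t. \<Phi> t x)"
proof -
  obtain \<phi> where \<phi>: "solution_from f t0 x \<phi>" using fc by (auto simp: forward_complete_def)
  show ?thesis
    unfolding solution_from_def
  proof (intro allI impI)
    fix t assume t: "t0 \<le> t"
    then have "((\<lambda>s. f s (\<phi> s)) has_integral (\<Phi> t x - x)) {t0..t}"
      using \<phi> flow_eq[OF \<phi>] by (simp add: solution_from_def)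
    then show "((\<lambda>s. f s (\<Phi> s x)) has_integral (\<Phi> t x - x)) {t0..t}"
      by (rule has_integral_eq[rotated]) (simp add: flow_eq[OF \<phi>])
  qed
qed

lemma flow_initial: "\<Phi> t0 x = x"
  by (rule solution_from_initial[OF flow_solution])

lemma flow_increment:
  "t0 \<le> u \<Longrightarrow> u \<le> v \<Longrightarrow> ((\<lambda>s. f s (\<Phi> s x)) has_integral (\<Phi> v x - \<Phi> u x)) {u..v}"
  by (rule solution_from_increment[OF flow_solution])

lemma flow_continuous_on: "continuous_on {t0..T} (\<lambda>t. \<Phi> t x)"
  by (rule solution_from_continuous_on[OF flow_solution])

text \<open>Forward completeness bounds each solution separately. A neighbouring solution inherits
  the bound: while it stays within distance \<open>1\<close>, the Lipschitz constant on the ball of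
  radius \<open>R + 1\<close> applies, and Gronwall's inequality then keeps the distance strictly
  below \<open>1\<close>.\<close>

lemma flow_locally_bounded:
  assumes T: "t0 \<le> T"
  obtains d R where "0 < d" "\<And>y t. norm (y - x) < d \<Longrightarrow> t \<in> {t0..T} \<Longrightarrow> norm (\<Phi> t y) \<le> R"
proof -
  obtain R where R: "0 < R" "\<And>t. t \<in> {t0..T} \<Longrightarrow> norm (\<Phi> t x) \<le> R"
    by (rule solution_from_bounded[OF flow_solution, where x = x and T = T]) blast
  obtain L where L: "0 < L"
    "\<And>t x y. t \<in> {t0..T} \<Longrightarrow> norm x \<le> R + 1 \<Longrightarrow> norm y \<le> R + 1 \<Longrightarrow> norm (f t x - f t y) \<le> L * norm (x - y)"
    by (rule J_bound[where T = T and r = "R + 1"]) blast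
  \<comment> \<open>Multiplied by the Gronwall factor over \<open>{t0..T}\<close>, this radius
    becomes exactly \<open>1\<close>.\<close>
  define d where "d = exp (- L * (T - t0))"
  have d: "0 < d" "d \<le> 1" using L T by (auto simp: d_def)
  have close: "norm (\<Phi> t y - \<Phi> t x) < 1" if y: "norm (y - x) < d" and t: "t \<in> {t0..T}" for y t
  proof (rule ccontr)
    define h where "h s = norm (\<Phi> s y - \<Phi> s x)" for s
    assume "\<not> norm (\<Phi> t y - \<Phi> t x) < 1"
    then have t1: "1 \<le> h t" by (simp add: h_def)
    have cont: "continuous_on {t0..T} h" unfolding h_def by (intro continuous_intros flow_continuous_on)
    have h0: "h t0 < 1" using y d by (simp add: h_def flow_initial)
    \<comment> \<open>The times at distance exactly \<open>1\<close>; this set is compact, and its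
      least element \<open>\<tau>\<close> is the time of first exit.\<close>
    define S where "S = {s \<in> {t0..T}. h s = 1}"
    have ivt: "\<exists>s'\<in>S. s' \<le> s" if "s \<in> {t0..T}" "1 \<le> h s" for s
    proof -
      have "\<exists>s'\<ge>t0. s' \<le> s \<and> h s' = 1"
        by (rule IVT') (use that h0 continuous_on_subset[OF cont] in auto)
      then show ?thesis using that by (auto simp: S_def)
    qed
    have "S \<noteq> {}" using ivt[OF t t1] by auto
    moreover have "compact S"
    proof -
      have "S = {t0..T} \<inter> h -` {1}" by (auto simp: S_def)
      then have "closed S" by (simp add: continuous_closed_preimage[OF cont])
      moreover have "bounded S" by (rule bounded_subset[of "{t0..T}"]) (auto simp: S_def)
      ultimately show ?thesis by (simp add: compact_eq_bounded_closed)
    qed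
    ultimately obtain \<tau> where \<tau>: "\<tau> \<in> S" "\<And>s. s \<in> S \<Longrightarrow> \<tau> \<le> s"
      using compact_attains_inf by metis
    have le1: "h s \<le> 1" if "s \<in> {t0..\<tau>}" for s
    proof (rule ccontr)
      assume "\<not> h s \<le> 1"
      moreover have "s \<in> {t0..T}" using that \<tau>(1) by (auto simp: S_def)
      ultimately obtain s' where "s' \<in> S" "s' \<le> s" using ivt[of s] by auto
      moreover from this have "s = \<tau>" using \<tau>(2)[of s'] that by auto
      ultimately show False using \<open>\<not> h s \<le> 1\<close> \<tau>(1) by (auto simp: S_def)
    qed
    have \<tau>T: "t0 \<le> \<tau>" "\<tau> \<le> T" using \<tau>(1) by (auto simp: S_def)
    have "h \<tau> \<le> h t0 * exp (L * (\<tau> - t0))"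
      unfolding h_def
    proof (rule solutions_gronwall(1)[OF flow_solution flow_solution])
      fix s assume s: "s \<in> {t0..\<tau>}"
      then have "norm (\<Phi> s x) \<le> R" using R \<tau>T by auto
      moreover from this have "norm (\<Phi> s y) \<le> R + 1"
        using le1[OF s] norm_triangle_sub[of "\<Phi> s y" "\<Phi> s x"] by (simp add: h_def)
      ultimately show "norm (f s (\<Phi> s y) - f s (\<Phi> s x)) \<le> L * norm (\<Phi> s y - \<Phi> s x)"
        using s \<tau>T by (intro L(2)) auto
    qed (use L \<tau>T in auto)
    also have "\<dots> \<le> h t0 * exp (L * (T - t0))"
      using L \<tau>T by (intro mult_left_mono) (auto simp: h_def)
    also have "\<dots> < d * exp (L * (T - t0))"
      using y by (intro mult_strict_right_mono) (auto simp: h_def flow_initial)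
    also have "\<dots> = 1" by (simp add: d_def flip: exp_add)
    finally show False using \<tau>(1) by (simp add: S_def)
  qed
  show ?thesis
  proof (rule that[OF d(1)])
    fix y t assume y: "norm (y - x) < d" and t: "t \<in> {t0..T}"
    show "norm (\<Phi> t y) \<le> R + 1"
      using close[OF y t] R(2)[OF t] norm_triangle_sub[of "\<Phi> t y" "\<Phi> t x"] by linarith
  qed
qed

text \<open>Compactness leaves finitely many of the local bounds; their sum stands in for the
  maximum.\<close>

lemma flow_bounded:
  assumes K: "compact K" and T: "t0 \<le> T"
  obtains R where "0 < R" "\<And>x t. x \<in> K \<Longrightarrow> t \<in> {t0..T} \<Longrightarrow> norm (\<Phi> t x) \<le> R"
proof -
  have "\<exists>d R. 0 < d \<and> (\<forall>y t. norm (y - x) < d \<longrightarrow> t \<in> {t0..T} \<longrightarrow> norm (\<Phi> t y) \<le> R)" for x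
    by (rule flow_locally_bounded[OF T, of x]) blast
  then obtain d R where d: "\<And>x. 0 < d x"
    and R: "\<And>x y t. norm (y - x) < d x \<Longrightarrow> t \<in> {t0..T} \<Longrightarrow> norm (\<Phi> t y) \<le> R x"
    by metis
  obtain F where F: "F \<subseteq> K" "finite F" "K \<subseteq> (\<Union>x\<in>F. ball x (d x))"
  proof (rule compactE_image[OF K, of K "\<lambda>x. ball x (d x)"])
    show "K \<subseteq> (\<Union>x\<in>K. ball x (d x))" using d by (auto intro: centre_in_ball[THEN iffD2])
  qed auto
  have "norm (\<Phi> t y) \<le> (\<Sum>x\<in>F. \<bar>R x\<bar>) + 1" if y: "y \<in> K" and t: "t \<in> {t0..T}" for y t
  proof -
    obtain x where x: "x \<in> F" "norm (y - x) < d x"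
      using F y by (auto simp: dist_norm norm_minus_commute subset_iff)
    have "norm (\<Phi> t y) \<le> \<bar>R x\<bar>" using R[OF x(2) t] by linarith
    also have "\<dots> \<le> (\<Sum>x\<in>F. \<bar>R x\<bar>)" using F(2) x(1) by (intro member_le_sum) auto
    finally show ?thesis by simp
  qed
  moreover have "0 < (\<Sum>x\<in>F. \<bar>R x\<bar>) + 1" by (intro add_nonneg_pos sum_nonneg) auto
  ultimately show ?thesis using that by blast
qed

end

subsection \<open>Expansion of the flow\<close>

context C1_system begin

text \<open>Gronwall's inequality has the same factor forwards and backwards, so one constant bounds
  both expansion and contraction.\<close>

lemma flow_lipschitz:
  assumes K: "compact K" and T: "t0 \<le> T"
  obtains C where "1 \<le> C"
    "\<And>x y t. x \<in> K \<Longrightarrow> y \<in> K \<Longrightarrow> t \<in> {t0..T} \<Longrightarrow> norm (\<Phi> t y - \<Phi> t x) \<le> C * norm (y - x)"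
    "\<And>x y t. x \<in> K \<Longrightarrow> y \<in> K \<Longrightarrow> t \<in> {t0..T} \<Longrightarrow> norm (y - x) \<le> C * norm (\<Phi> t y - \<Phi> t x)"
proof -
  obtain R where R: "0 < R" "\<And>x t. x \<in> K \<Longrightarrow> t \<in> {t0..T} \<Longrightarrow> norm (\<Phi> t x) \<le> R"
    by (rule flow_bounded[OF K T]) blast
  obtain L where L: "0 < L"
    "\<And>t x y. t \<in> {t0..T} \<Longrightarrow> norm x \<le> R \<Longrightarrow> norm y \<le> R \<Longrightarrow> norm (f t x - f t y) \<le> L * norm (x - y)"
    by (rule J_bound[where T = T and r = R]) blast
  have *: "norm (\<Phi> t y - \<Phi> t x) \<le> exp (L * (T - t0)) * norm (y - x)"
    "norm (y - x) \<le> exp (L * (T - t0)) * norm (\<Phi> t y - \<Phi> t x)"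
    if "x \<in> K" "y \<in> K" "t \<in> {t0..T}" for x y t
  proof -
    have lip: "norm (f s (\<Phi> s y) - f s (\<Phi> s x)) \<le> L * norm (\<Phi> s y - \<Phi> s x)" if "s \<in> {t0..t}" for s
      using that \<open>x \<in> K\<close> \<open>y \<in> K\<close> \<open>t \<in> {t0..T}\<close> R by (intro L(2)) auto
    have e: "exp (L * (t - t0)) \<le> exp (L * (T - t0))" using L that by simp
    have "norm (\<Phi> t y - \<Phi> t x) \<le> norm (\<Phi> t0 y - \<Phi> t0 x) * exp (L * (t - t0))"
      "norm (\<Phi> t0 y - \<Phi> t0 x) \<le> norm (\<Phi> t y - \<Phi> t x) * exp (L * (t - t0))"
      by (rule solutions_gronwall[OF flow_solution flow_solution _ _ _ lip]; use L that in auto)+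
    then show "norm (\<Phi> t y - \<Phi> t x) \<le> exp (L * (T - t0)) * norm (y - x)"
      "norm (y - x) \<le> exp (L * (T - t0)) * norm (\<Phi> t y - \<Phi> t x)"
      using mult_left_mono[OF e, of "norm (y - x)"] mult_left_mono[OF e, of "norm (\<Phi> t y - \<Phi> t x)"]
      by (auto simp: flow_initial mult.commute)
  qed
  show ?thesis by (rule that[of "exp (L * (T - t0))"]) (use * L T in auto)
qed

text \<open>Vector-valued maps have no mean value equality, so it is applied to the scalar function
  \<open>w \<bullet> f t\<close> on the segment. The intermediate point lies between two states and
  need not be reachable itself, whence the convex hull in \<open>mu_hat\<close>.\<close>

lemma inner_mean_value:
  assumes t: "t0 \<le> t"
  obtains z where "z \<in> closed_segment x y" "w \<bullet> (f t y - f t x) = w \<bullet> (J t z *v (y - x))"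
proof -
  have d: "((\<lambda>\<theta>. w \<bullet> f t (x + \<theta> *\<^sub>R (y - x))) has_real_derivative w \<bullet> (J t (x + \<theta> *\<^sub>R (y - x)) *v (y - x))) (at \<theta>)"
    for \<theta>
  proof -
    have "((\<lambda>\<theta>. x + \<theta> *\<^sub>R (y - x)) has_derivative (\<lambda>h. h *\<^sub>R (y - x))) (at \<theta>)"
      by (auto intro!: derivative_eq_intros)
    from has_derivative_compose[OF this has_derivative_J[OF t]]
    have "((\<lambda>\<theta>. w \<bullet> f t (x + \<theta> *\<^sub>R (y - x))) has_derivative
      (\<lambda>h. w \<bullet> (J t (x + \<theta> *\<^sub>R (y - x)) *v (h *\<^sub>R (y - x))))) (at \<theta>)"
      by (rule has_derivative_inner_right)
    then show ?thesis
      by (rule has_derivative_imp_has_field_derivative) (simp add: matrix_vector_mult_scaleR mult.commute)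
  qed
  obtain \<theta> where \<theta>: "0 < \<theta>" "\<theta> < 1"
    "w \<bullet> f t (x + 1 *\<^sub>R (y - x)) - w \<bullet> f t (x + 0 *\<^sub>R (y - x)) = (1 - 0) * (w \<bullet> (J t (x + \<theta> *\<^sub>R (y - x)) *v (y - x)))"
    using MVT2[of 0 1 "\<lambda>\<theta>. w \<bullet> f t (x + \<theta> *\<^sub>R (y - x))", OF _ d] by auto
  show ?thesis
  proof (rule that)
    show "x + \<theta> *\<^sub>R (y - x) \<in> closed_segment x y"
      using \<theta> by (auto simp: in_segment algebra_simps intro!: exI[of _ \<theta>])
  qed (use \<theta> in \<open>simp add: inner_diff_right\<close>)
qed

text \<open>The functional has to support \<open>\<nu>\<close> at the later endpoint: then
  \<open>w \<bullet> \<delta> u \<le> \<nu> (\<delta> u)\<close> has the direction needed to bound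
  the increment of \<open>\<nu>\<close> from above. The price is a bound in terms of the later value
  \<open>\<nu> (\<delta> v)\<close>; read backwards in time, it is growth at rate
  \<open>- c\<close>.\<close>

lemma flow_difference_growth:
  assumes \<nu>: "is_norm \<nu>" and ab: "t0 \<le> a" "a \<le> b"
    and \<mu>: "\<And>t z. t \<in> {a..b} \<Longrightarrow> z \<in> closed_segment (\<Phi> t x) (\<Phi> t y) \<Longrightarrow> matrix_measure \<nu> (J t z) \<le> c"
  shows "\<nu> (\<Phi> b y - \<Phi> b x) \<le> \<nu> (\<Phi> a y - \<Phi> a x) * exp (c * (b - a))"
proof (cases "x = y")
  case True
  then show ?thesis by (simp add: is_norm_zero[OF \<nu>])
next
  case False
  define \<delta> where "\<delta> t = \<Phi> t y - \<Phi> t x" for t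
  have b: "t0 \<le> b" using ab by simp
  obtain R where R: "0 < R" "\<And>z t. z \<in> {x, y} \<Longrightarrow> t \<in> {t0..b} \<Longrightarrow> norm (\<Phi> t z) \<le> R"
    by (rule flow_bounded[of "{x, y}" b]) (use b in auto)
  have segR: "norm z \<le> R" if "z \<in> closed_segment (\<Phi> t x) (\<Phi> t y)" "t \<in> {t0..b}" for z t
    using that closed_segment_subset[of "\<Phi> t x" "cball 0 R" "\<Phi> t y"] R(2)[of x t] R(2)[of y t] by auto
  obtain L where L: "0 < L" "\<And>t v w. t \<in> {t0..b} \<Longrightarrow> norm v \<le> R \<Longrightarrow> norm (J t v *v w) \<le> L * norm w"
    "\<And>t x y. t \<in> {t0..b} \<Longrightarrow> norm x \<le> R \<Longrightarrow> norm y \<le> R \<Longrightarrow> norm (f t x - f t y) \<le> L * norm (x - y)"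
    by (rule J_bound[where T = b and r = R]) blast
  obtain C where C: "1 \<le> C"
    "\<And>z z' t. z \<in> {x, y} \<Longrightarrow> z' \<in> {x, y} \<Longrightarrow> t \<in> {t0..b} \<Longrightarrow> norm (\<Phi> t z' - \<Phi> t z) \<le> C * norm (z' - z)"
    "\<And>z z' t. z \<in> {x, y} \<Longrightarrow> z' \<in> {x, y} \<Longrightarrow> t \<in> {t0..b} \<Longrightarrow> norm (z' - z) \<le> C * norm (\<Phi> t z' - \<Phi> t z)"
    by (rule flow_lipschitz[of "{x, y}" b]) (use b in auto)
  obtain p where p: "0 < p" "\<And>z. p * norm z \<le> \<nu> z" using norm_le_is_norm[OF \<nu>] by blast
  obtain q where q: "0 < q" "\<And>z. \<nu> z \<le> q * norm z" using is_norm_le_norm[OF \<nu>] by blast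
  \<comment> \<open>Any two values of \<open>\<delta>\<close> are comparable through the initial
    difference \<open>y - x\<close>.\<close>
  have cmp: "norm (\<delta> s) \<le> C * C * norm (\<delta> t)" if "s \<in> {t0..b}" "t \<in> {t0..b}" for s t
  proof -
    have "norm (\<delta> s) \<le> C * norm (y - x)" unfolding \<delta>_def by (rule C(2)) (use that in auto)
    also have "\<dots> \<le> C * (C * norm (\<delta> t))" unfolding \<delta>_def
      by (intro mult_left_mono C(3)) (use that C in auto)
    finally show ?thesis by simp
  qed
  have lip: "norm (f s (\<Phi> s y) - f s (\<Phi> s x)) \<le> L * norm (\<delta> s)" if "s \<in> {t0..b}" for s
    unfolding \<delta>_def by (intro L(3) R(2) that) auto
  have int: "((\<lambda>s. f s (\<Phi> s y) - f s (\<Phi> s x)) has_integral (\<delta> v - \<delta> u)) {u..v}" if "t0 \<le> u" "u \<le> v" for u v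
    using has_integral_diff[OF flow_increment[OF that, of y] flow_increment[OF that, of x]]
    by (simp add: \<delta>_def algebra_simps)
  \<comment> \<open>One \<open>L\<close> and \<open>C * C\<close> bound the drift of
    \<open>\<delta>\<close> in terms of \<open>\<delta> v\<close>, the other \<open>L\<close> bounds
    the Jacobian; \<open>q\<close> and \<open>p\<close> translate between \<open>\<nu>\<close> and
    the Euclidean norm.\<close>
  define D where "D = q * L * L * C * C / p"
  have D: "0 < D" using p q L C by (simp add: D_def)
  have step: "\<nu> (\<delta> v) * (1 - (c + D * (v - u)) * (v - u)) \<le> \<nu> (\<delta> u)" if uv: "a \<le> u" "u \<le> v" "v \<le> b" for u v
  proof -
    have v: "v \<in> {t0..b}" using uv ab by auto
    \<comment> \<open>Distinct solutions never meet, so a supporting functional at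
      \<open>\<delta> v\<close> exists.\<close>
    have "norm (y - x) \<le> C * norm (\<delta> v)" unfolding \<delta>_def by (rule C(3)) (use v in auto)
    then have "\<delta> v \<noteq> 0" using False by auto
    then obtain w where w: "w \<bullet> \<delta> v = \<nu> (\<delta> v)" "\<And>z. w \<bullet> z \<le> \<nu> z"
      using is_norm_support_functional[OF \<nu>] by blast
    \<comment> \<open>The mean value theorem yields a Jacobian applied to \<open>\<delta> s\<close>,
      whereas \<open>w\<close> supports \<open>\<nu>\<close> at \<open>\<delta> v\<close>. Replacing
      one by the other costs the term with \<open>D\<close>.\<close>
    have bnd: "w \<bullet> (f s (\<Phi> s y) - f s (\<Phi> s x)) \<le> (c + D * (v - u)) * \<nu> (\<delta> v)" if s: "s \<in> {u..v}" for s
    proof -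
      have s0: "t0 \<le> s" and sb: "s \<in> {t0..b}" and sab: "s \<in> {a..b}" using s uv ab by auto
      obtain z where z: "z \<in> closed_segment (\<Phi> s x) (\<Phi> s y)"
        "w \<bullet> (f s (\<Phi> s y) - f s (\<Phi> s x)) = w \<bullet> (J s z *v \<delta> s)"
        unfolding \<delta>_def by (rule inner_mean_value[OF s0])
      have zR: "norm z \<le> R" by (rule segR[OF z(1) sb])
      have "norm (\<delta> v - \<delta> s) \<le> (L * (C * C * norm (\<delta> v))) * measure lborel {s..v}"
      proof (rule has_integral_bound_real[where S = "{}"])
        show "((\<lambda>s. f s (\<Phi> s y) - f s (\<Phi> s x)) has_integral (\<delta> v - \<delta> s)) {s..v}"
          by (rule int) (use s s0 in auto)
        fix r assume r: "r \<in> {s..v} - {}"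
        then have rb: "r \<in> {t0..b}" using s0 v by auto
        show "norm (f r (\<Phi> r y) - f r (\<Phi> r x)) \<le> L * (C * C * norm (\<delta> v))"
          using lip[OF rb] mult_left_mono[OF cmp[OF rb v] less_imp_le[OF L(1)]] by (rule order_trans)
      qed (use L C in auto)
      also have "\<dots> = L * (C * C * norm (\<delta> v)) * (v - s)" using s by simp
      also have "\<dots> \<le> L * (C * C * norm (\<delta> v)) * (v - u)" using s L C by (intro mult_left_mono) auto
      finally have near: "norm (\<delta> s - \<delta> v) \<le> L * (C * C * norm (\<delta> v)) * (v - u)"
        by (simp add: norm_minus_commute)
      have "w \<bullet> (J s z *v (\<delta> s - \<delta> v)) \<le> q * norm (J s z *v (\<delta> s - \<delta> v))"
        using w(2) q(2) order_trans by blast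
      also have "\<dots> \<le> q * (L * norm (\<delta> s - \<delta> v))" using L(2)[OF sb zR] q(1) by (intro mult_left_mono) auto
      also have "\<dots> \<le> q * (L * (L * (C * C * norm (\<delta> v)) * (v - u)))" using near L q by (intro mult_left_mono) auto
      also have "\<dots> = D * (v - u) * (p * norm (\<delta> v))" using p by (simp add: D_def)
      also have "\<dots> \<le> D * (v - u) * \<nu> (\<delta> v)" using p(2)[of "\<delta> v"] D uv by (intro mult_left_mono) auto
      finally have 1: "w \<bullet> (J s z *v (\<delta> s - \<delta> v)) \<le> D * (v - u) * \<nu> (\<delta> v)" .
      have "w \<bullet> (J s z *v \<delta> v) \<le> matrix_measure \<nu> (J s z) * \<nu> (\<delta> v)"
        by (rule support_functional_matrix_measure[OF \<nu> w])
      also have "\<dots> \<le> c * \<nu> (\<delta> v)" using \<mu>[OF sab z(1)] by (intro mult_right_mono is_norm_nonneg[OF \<nu>])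
      finally show ?thesis using 1 unfolding z(2)
        by (simp add: algebra_simps matrix_vector_mult_diff_distrib)
    qed
    have i1: "((\<lambda>s. w \<bullet> (f s (\<Phi> s y) - f s (\<Phi> s x))) has_integral w \<bullet> (\<delta> v - \<delta> u)) {u..v}"
      using has_integral_linear[OF int[of u v] bounded_linear_inner_right[of w]] uv ab by (simp add: o_def)
    have i2: "((\<lambda>s. (c + D * (v - u)) * \<nu> (\<delta> v)) has_integral (c + D * (v - u)) * \<nu> (\<delta> v) * (v - u)) {u..v}"
      using has_integral_const_real[of "(c + D * (v - u)) * \<nu> (\<delta> v)" u v] uv by (simp add: mult.commute)
    have "w \<bullet> (\<delta> v - \<delta> u) \<le> (c + D * (v - u)) * \<nu> (\<delta> v) * (v - u)"
      by (rule has_integral_le[OF i1 i2 bnd])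
    then show ?thesis using w(1) w(2)[of "\<delta> u"] by (simp add: algebra_simps inner_diff_right)
  qed
  have "\<nu> (\<delta> (- (- b))) * exp (- c * (- a - (- b))) \<le> \<nu> (\<delta> (- (- a)))"
  proof (rule exponential_growth_of_increments[where g = "\<lambda>s. \<nu> (\<delta> (- s))"])
    fix \<eta> :: real assume \<eta>: "0 < \<eta>"
    \<comment> \<open>Below the step length \<open>\<eta> / D\<close> the second-order error is
      absorbed by \<open>\<eta>\<close>.\<close>
    have "\<nu> (\<delta> (- u)) * (1 + (- c - \<eta>) * (v - u)) \<le> \<nu> (\<delta> (- v))"
      if "- b \<le> u" "u \<le> v" "v \<le> - a" "v - u < \<eta> / D" for u v
    proof -
      have "D * (v - u) \<le> \<eta>" using that(4) D by (simp add: field_simps)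
      then have "1 + (- c - \<eta>) * (v - u) \<le> 1 - (c + D * (v - u)) * (v - u)"
        using that(2) mult_right_mono[of "D * (v - u)" \<eta> "v - u"] by (simp add: algebra_simps)
      then have "\<nu> (\<delta> (- u)) * (1 + (- c - \<eta>) * (v - u)) \<le> \<nu> (\<delta> (- u)) * (1 - (c + D * (v - u)) * (v - u))"
        by (intro mult_left_mono is_norm_nonneg[OF \<nu>])
      also have "\<dots> \<le> \<nu> (\<delta> (- v))" using step[of "- v" "- u"] that by simp
      finally show ?thesis .
    qed
    then show "\<exists>d>0. \<forall>u v. - b \<le> u \<longrightarrow> u \<le> v \<longrightarrow> v \<le> - a \<longrightarrow> v - u < d \<longrightarrow>
      \<nu> (\<delta> (- u)) * (1 + (- c - \<eta>) * (v - u)) \<le> \<nu> (\<delta> (- v))"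
      using \<eta> D by (intro exI[of _ "\<eta> / D"]) auto
  qed (use ab is_norm_nonneg[OF \<nu>] in auto)
  then have "\<nu> (\<delta> b) * exp (- c * (b - a)) * exp (c * (b - a)) \<le> \<nu> (\<delta> a) * exp (c * (b - a))"
    by (intro mult_right_mono) auto
  then show ?thesis unfolding \<delta>_def by (simp add: mult.assoc flip: exp_add)
qed

text \<open>Over the reals, \<open>SUP\<close> is known to dominate its members only on a set
  bounded above; this makes the members of \<open>entropy_ball\<close> usable.\<close>

lemma flow_difference_bdd_above:
  assumes N: "is_norm N"
  shows "bdd_above ((\<lambda>t. N (\<Phi> t y - \<Phi> t x)) ` {t0..T})"
proof -
  have "continuous_on {t0..T} (\<lambda>t. N (\<Phi> t y - \<Phi> t x))"
    by (rule continuous_on_compose2[OF is_norm_continuous_on[OF N, of UNIV]])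
       (auto intro!: continuous_intros flow_continuous_on)
  then have "compact ((\<lambda>t. N (\<Phi> t y - \<Phi> t x)) ` {t0..T})"
    by (rule compact_continuous_image) simp
  then show ?thesis by (intro bounded_imp_bdd_above compact_imp_bounded)
qed

lemma entropy_ballD:
  assumes N: "is_norm N" and y: "y \<in> entropy_ball N f t0 x \<epsilon> T" and t: "t \<in> {t0..t0 + T}"
  shows "N (\<Phi> t y - \<Phi> t x) < \<epsilon>"
proof -
  have "N (\<Phi> t y - \<Phi> t x) \<le> (SUP t\<in>{t0..t0 + T}. N (\<Phi> t y - \<Phi> t x))"
    by (rule cSUP_upper[OF t flow_difference_bdd_above[OF N]])
  with y show ?thesis by (simp add: entropy_ball_def)
qed

text \<open>Bounds on all members pass to a supremum only as nonstrict inequalities, hence the gap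
  between \<open>\<epsilon>'\<close> and \<open>\<epsilon>\<close>.\<close>

lemma entropy_ballI:
  assumes T: "0 \<le> T" and le: "\<And>t. t \<in> {t0..t0 + T} \<Longrightarrow> N (\<Phi> t y - \<Phi> t x) \<le> \<epsilon>'" and "\<epsilon>' < \<epsilon>"
  shows "y \<in> entropy_ball N f t0 x \<epsilon> T"
proof -
  have "(SUP t\<in>{t0..t0 + T}. N (\<Phi> t y - \<Phi> t x)) \<le> \<epsilon>'"
    by (rule cSUP_least) (use T le in auto)
  then show ?thesis using assms(3) by (simp add: entropy_ball_def)
qed

text \<open>A net whose mesh is scaled by the expansion factor \<open>A\<close> of the flow on \<open>{t0..t0 + T}\<close>.\<close>

lemma spanning_card_le:
  assumes K: "K \<subseteq> cball 0 r" and r: "0 \<le> r" and N: "is_norm N" and \<epsilon>: "0 < \<epsilon>" and T: "0 \<le> T" and A: "\<epsilon> \<le> 2 * A"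
    and exp: "\<And>x y t. x \<in> K \<Longrightarrow> y \<in> K \<Longrightarrow> t \<in> {t0..t0 + T} \<Longrightarrow> N (\<Phi> t y - \<Phi> t x) \<le> A * norm (y - x)"
  obtains E where "finite E" "spanning N f t0 \<epsilon> T K E"
    "real (card E) \<le> (4 * (r + 1) * A / \<epsilon>) ^ CARD('n)"
proof -
  \<comment> \<open>Half of the admissible radius, to leave the gap that
    \<open>entropy_ballI\<close> asks for. The condition \<open>\<epsilon> \<le> 2 * A\<close> keeps
    the mesh at most \<open>1\<close>, so that \<open>r + \<rho>\<close> is at most
    \<open>r + 1\<close>.\<close>
  define \<rho> where "\<rho> = \<epsilon> / (2 * A)"
  have A0: "0 < A" using \<epsilon> A by simp
  have \<rho>: "0 < \<rho>" "\<rho> \<le> 1" using \<epsilon> A A0 by (auto simp: \<rho>_def)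
  obtain E where E: "finite E" "E \<subseteq> K" "\<And>x. x \<in> K \<Longrightarrow> \<exists>y\<in>E. dist x y < \<rho>"
    "real (card E) \<le> (2 * (r + \<rho>) / \<rho>) ^ DIM(real^'n)"
    using finite_net[OF K r \<rho>(1)] by blast
  show ?thesis
  proof (rule that[OF E(1)])
    have "y \<in> (\<Union>x\<in>E. entropy_ball N f t0 x \<epsilon> T)" if y: "y \<in> K" for y
    proof -
      obtain x where x: "x \<in> E" "norm (y - x) < \<rho>" using E(3)[OF y] by (auto simp: dist_norm)
      have "y \<in> entropy_ball N f t0 x \<epsilon> T"
      proof (rule entropy_ballI[OF T])
        fix t assume "t \<in> {t0..t0 + T}"
        then have "N (\<Phi> t y - \<Phi> t x) \<le> A * norm (y - x)" using x y E(2) by (intro exp) auto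
        also have "\<dots> \<le> A * \<rho>" using x A0 by (intro mult_left_mono) auto
        finally show "N (\<Phi> t y - \<Phi> t x) \<le> \<epsilon> / 2" using A0 by (simp add: \<rho>_def)
      qed (use \<epsilon> in simp)
      then show ?thesis using x by blast
    qed
    then show "spanning N f t0 \<epsilon> T K E" using E(2) by (auto simp: spanning_def)
    have "2 * (r + \<rho>) / \<rho> \<le> 2 * (r + 1) / \<rho>" using \<rho> by (intro divide_right_mono) auto
    also have "\<dots> = 4 * (r + 1) * A / \<epsilon>" using A0 \<epsilon> by (simp add: \<rho>_def field_simps)
    finally have "(2 * (r + \<rho>) / \<rho>) ^ CARD('n) \<le> (4 * (r + 1) * A / \<epsilon>) ^ CARD('n)"
      using r \<rho> by (intro power_mono) auto
    then show "real (card E) \<le> (4 * (r + 1) * A / \<epsilon>) ^ CARD('n)" using E(4) by simp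
  qed
qed

text \<open>The infimum in \<open>min_spanning_card\<close> is over natural numbers and is attained
  once there is a finite spanning set at all.\<close>

lemma finite_spanning_exists:
  assumes K: "compact K" and N: "is_norm N" and \<epsilon>: "0 < \<epsilon>" and T: "0 \<le> T"
  obtains E where "finite E" "spanning N f t0 \<epsilon> T K E"
proof -
  have "t0 \<le> t0 + T" using T by simp
  then obtain C where C: "1 \<le> C"
    "\<And>x y t. x \<in> K \<Longrightarrow> y \<in> K \<Longrightarrow> t \<in> {t0..t0 + T} \<Longrightarrow> norm (\<Phi> t y - \<Phi> t x) \<le> C * norm (y - x)"
    by (rule flow_lipschitz[OF K]) blast
  obtain q where q: "0 < q" "\<And>z. N z \<le> q * norm z" using is_norm_le_norm[OF N] by blast
  obtain r where r: "0 \<le> r" "K \<subseteq> cball 0 r"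
    by (rule compact_subset_cball_0[OF K])
  show ?thesis
  proof (rule spanning_card_le[OF r(2,1) N \<epsilon> T])
    \<comment> \<open>The maximum with \<open>\<epsilon>\<close> enlarges the expansion factor to
      meet the side condition on the mesh.\<close>
    show "\<epsilon> \<le> 2 * max (q * C) \<epsilon>" using \<epsilon> by simp
    fix x y t assume *: "x \<in> K" "y \<in> K" "t \<in> {t0..t0 + T}"
    have "N (\<Phi> t y - \<Phi> t x) \<le> q * norm (\<Phi> t y - \<Phi> t x)" by (rule q)
    also have "\<dots> \<le> q * (C * norm (y - x))" by (intro mult_left_mono C *) (use q in auto)
    also have "\<dots> \<le> max (q * C) \<epsilon> * norm (y - x)" by (simp add: mult.assoc[symmetric] mult_right_mono)
    finally show "N (\<Phi> t y - \<Phi> t x) \<le> max (q * C) \<epsilon> * norm (y - x)" .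
  qed (use that in blast)
qed

end

subsection \<open>Entropy and the upper bound\<close>

context C1_system begin

context
  fixes N :: "real^'n \<Rightarrow> real" and K :: "(real^'n) set"
  assumes N: "is_norm N" and K: "compact K" and K0: "K \<noteq> {}"
begin

lemma min_spanning_card_le:
  "finite E \<Longrightarrow> spanning N f t0 \<epsilon> T K E \<Longrightarrow> min_spanning_card N f t0 \<epsilon> T K \<le> card E"
  unfolding min_spanning_card_def by (intro wellorder_Inf_le1) auto

lemma min_spanning_card_attained:
  assumes "0 < \<epsilon>" "0 \<le> T"
  obtains E where "finite E" "spanning N f t0 \<epsilon> T K E" "card E = min_spanning_card N f t0 \<epsilon> T K"
proof -
  have "card ` {E. finite E \<and> spanning N f t0 \<epsilon> T K E} \<noteq> {}"
    using finite_spanning_exists[OF K N assms] by blast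
  from Inf_nat_def1[OF this] show ?thesis using that by (auto simp: min_spanning_card_def)
qed

text \<open>Keeps the count in the range where \<open>ln\<close> is monotone and
  nonnegative.\<close>

lemma min_spanning_card_pos:
  assumes "0 < \<epsilon>" "0 \<le> T"
  shows "1 \<le> min_spanning_card N f t0 \<epsilon> T K"
proof -
  obtain E where E: "finite E" "spanning N f t0 \<epsilon> T K E" "card E = min_spanning_card N f t0 \<epsilon> T K"
    by (rule min_spanning_card_attained[OF assms])
  then have "E \<noteq> {}" using K0 by (auto simp: spanning_def)
  then show ?thesis using E(1) unfolding E(3)[symmetric] by (simp add: Suc_le_eq card_gt_0_iff)
qed

lemma entropy_ball_mono: "\<epsilon> \<le> \<epsilon>' \<Longrightarrow> entropy_ball N f t0 x \<epsilon> T \<subseteq> entropy_ball N f t0 x \<epsilon>' T"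
  unfolding entropy_ball_def by (intro Collect_mono) linarith

lemma min_spanning_card_antimono:
  assumes "0 < \<epsilon>" "\<epsilon> \<le> \<epsilon>'" "0 \<le> T"
  shows "min_spanning_card N f t0 \<epsilon>' T K \<le> min_spanning_card N f t0 \<epsilon> T K"
proof -
  obtain E where E: "finite E" "spanning N f t0 \<epsilon> T K E" "card E = min_spanning_card N f t0 \<epsilon> T K"
    by (rule min_spanning_card_attained[OF assms(1,3)])
  then have "spanning N f t0 \<epsilon>' T K E"
    using entropy_ball_mono[OF assms(2)] unfolding spanning_def by blast
  then show ?thesis using min_spanning_card_le[OF E(1)] unfolding E(3)[symmetric] by simp
qed

definition growth_rate :: "real \<Rightarrow> ereal" where
  "growth_rate \<epsilon> = Limsup at_top (\<lambda>T. ereal (1 / T * ln (real (min_spanning_card N f t0 \<epsilon> T K))))"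

lemma growth_rate_antimono:
  assumes "0 < \<epsilon>" "\<epsilon> \<le> \<epsilon>'"
  shows "growth_rate \<epsilon>' \<le> growth_rate \<epsilon>"
  unfolding growth_rate_def
proof (rule Limsup_mono)
  have "ereal (1 / T * ln (real (min_spanning_card N f t0 \<epsilon>' T K)))
      \<le> ereal (1 / T * ln (real (min_spanning_card N f t0 \<epsilon> T K)))" if T: "0 < T" for T
  proof -
    have "1 \<le> min_spanning_card N f t0 \<epsilon>' T K"
      using assms T by (intro min_spanning_card_pos) auto
    moreover have "min_spanning_card N f t0 \<epsilon>' T K \<le> min_spanning_card N f t0 \<epsilon> T K"
      using assms T by (intro min_spanning_card_antimono) auto
    ultimately show ?thesis using T by (simp add: divide_right_mono)
  qed
  then show "\<forall>\<^sub>F T in at_top. ereal (1 / T * ln (real (min_spanning_card N f t0 \<epsilon>' T K)))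
      \<le> ereal (1 / T * ln (real (min_spanning_card N f t0 \<epsilon> T K)))"
    by (intro eventually_mono[OF eventually_gt_at_top[of 0]])
qed

text \<open>A smaller \<open>\<epsilon>\<close> asks for more centres, so the growth rate is
  antitone and its limit from the right at \<open>0\<close> exists as the supremum. The sign is
  changed to apply a criterion for increasing functions.\<close>

lemma topological_entropy_eq_SUP: "topological_entropy N f t0 K = (SUP \<epsilon>\<in>{0<..}. growth_rate \<epsilon>)"
proof -
  have "((\<lambda>\<epsilon>. - growth_rate \<epsilon>) \<longlongrightarrow> Inf ((\<lambda>\<epsilon>. - growth_rate \<epsilon>) ` ({0<..} \<inter> UNIV))) (at 0 within ({0<..} \<inter> UNIV))"
    by (rule Lim_right_bound[where K = "-\<infinity>"]) (auto intro: growth_rate_antimono)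
  then have "((\<lambda>\<epsilon>. - growth_rate \<epsilon>) \<longlongrightarrow> - (SUP \<epsilon>\<in>{0<..}. growth_rate \<epsilon>)) (at_right 0)"
    by (simp add: ereal_INF_uminus_eq)
  then have "(growth_rate \<longlongrightarrow> (SUP \<epsilon>\<in>{0<..}. growth_rate \<epsilon>)) (at_right 0)"
    by (subst ereal_Lim_uminus)
  then show ?thesis
    unfolding topological_entropy_def growth_rate_def by (intro tendsto_Lim) auto
qed

text \<open>A constant factor \<open>D\<close> contributes \<open>ln D / T\<close>, which vanishes
  in the limit. The effect of any fixed initial period can thus be hidden in
  \<open>D\<close>.\<close>

lemma growth_rate_le:
  assumes D: "0 < D" and le: "\<And>T. T1 \<le> T \<Longrightarrow> real (min_spanning_card N f t0 \<epsilon> T K) \<le> D * exp (c * T)"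
    and \<epsilon>: "0 < \<epsilon>"
  shows "growth_rate \<epsilon> \<le> ereal c"
proof -
  have "growth_rate \<epsilon> \<le> Limsup at_top (\<lambda>T. ereal (ln D / T + c))"
    unfolding growth_rate_def
  proof (rule Limsup_mono)
    have "ereal (1 / T * ln (real (min_spanning_card N f t0 \<epsilon> T K))) \<le> ereal (ln D / T + c)"
      if T: "max T1 0 < T" for T
    proof -
      have "1 \<le> min_spanning_card N f t0 \<epsilon> T K" using \<epsilon> T by (intro min_spanning_card_pos) auto
      then have "ln (real (min_spanning_card N f t0 \<epsilon> T K)) \<le> ln (D * exp (c * T))"
        using le[of T] T D by (subst ln_le_cancel_iff) auto
      also have "\<dots> = ln D + c * T" using D by (simp add: ln_mult)
      finally show ?thesis using T by (simp add: field_simps)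
    qed
    then show "\<forall>\<^sub>F T in at_top. ereal (1 / T * ln (real (min_spanning_card N f t0 \<epsilon> T K))) \<le> ereal (ln D / T + c)"
      by (intro eventually_mono[OF eventually_gt_at_top[of "max T1 0"]])
  qed
  also have "\<dots> = ereal c"
  proof (rule lim_imp_Limsup)
    have "((\<lambda>T. ln D / T + c) \<longlongrightarrow> 0 + c) at_top"
      by (intro tendsto_add tendsto_const real_tendsto_divide_at_top[OF tendsto_const] filterlim_ident)
    then show "((\<lambda>T. ereal (ln D / T + c)) \<longlongrightarrow> ereal c) at_top" by simp
  qed simp
  finally show ?thesis .
qed

lemma growth_rate_ge:
  assumes D: "0 < D" and le: "\<And>T. T1 \<le> T \<Longrightarrow> D * exp (c * T) \<le> real (min_spanning_card N f t0 \<epsilon> T K)"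
  shows "ereal c \<le> growth_rate \<epsilon>"
proof -
  have "ereal c = Limsup at_top (\<lambda>T. ereal (ln D / T + c))"
  proof (rule lim_imp_Limsup[symmetric])
    have "((\<lambda>T. ln D / T + c) \<longlongrightarrow> 0 + c) at_top"
      by (intro tendsto_add tendsto_const real_tendsto_divide_at_top[OF tendsto_const] filterlim_ident)
    then show "((\<lambda>T. ereal (ln D / T + c)) \<longlongrightarrow> ereal c) at_top" by simp
  qed simp
  also have "\<dots> \<le> growth_rate \<epsilon>"
    unfolding growth_rate_def
  proof (rule Limsup_mono)
    have "ereal (ln D / T + c) \<le> ereal (1 / T * ln (real (min_spanning_card N f t0 \<epsilon> T K)))"
      if T: "max T1 0 < T" for T
    proof -
      have "0 < D * exp (c * T)" using D by simp
      \<comment> \<open>Positivity of the count is read off from the lower bound itself.\<close>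
      moreover from this have "0 < real (min_spanning_card N f t0 \<epsilon> T K)" using le[of T] T by linarith
      ultimately have "ln (D * exp (c * T)) \<le> ln (real (min_spanning_card N f t0 \<epsilon> T K))"
        using le[of T] T by (subst ln_le_cancel_iff) auto
      moreover have "ln (D * exp (c * T)) = ln D + c * T" using D by (simp add: ln_mult)
      ultimately have "(ln D + c * T) / T \<le> ln (real (min_spanning_card N f t0 \<epsilon> T K)) / T"
        using T by (intro divide_right_mono) auto
      then show ?thesis using T by (simp add: add_divide_distrib)
    qed
    then show "\<forall>\<^sub>F T in at_top. ereal (ln D / T + c) \<le> ereal (1 / T * ln (real (min_spanning_card N f t0 \<epsilon> T K)))"
      by (intro eventually_mono[OF eventually_gt_at_top[of "max T1 0"]])
  qed
  finally show ?thesis .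
qed

lemma topological_entropy_nonneg: "0 \<le> topological_entropy N f t0 K"
proof -
  have "ereal 0 \<le> growth_rate 1"
  proof (rule growth_rate_ge[of 1 0])
    show "1 * exp (0 * T) \<le> real (min_spanning_card N f t0 1 T K)" if "0 \<le> T" for T
      using min_spanning_card_pos[of 1 T] that by simp
  qed simp
  also have "\<dots> \<le> topological_entropy N f t0 K"
    unfolding topological_entropy_eq_SUP by (rule SUP_upper) simp
  finally show ?thesis by (simp add: zero_ereal_def)
qed

text \<open>Up to \<open>T1\<close> the flow is merely Lipschitz, afterwards differences grow at
  rate \<open>c\<close>. Because of \<open>0 \<le> c\<close>, the single factor
  \<open>exp (c * T)\<close> serves all times of the window.\<close>

lemma topological_entropy_le:
  assumes \<nu>: "is_norm \<nu>" and c: "0 \<le> c" and \<mu>: "mu_hat \<nu> f t0 K < ereal c"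
  shows "topological_entropy N f t0 K \<le> ereal (real CARD('n) * c)"
  unfolding topological_entropy_eq_SUP
proof (rule SUP_least)
  fix \<epsilon> :: real assume "\<epsilon> \<in> {0<..}"
  then have \<epsilon>: "0 < \<epsilon>" by simp
  from Limsup_lessD[OF \<mu>[unfolded mu_hat_def]] obtain a where a:
    "\<And>t. a \<le> t \<Longrightarrow> (SUP v\<in>convex hull (\<lambda>x. \<Phi> t x) ` K. ereal (matrix_measure \<nu> (J t v))) < ereal c"
    by (auto simp: eventually_at_top_linorder)
  define T1 where "T1 = max a t0"
  have T1: "t0 \<le> T1" by (simp add: T1_def)
  have mu_le: "matrix_measure \<nu> (J t z) \<le> c"
    if "T1 \<le> t" "x \<in> K" "y \<in> K" "z \<in> closed_segment (\<Phi> t x) (\<Phi> t y)" for t x y z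
  proof -
    have "closed_segment (\<Phi> t x) (\<Phi> t y) \<subseteq> convex hull (\<lambda>x. \<Phi> t x) ` K"
      using that by (intro closed_segment_subset convex_convex_hull hull_inc) auto
    then have "ereal (matrix_measure \<nu> (J t z)) \<le> (SUP v\<in>convex hull (\<lambda>x. \<Phi> t x) ` K. ereal (matrix_measure \<nu> (J t v)))"
      using that(4) by (intro SUP_upper) auto
    also have "\<dots> < ereal c" using that(1) by (intro a) (simp add: T1_def)
    finally show ?thesis by simp
  qed
  obtain C where C: "1 \<le> C"
    "\<And>x y t. x \<in> K \<Longrightarrow> y \<in> K \<Longrightarrow> t \<in> {t0..T1} \<Longrightarrow> norm (\<Phi> t y - \<Phi> t x) \<le> C * norm (y - x)"
    by (rule flow_lipschitz[OF K T1]) blast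
  obtain p where p: "0 < p" "\<And>z. p * norm z \<le> \<nu> z" using norm_le_is_norm[OF \<nu>] by blast
  obtain q where q: "0 < q" "\<And>z. \<nu> z \<le> q * norm z" using is_norm_le_norm[OF \<nu>] by blast
  obtain q' where q': "0 < q'" "\<And>z. N z \<le> q' * norm z" using is_norm_le_norm[OF N] by blast
  obtain r where r: "0 \<le> r" "K \<subseteq> cball 0 r"
    by (rule compact_subset_cball_0[OF K])
  \<comment> \<open>The value \<open>1\<close> serves times up to \<open>T1\<close>; afterwards the
    detour through \<open>\<nu>\<close> costs \<open>q / p\<close>.\<close>
  define M where "M = max 1 (q / p)"
  have M: "1 \<le> M" by (simp add: M_def)
  \<comment> \<open>Including \<open>\<epsilon>\<close> gives the expansion factor the size that
    \<open>spanning_card_le\<close> demands, for every \<open>T\<close>.\<close>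
  define B where "B = max \<epsilon> (q' * M * C)"
  have B: "0 < B" using \<epsilon> by (simp add: B_def)
  have exp_bound: "N (\<Phi> t y - \<Phi> t x) \<le> B * exp (c * T) * norm (y - x)"
    if xy: "x \<in> K" "y \<in> K" and T: "0 \<le> T" and t: "t \<in> {t0..t0 + T}" for x y t T
  proof -
    have "norm (\<Phi> t y - \<Phi> t x) \<le> M * exp (c * T) * (C * norm (y - x))"
    proof (cases "t \<le> T1")
      case True
      have "norm (\<Phi> t y - \<Phi> t x) \<le> 1 * (C * norm (y - x))" using C(2) xy t True by simp
      also have "1 * (C * norm (y - x)) \<le> M * exp (c * T) * (C * norm (y - x))"
        using M C c T mult_mono[of 1 M 1 "exp (c * T)"] by (intro mult_right_mono) auto
      finally show ?thesis .
    next
      case False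
      have "\<nu> (\<Phi> t y - \<Phi> t x) \<le> \<nu> (\<Phi> T1 y - \<Phi> T1 x) * exp (c * (t - T1))"
        by (rule flow_difference_growth[OF \<nu> T1]) (use False mu_le xy in auto)
      also have "\<dots> \<le> (q * (C * norm (y - x))) * exp (c * T)"
      proof (rule mult_mono)
        have "\<nu> (\<Phi> T1 y - \<Phi> T1 x) \<le> q * norm (\<Phi> T1 y - \<Phi> T1 x)" by (rule q)
        also have "\<dots> \<le> q * (C * norm (y - x))"
          by (intro mult_left_mono C xy) (use q T1 in auto)
        finally show "\<nu> (\<Phi> T1 y - \<Phi> T1 x) \<le> q * (C * norm (y - x))" .
        show "exp (c * (t - T1)) \<le> exp (c * T)"
          using t T1 c by (auto intro!: mult_left_mono)
      qed (use q C is_norm_nonneg[OF \<nu>] in auto)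
      finally have "p * norm (\<Phi> t y - \<Phi> t x) \<le> (q * (C * norm (y - x))) * exp (c * T)"
        using p(2) order_trans by blast
      then have "norm (\<Phi> t y - \<Phi> t x) \<le> q / p * exp (c * T) * (C * norm (y - x))"
        using p(1) by (simp add: field_simps)
      also have "\<dots> \<le> M * exp (c * T) * (C * norm (y - x))"
        using C by (intro mult_right_mono) (auto simp: M_def)
      finally show ?thesis .
    qed
    then have "q' * norm (\<Phi> t y - \<Phi> t x) \<le> q' * (M * exp (c * T) * (C * norm (y - x)))"
      using q'(1) by (intro mult_left_mono) auto
    also have "\<dots> = q' * M * C * (exp (c * T) * norm (y - x))" by simp
    also have "\<dots> \<le> B * (exp (c * T) * norm (y - x))"
      by (intro mult_right_mono) (auto simp: B_def)
    finally show ?thesis using q'(2)[of "\<Phi> t y - \<Phi> t x"] by (simp add: mult.assoc)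
  qed
  define D where "D = (4 * (r + 1) * B / \<epsilon>) ^ CARD('n)"
  show "growth_rate \<epsilon> \<le> ereal (real CARD('n) * c)"
  proof (rule growth_rate_le[OF _ _ \<epsilon>])
    show "0 < D" using r B \<epsilon> by (simp add: D_def)
    fix T :: real assume T: "0 \<le> T"
    have "B \<le> B * exp (c * T)" using B c T by simp
    then have A: "\<epsilon> \<le> 2 * (B * exp (c * T))" using \<epsilon> by (simp add: B_def)
    obtain E where E: "finite E" "spanning N f t0 \<epsilon> T K E"
      "real (card E) \<le> (4 * (r + 1) * (B * exp (c * T)) / \<epsilon>) ^ CARD('n)"
      by (rule spanning_card_le[OF r(2,1) N \<epsilon> T A exp_bound]) (use T in auto)
    have "real (min_spanning_card N f t0 \<epsilon> T K) \<le> real (card E)"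
      using min_spanning_card_le[OF E(1,2)] by simp
    also have "\<dots> \<le> D * exp (c * T) ^ CARD('n)"
      using E(3) by (simp add: D_def power_mult_distrib power_divide)
    also have "\<dots> = D * exp (real CARD('n) * c * T)"
      by (simp add: exp_of_nat_mult[symmetric] mult.assoc)
    finally show "real (min_spanning_card N f t0 \<epsilon> T K) \<le> D * exp (real CARD('n) * c * T)" .
  qed
qed

lemma topological_entropy_upper_bound:
  assumes \<nu>: "is_norm \<nu>"
  shows "topological_entropy N f t0 K \<le> ereal (real CARD('n)) * max (mu_hat \<nu> f t0 K) 0"
proof (cases "max (mu_hat \<nu> f t0 K) 0")
  case (real m)
  have m0: "0 \<le> m" using max.cobounded2[of 0 "mu_hat \<nu> f t0 K"] unfolding real by simp
  show ?thesis
  proof (rule ereal_le_epsilon2)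
    fix e :: real assume e: "0 < e"
    have "mu_hat \<nu> f t0 K \<le> ereal m" unfolding real[symmetric] by simp
    \<comment> \<open>The slack is divided by the dimension, which later multiplies the
      rate.\<close>
    also have "\<dots> < ereal (m + e / real CARD('n))" using e by simp
    finally have "topological_entropy N f t0 K \<le> ereal (real CARD('n) * (m + e / real CARD('n)))"
      using m0 e by (intro topological_entropy_le[OF \<nu>]) auto
    also have "\<dots> = ereal (real CARD('n)) * max (mu_hat \<nu> f t0 K) 0 + ereal e"
      unfolding real by (simp add: algebra_simps)
    finally show "topological_entropy N f t0 K \<le> ereal (real CARD('n)) * max (mu_hat \<nu> f t0 K) 0 + ereal e" .
  qed
next
  case MInf
  moreover have "(0 :: ereal) \<le> max (mu_hat \<nu> f t0 K) 0" by simp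
  ultimately show ?thesis by (simp add: max_def split: if_splits)
qed simp

end

end

subsection \<open>The linearised flow\<close>

text \<open>The forcing term \<open>\<rho>\<close> is measured by its integral, since this is what
  dominated convergence can make small for the linearisation error; a bound uniform in time is not
  at hand.\<close>

lemma gronwall_inhomogeneous:
  fixes e :: "real \<Rightarrow> 'a::euclidean_space"
  assumes int: "\<And>t. t \<in> {a..b} \<Longrightarrow> (g has_integral e t) {a..t}"
    and g: "\<And>s. s \<in> {a..b} \<Longrightarrow> norm (g s) \<le> L * norm (e s) + \<rho> s"
    and \<rho>: "\<rho> integrable_on {a..b}" "\<And>s. s \<in> {a..b} \<Longrightarrow> 0 \<le> \<rho> s"
    and L: "0 \<le> L" and t: "t \<in> {a..b}"
  shows "norm (e t) \<le> integral {a..b} \<rho> * exp (L * (b - a))"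
proof -
  \<comment> \<open>The equation on the degenerate interval says that \<open>e\<close> starts at
    \<open>0\<close>.\<close>
  have "(g has_integral e a) {a}" using int[of a] t by auto
  then have "e a = 0" by (rule has_integral_unique[OF _ has_integral_refl(2)])
  then have c: "continuous_on {a..b} (\<lambda>s. norm (e s))"
    by (intro continuous_intros continuous_on_has_integral_increment[where g = g]) (use int in auto)
  have "norm (e t) \<le> integral {a..b} \<rho> * exp (L * (t - a))"
  proof (rule gronwall_integral[OF c L _ t])
    fix t assume t: "t \<in> {a..b}"
    have i1: "(\<lambda>s. L * norm (e s)) integrable_on {a..t}"
      by (intro integrable_continuous_real continuous_intros continuous_on_subset[OF c]) (use t in auto)
    have i2: "\<rho> integrable_on {a..t}" by (rule integrable_subinterval_real[OF \<rho>(1)]) (use t in auto)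
    have "norm (integral {a..t} g) \<le> integral {a..t} (\<lambda>s. L * norm (e s) + \<rho> s)"
      by (rule Henstock_Kurzweil_Integration.integral_norm_bound_integral)
         (use t int g i1 i2 in \<open>auto intro!: integrable_add\<close>)
    also have "\<dots> = L * integral {a..t} (\<lambda>s. norm (e s)) + integral {a..t} \<rho>"
      by (subst Henstock_Kurzweil_Integration.integral_add[OF i1 i2]) simp
    also have "integral {a..t} \<rho> \<le> integral {a..b} \<rho>"
      by (rule integral_subset_le[OF _ i2 \<rho>(1)]) (use t \<rho>(2) in auto)
    finally show "norm (e t) \<le> integral {a..b} \<rho> + L * integral {a..t} (\<lambda>s. norm (e s))"
      using integral_unique[OF int[OF t]] by simp
  qed
  also have "\<dots> \<le> integral {a..b} \<rho> * exp (L * (b - a))"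
    using t L Henstock_Kurzweil_Integration.integral_nonneg[OF \<rho>] by (intro mult_left_mono) (auto intro!: mult_left_mono)
  finally show ?thesis .
qed

lemma bounded_measurable_integrable_on_interval:
  fixes g :: "real \<Rightarrow> 'a::euclidean_space"
  assumes "g \<in> borel_measurable (lebesgue_on {a..b})" "\<And>s. s \<in> {a..b} \<Longrightarrow> norm (g s) \<le> B"
  shows "g integrable_on {a..b}"
  by (rule measurable_bounded_by_integrable_imp_integrable[where g = "\<lambda>_. B"]) (use assms in auto)

lemma continuous_on_interval_bounded:
  fixes p :: "real \<Rightarrow> 'b::real_normed_vector"
  assumes "continuous_on {a..b} p"
  obtains B where "0 \<le> B" "\<And>s. s \<in> {a..b} \<Longrightarrow> norm (p s) \<le> B"
proof -
  have "compact (p ` {a..b})" by (rule compact_continuous_image[OF assms]) simp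
  then obtain B where "0 \<le> B" "p ` {a..b} \<subseteq> cball 0 B" by (rule compact_subset_cball_0)
  then show ?thesis using that by (auto simp: image_subset_iff)
qed

section \<open>Measurability along trajectories and the linearisation error\<close>

context C1_system begin

text \<open>On a bounded interval there are finitely many jumps. Their times may depend on the state
  \<open>v\<close>, so measurability along a moving state needs an argument of its own.\<close>

lemma f_measurable: "(\<lambda>s. f s v) \<in> borel_measurable (lebesgue_on {t0..T})"
proof -
  obtain D where D: "\<And>b. finite (D \<inter> {t0..b})"
    "\<And>t. t \<in> {t0..} - D \<Longrightarrow> continuous (at t within {t0..}) (\<lambda>t. f t v)"
    using pc[of v] unfolding piecewise_continuous_from_def by blast
  define S where "S = {t0..T} - D \<inter> {t0..T}"
  have S: "S \<in> sets borel"
    unfolding S_def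
    by (intro sets.Diff borel_closed[OF closed_atLeastAtMost] borel_closed[OF finite_imp_closed[OF D(1)]])
  have "continuous_on S (\<lambda>s. f s v)"
    unfolding continuous_on_eq_continuous_within
    by (intro ballI continuous_within_subset[OF D(2)]) (auto simp: S_def)
  then have "(\<lambda>s. indicator S s *\<^sub>R f s v) \<in> borel_measurable borel"
    by (rule borel_measurable_continuous_on_indicator[OF S])
  then have "(\<lambda>s. indicator S s *\<^sub>R f s v) \<in> borel_measurable lebesgue"
    by (rule measurable_compose[OF id_borel_measurable_lebesgue[unfolded id_def]])
  then have "(\<lambda>s. indicator S s *\<^sub>R f s v) \<in> borel_measurable (lebesgue_on {t0..T})"
    by (rule measurable_restrict_space1)
  then show ?thesis
  proof (rule measurable_discrete_difference)
    show "countable (D \<inter> {t0..T})" using D(1) by (rule countable_finite)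
    show "{s} \<in> sets (lebesgue_on {t0..T})" if "s \<in> D \<inter> {t0..T}" for s
      using that by (auto simp: sets_restrict_space_iff)
    show "indicator S s *\<^sub>R f s v = f s v" if "s \<in> space (lebesgue_on {t0..T})" "s \<notin> D \<inter> {t0..T}" for s
      using that by (auto simp: S_def)
  qed simp
qed

lemma f_continuous: "t0 \<le> t \<Longrightarrow> continuous_on S (f t)"
  using has_derivative_J[of t] by (meson continuous_at_imp_continuous_on has_derivative_continuous)

text \<open>Approximating the curve \<open>p\<close> by step functions with countably many values reduces this to constant \<open>p\<close>.\<close>

lemma f_along_curve_measurable:
  assumes p: "continuous_on {t0..T} p" and T: "t0 \<le> T"
  shows "(\<lambda>s. f s (p s)) \<in> borel_measurable (lebesgue_on {t0..T})"
proof (rule borel_measurable_LIMSEQ_metric)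
  \<comment> \<open>Times are rounded down to multiples of \<open>1 / Suc k\<close> and clamped,
    since rounding may leave \<open>{t0..T}\<close>, outside of which \<open>p\<close> is not
    controlled.\<close>
  define \<tau> where "\<tau> k s = max t0 (min T (of_int \<lfloor>real (Suc k) * s\<rfloor> / real (Suc k)))" for k s
  have \<tau>: "\<tau> k s \<in> {t0..T}" for k s using T by (auto simp: \<tau>_def)
  have "(\<lambda>s. (\<lambda>j s. f s (p (max t0 (min T (of_int j / real (Suc k)))))) \<lfloor>real (Suc k) * s\<rfloor> s)
     \<in> borel_measurable (lebesgue_on {t0..T})" for k
  proof (rule measurable_compose_countable[OF f_measurable])
    have "(\<lambda>s. \<lfloor>real (Suc k) * s\<rfloor>) \<in> borel \<rightarrow>\<^sub>M count_space UNIV" by measurable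
    then have "(\<lambda>s. \<lfloor>real (Suc k) * s\<rfloor>) \<in> lebesgue \<rightarrow>\<^sub>M count_space UNIV"
      by (rule measurable_compose[OF id_borel_measurable_lebesgue[unfolded id_def]])
    then show "(\<lambda>s. \<lfloor>real (Suc k) * s\<rfloor>) \<in> lebesgue_on {t0..T} \<rightarrow>\<^sub>M count_space UNIV"
      by (rule measurable_restrict_space1)
  qed
  then show "(\<lambda>s. f s (p (\<tau> k s))) \<in> borel_measurable (lebesgue_on {t0..T})" for k
    by (simp add: \<tau>_def)
  fix s assume "s \<in> space (lebesgue_on {t0..T})"
  then have s: "s \<in> {t0..T}" by simp
  have "\<bar>of_int \<lfloor>real (Suc k) * s\<rfloor> / real (Suc k) - s\<bar> \<le> inverse (real (Suc k))" for k
  proof -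
    have "\<bar>of_int \<lfloor>real (Suc k) * s\<rfloor> - real (Suc k) * s\<bar> \<le> 1"
      by linarith
    then have "\<bar>of_int \<lfloor>real (Suc k) * s\<rfloor> - real (Suc k) * s\<bar> / real (Suc k) \<le> 1 / real (Suc k)"
      by (intro divide_right_mono) auto
    moreover have "\<bar>of_int \<lfloor>real (Suc k) * s\<rfloor> - real (Suc k) * s\<bar> / real (Suc k)
        = \<bar>of_int \<lfloor>real (Suc k) * s\<rfloor> / real (Suc k) - s\<bar>"
    proof -
      have "of_int \<lfloor>real (Suc k) * s\<rfloor> / real (Suc k) - s = (of_int \<lfloor>real (Suc k) * s\<rfloor> - real (Suc k) * s) / real (Suc k)"
        by (simp add: diff_divide_distrib del: of_nat_Suc)
      then show ?thesis by (simp only: abs_divide abs_of_nat)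
    qed
    ultimately show ?thesis by (simp add: inverse_eq_divide)
  qed
  then have "(\<lambda>k. of_int \<lfloor>real (Suc k) * s\<rfloor> / real (Suc k) - s) \<longlonglongrightarrow> 0"
    by (intro Lim_null_comparison[OF _ LIMSEQ_inverse_real_of_nat]) (simp add: eventually_sequentially)
  then have "(\<lambda>k. of_int \<lfloor>real (Suc k) * s\<rfloor> / real (Suc k)) \<longlonglongrightarrow> s"
    by (simp only: LIM_zero_iff)
  then have "(\<lambda>k. \<tau> k s) \<longlonglongrightarrow> max t0 (min T s)"
    unfolding \<tau>_def by (intro tendsto_max tendsto_min tendsto_const)
  then have "(\<lambda>k. \<tau> k s) \<longlonglongrightarrow> s" using s by simp
  then have "(\<lambda>k. p (\<tau> k s)) \<longlonglongrightarrow> p s"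
    by (rule continuous_on_tendsto_compose[OF p]) (use s \<tau> in auto)
  then show "(\<lambda>k. f s (p (\<tau> k s))) \<longlonglongrightarrow> f s (p s)"
    using continuous_on_tendsto_compose[OF f_continuous[of s UNIV], of "\<lambda>k. p (\<tau> k s)" "p s" sequentially] s
    by simp
qed

text \<open>No continuity in time is assumed of the Jacobian. It is a pointwise limit of difference
  quotients of \<open>f\<close> along continuous curves, hence measurable there, and its bound makes
  it integrable.\<close>

lemma J_along_curve_integrable:
  assumes p: "continuous_on {t0..T} p" and z: "continuous_on {t0..T} z" and T: "t0 \<le> T"
  shows "(\<lambda>s. J s (p s) *v z s) integrable_on {t0..T}"
proof -
  obtain B1 where B1: "0 \<le> B1" "\<And>s. s \<in> {t0..T} \<Longrightarrow> norm (p s) \<le> B1"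
    by (rule continuous_on_interval_bounded[OF p]) blast
  obtain B2 where B2: "0 \<le> B2" "\<And>s. s \<in> {t0..T} \<Longrightarrow> norm (z s) \<le> B2"
    by (rule continuous_on_interval_bounded[OF z]) blast
  obtain L where L: "0 < L" "\<And>t v w. t \<in> {t0..T} \<Longrightarrow> norm v \<le> B1 \<Longrightarrow> norm (J t v *v w) \<le> L * norm w"
    by (rule J_bound[where T = T and r = B1]) blast
  define h where "h k s = real (Suc k) *\<^sub>R (f s (p s + (1 / real (Suc k)) *\<^sub>R z s) - f s (p s))" for k s
  have "(\<lambda>s. J s (p s) *v z s) \<in> borel_measurable (lebesgue_on {t0..T})"
  proof (rule borel_measurable_LIMSEQ_metric)
    show "h k \<in> borel_measurable (lebesgue_on {t0..T})" for k
      unfolding h_def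
      by (intro borel_measurable_scaleR borel_measurable_const borel_measurable_diff f_along_curve_measurable continuous_intros p z T)
    fix s assume "s \<in> space (lebesgue_on {t0..T})"
    then have s: "t0 \<le> s" by simp
    have "((\<lambda>\<theta>. p s + \<theta> *\<^sub>R z s) has_derivative (\<lambda>\<theta>. \<theta> *\<^sub>R z s)) (at 0)"
      by (auto intro!: derivative_eq_intros)
    moreover have "(f s has_derivative (\<lambda>h. J s (p s) *v h)) (at (p s + 0 *\<^sub>R z s))"
      using has_derivative_J[OF s, of "p s"] by simp
    ultimately have "((\<lambda>\<theta>. f s (p s + \<theta> *\<^sub>R z s)) has_derivative (\<lambda>\<theta>. J s (p s) *v (\<theta> *\<^sub>R z s))) (at 0)"
      by (rule has_derivative_compose)
    \<comment> \<open>\<open>X\<close> is the remainder quotient of the derivative in direction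
      \<open>z s\<close>; at \<open>\<theta> = 1 / Suc k\<close> it is the distance of
      \<open>h k s\<close> from its limit.\<close>
    moreover define X where "X \<theta> = norm (f s (p s + (0 + \<theta>) *\<^sub>R z s) - f s (p s + 0 *\<^sub>R z s) - J s (p s) *v (\<theta> *\<^sub>R z s)) / norm \<theta>" for \<theta>
    ultimately have "X \<midarrow>0\<rightarrow> 0"
      by (simp add: has_derivative_at X_def[abs_def])
    moreover have "(\<lambda>k. 1 / real (Suc k)) \<longlonglongrightarrow> 0"
      using LIMSEQ_inverse_real_of_nat by (simp add: inverse_eq_divide)
    ultimately have "(\<lambda>k. X (1 / real (Suc k))) \<longlonglongrightarrow> 0"
      by (intro LIMSEQ_SEQ_conv[THEN iffD2, rule_format]) auto
    moreover have "X (1 / real (Suc k)) = norm (h k s - J s (p s) *v z s)" for k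
    proof -
      have "h k s - J s (p s) *v z s = real (Suc k) *\<^sub>R (f s (p s + (0 + 1 / real (Suc k)) *\<^sub>R z s)
          - f s (p s + 0 *\<^sub>R z s) - J s (p s) *v ((1 / real (Suc k)) *\<^sub>R z s))"
        by (simp add: h_def scaleR_diff_right matrix_vector_mult_scaleR del: of_nat_Suc)
      then show ?thesis by (simp add: X_def mult.commute del: of_nat_Suc)
    qed
    ultimately have "(\<lambda>k. norm (h k s - J s (p s) *v z s)) \<longlonglongrightarrow> 0" by simp
    then have "(\<lambda>k. h k s - J s (p s) *v z s) \<longlonglongrightarrow> 0" by (rule tendsto_norm_zero_cancel)
    then show "(\<lambda>k. h k s) \<longlonglongrightarrow> J s (p s) *v z s" by (simp only: LIM_zero_iff)
  qed
  moreover have "norm (J s (p s) *v z s) \<le> L * B2" if s: "s \<in> {t0..T}" for s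
    using L(2)[OF s B1(2)[OF s], of "z s"] mult_left_mono[OF B2(2)[OF s], of L] L(1) by linarith
  ultimately show ?thesis by (rule bounded_measurable_integrable_on_interval)
qed

text \<open>The error of linearising \<open>f s\<close>, not the flow, at the base trajectory. It is
  the forcing term in the linear equation satisfied by
  \<open>\<Phi> s (x + w) - \<Phi> s x\<close>.\<close>

definition remainder :: "real^'n \<Rightarrow> real^'n \<Rightarrow> real \<Rightarrow> real^'n" where
  "remainder x w s = f s (\<Phi> s (x + w)) - f s (\<Phi> s x) - J s (\<Phi> s x) *v (\<Phi> s (x + w) - \<Phi> s x)"

lemma remainder_integrable:
  assumes T: "t0 \<le> T"
  shows "remainder x w integrable_on {t0..T}"
  unfolding remainder_def
  by (intro integrable_diff J_along_curve_integrable continuous_intros flow_continuous_on T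
      has_integral_integrable[OF flow_increment[OF order_refl T]])

text \<open>A bounded sequence of displacements keeps all initial states in one closed ball, which
  gives one constant. After division by \<open>norm (w k)\<close> this constant is the dominating
  function.\<close>

lemma remainder_bound:
  assumes T: "t0 \<le> T" and w: "bounded (range w)"
  obtains C where "0 < C" "\<And>k s. s \<in> {t0..T} \<Longrightarrow> norm (\<Phi> s (x + w k) - \<Phi> s x) \<le> C * norm (w k)"
    "\<And>k s. s \<in> {t0..T} \<Longrightarrow> norm (f s (\<Phi> s (x + w k)) - f s (\<Phi> s x)) \<le> C * norm (w k)"
    "\<And>k s. s \<in> {t0..T} \<Longrightarrow> norm (remainder x (w k) s) \<le> C * norm (w k)"
proof -
  obtain b where b: "\<And>k. norm (w k) \<le> b" using w by (auto simp: bounded_iff)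
  have b0: "0 \<le> b" by (rule order_trans[OF norm_ge_zero b])
  define K where "K = cball x b"
  have K: "compact K" "\<And>k. x + w k \<in> K" "x \<in> K"
    using b b0 by (auto simp: K_def dist_norm)
  obtain R where R: "0 < R" "\<And>x t. x \<in> K \<Longrightarrow> t \<in> {t0..T} \<Longrightarrow> norm (\<Phi> t x) \<le> R"
    by (rule flow_bounded[OF K(1) T]) blast
  obtain L where L: "0 < L" "\<And>t v w. t \<in> {t0..T} \<Longrightarrow> norm v \<le> R \<Longrightarrow> norm (J t v *v w) \<le> L * norm w"
    "\<And>t x y. t \<in> {t0..T} \<Longrightarrow> norm x \<le> R \<Longrightarrow> norm y \<le> R \<Longrightarrow> norm (f t x - f t y) \<le> L * norm (x - y)"
    by (rule J_bound[where T = T and r = R]) blast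
  obtain C where C: "1 \<le> C"
    "\<And>x y t. x \<in> K \<Longrightarrow> y \<in> K \<Longrightarrow> t \<in> {t0..T} \<Longrightarrow> norm (\<Phi> t y - \<Phi> t x) \<le> C * norm (y - x)"
    by (rule flow_lipschitz[OF K(1) T]) blast
  have 1: "norm (\<Phi> s (x + w k) - \<Phi> s x) \<le> C * norm (w k)" if "s \<in> {t0..T}" for s k
    using C(2)[OF K(3) K(2)[of k] that] by simp
  have 2: "norm (f s (\<Phi> s (x + w k)) - f s (\<Phi> s x)) \<le> L * (C * norm (w k))" if s: "s \<in> {t0..T}" for s k
    using L(3)[OF s R(2)[OF K(2)[of k] s] R(2)[OF K(3) s]] mult_left_mono[OF 1[OF s, of k] less_imp_le[OF L(1)]]
    by linarith
  have 3: "norm (remainder x (w k) s) \<le> 2 * (L * (C * norm (w k)))" if s: "s \<in> {t0..T}" for s k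
    using 2[OF s, of k] L(2)[OF s R(2)[OF K(3) s], of "\<Phi> s (x + w k) - \<Phi> s x"]
      mult_left_mono[OF 1[OF s, of k] less_imp_le[OF L(1)]]
      norm_triangle_ineq4[of "f s (\<Phi> s (x + w k)) - f s (\<Phi> s x)" "J s (\<Phi> s x) *v (\<Phi> s (x + w k) - \<Phi> s x)"]
    unfolding remainder_def by linarith
  have C0: "0 < C" using C by simp
  show ?thesis
  proof (rule that[of "C + 2 * (L * C)"])
    show "0 < C + 2 * (L * C)" using C0 L by (simp add: add_pos_pos)
    fix k s assume s: "s \<in> {t0..T}"
    have n: "0 \<le> C * norm (w k)" "0 \<le> L * (C * norm (w k))" using C0 L(1) by auto
    have e: "(C + 2 * (L * C)) * norm (w k) = C * norm (w k) + 2 * (L * (C * norm (w k)))"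
      by (simp add: algebra_simps)
    show "norm (\<Phi> s (x + w k) - \<Phi> s x) \<le> (C + 2 * (L * C)) * norm (w k)"
      using 1[OF s, of k] n unfolding e by linarith
    show "norm (f s (\<Phi> s (x + w k)) - f s (\<Phi> s x)) \<le> (C + 2 * (L * C)) * norm (w k)"
      using 2[OF s, of k] n unfolding e by linarith
    show "norm (remainder x (w k) s) \<le> (C + 2 * (L * C)) * norm (w k)"
      using 3[OF s, of k] n unfolding e by linarith
  qed
qed

text \<open>Combines differentiability of \<open>f s\<close> at \<open>\<Phi> s x\<close> with the
  Lipschitz estimate for the flow, at one fixed time. The convergence need not be uniform in
  \<open>s\<close>.\<close>

lemma remainder_tendsto_0:
  assumes s: "t0 \<le> s" and w: "w \<longlonglongrightarrow> 0" "\<And>k. w k \<noteq> 0"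
  shows "(\<lambda>k. norm (remainder x (w k) s) / norm (w k)) \<longlonglongrightarrow> 0"
proof (rule LIMSEQ_I)
  fix e :: real assume e: "0 < e"
  have "bounded (range w)" using w(1) by (rule convergent_imp_bounded)
  then obtain C where C: "0 < C" "\<And>k r. r \<in> {t0..s} \<Longrightarrow> norm (\<Phi> r (x + w k) - \<Phi> r x) \<le> C * norm (w k)"
    by (rule remainder_bound[OF s, where x = x]) blast
  have close: "norm (\<Phi> s (x + w k) - \<Phi> s x) \<le> C * norm (w k)" for k using s by (intro C) auto
  have "0 < e / (2 * C)" using e C by simp
  then obtain d where d: "0 < d" "\<And>y. norm (y - \<Phi> s x) < d \<Longrightarrow>
    norm (f s y - f s (\<Phi> s x) - J s (\<Phi> s x) *v (y - \<Phi> s x)) \<le> e / (2 * C) * norm (y - \<Phi> s x)"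
    using has_derivative_J[OF s, of "\<Phi> s x"] unfolding has_derivative_at_alt by blast
  obtain k0 where k0: "\<And>k. k0 \<le> k \<Longrightarrow> norm (w k) < d / C"
    using LIMSEQ_D[OF w(1), of "d / C"] d C by auto
  have "norm (norm (remainder x (w k) s) / norm (w k) - 0) < e" if k: "k0 \<le> k" for k
  proof -
    have "C * norm (w k) < d" using k0[OF k] C by (simp add: field_simps)
    then have "norm (\<Phi> s (x + w k) - \<Phi> s x) < d" using close[of k] by linarith
    then have "norm (remainder x (w k) s) \<le> e / (2 * C) * norm (\<Phi> s (x + w k) - \<Phi> s x)"
      unfolding remainder_def by (rule d)
    also have "\<dots> \<le> e / (2 * C) * (C * norm (w k))" using close e C by (intro mult_left_mono) auto
    also have "\<dots> = e / 2 * norm (w k)" using C by simp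
    also have "\<dots> < e * norm (w k)" using e w(2)[of k] by simp
    finally show ?thesis using w(2)[of k] by (simp add: field_simps)
  qed
  then show "\<exists>k0. \<forall>k\<ge>k0. norm (norm (remainder x (w k) s) / norm (w k) - 0) < e" by blast
qed

lemma remainder_norm_integrable:
  assumes T: "t0 \<le> T"
  shows "(\<lambda>s. norm (remainder x w s)) integrable_on {t0..T}"
proof -
  \<comment> \<open>A constant sequence specialises the bound to a single displacement.\<close>
  have "bounded (range (\<lambda>_ :: nat. w))" by simp
  then obtain C where C: "\<And>s. s \<in> {t0..T} \<Longrightarrow> norm (remainder x w s) \<le> C * norm w"
    by (rule remainder_bound[OF T, where x = x]) blast
  have "remainder x w absolutely_integrable_on {t0..T}"
    by (rule absolutely_integrable_integrable_bound[OF C remainder_integrable[OF T]]) auto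
  then show ?thesis by (simp add: absolutely_integrable_on_def)
qed

text \<open>The pointwise limits pass to the integral by dominated convergence: in the mean over
  time, the remainder is of smaller order than the displacement.\<close>

lemma remainder_integral_tendsto_0:
  assumes T: "t0 \<le> T" and w: "w \<longlonglongrightarrow> 0" "\<And>k. w k \<noteq> 0"
  shows "(\<lambda>k. integral {t0..T} (\<lambda>s. norm (remainder x (w k) s)) / norm (w k)) \<longlonglongrightarrow> 0"
proof -
  have "bounded (range w)" using w(1) by (rule convergent_imp_bounded)
  then obtain C where C: "\<And>k s. s \<in> {t0..T} \<Longrightarrow> norm (remainder x (w k) s) \<le> C * norm (w k)"
    by (rule remainder_bound[OF T, where x = x]) blast
  have "(\<lambda>k. integral {t0..T} (\<lambda>s. norm (remainder x (w k) s) / norm (w k))) \<longlonglongrightarrow> integral {t0..T} (\<lambda>s. 0)"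
  proof (rule dominated_convergence(2)[where h = "\<lambda>_. C"])
    show "(\<lambda>s. norm (remainder x (w k) s) / norm (w k)) integrable_on {t0..T}" for k
      by (intro integrable_on_divide remainder_norm_integrable T)
    show "norm (norm (remainder x (w k) s) / norm (w k)) \<le> C" if "s \<in> {t0..T}" for k s
      using C[OF that, of k] w(2)[of k] by (simp add: field_simps)
    show "(\<lambda>k. norm (remainder x (w k) s) / norm (w k)) \<longlonglongrightarrow> 0" if "s \<in> {t0..T}" for s
      using that by (intro remainder_tendsto_0 w) auto
  qed auto
  then show ?thesis by simp
qed

end

section \<open>The variational equation and differentiability in the initial state\<close>

context C1_system begin

text \<open>The solution is the limit of the difference quotients of the flow, which form a Cauchy sequence by
  Gronwall's inequality.\<close>

lemma variational_solution_exists: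
  assumes T: "t0 \<le> T" and e: "e \<noteq> 0"
  obtains y where "\<And>t. t \<in> {t0..T} \<Longrightarrow> ((\<lambda>s. J s (\<Phi> s x) *v y s) has_integral (y t - e)) {t0..t}"
proof -
  define c where "c k = real (Suc k)" for k
  have c0: "0 < c k" for k by (simp add: c_def)
  define w where "w k = (1 / c k) *\<^sub>R e" for k
  have w0: "w k \<noteq> 0" for k using e c0[of k] by (simp add: w_def)
  have wn: "norm (w k) = norm e / c k" for k using c0[of k] by (simp add: w_def)
  have "(\<lambda>k. 1 / c k) \<longlonglongrightarrow> 0"
    using LIMSEQ_inverse_real_of_nat by (simp add: inverse_eq_divide c_def)
  from tendsto_scaleR[OF this tendsto_const[of e]] have w: "w \<longlonglongrightarrow> 0" by (simp add: w_def[abs_def])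
  define q where "q k s = c k *\<^sub>R (\<Phi> s (x + w k) - \<Phi> s x)" for k s
  define g where "g k s = c k *\<^sub>R (f s (\<Phi> s (x + w k)) - f s (\<Phi> s x))" for k s
  \<comment> \<open>The difference quotient solves the variational equation up to the scaled
    remainder.\<close>
  have g_eq: "g k s = J s (\<Phi> s x) *v q k s + c k *\<^sub>R remainder x (w k) s" for k s
    unfolding g_def q_def remainder_def matrix_vector_mult_scaleR by (simp add: scaleR_diff_right)
  have q_int: "(g k has_integral (q k t - e)) {t0..t}" if t: "t0 \<le> t" for k t
  proof -
    have "((\<lambda>s. f s (\<Phi> s (x + w k)) - f s (\<Phi> s x)) has_integral ((\<Phi> t (x + w k) - \<Phi> t x) - w k)) {t0..t}"
      using has_integral_diff[OF flow_increment[OF order_refl t, of "x + w k"] flow_increment[OF order_refl t, of x]]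
      by (simp add: flow_initial algebra_simps)
    from has_integral_cmul[OF this, of "c k"]
    show ?thesis using c0[of k] by (simp add: g_def[abs_def] q_def w_def scaleR_diff_right)
  qed
  have bw: "bounded (range w)" using w by (rule convergent_imp_bounded)
  obtain C where C: "0 < C" "\<And>k s. s \<in> {t0..T} \<Longrightarrow> norm (\<Phi> s (x + w k) - \<Phi> s x) \<le> C * norm (w k)"
    "\<And>k s. s \<in> {t0..T} \<Longrightarrow> norm (f s (\<Phi> s (x + w k)) - f s (\<Phi> s x)) \<le> C * norm (w k)"
    by (rule remainder_bound[OF T bw, where x = x]) blast
  obtain R where R: "0 < R" "\<And>t. t \<in> {t0..T} \<Longrightarrow> norm (\<Phi> t x) \<le> R"
    by (rule solution_from_bounded[OF flow_solution, where x = x and T = T]) blast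
  obtain L where L: "0 < L" "\<And>t v w. t \<in> {t0..T} \<Longrightarrow> norm v \<le> R \<Longrightarrow> norm (J t v *v w) \<le> L * norm w"
    by (rule J_bound[where T = T and r = R]) blast
  define \<rho> where "\<rho> k = integral {t0..T} (\<lambda>s. c k * norm (remainder x (w k) s))" for k
  have \<rho>_int: "(\<lambda>s. c k * norm (remainder x (w k) s)) integrable_on {t0..T}" for k
    using integrable_cmul[OF remainder_norm_integrable[OF T, of x "w k"], of "c k"] by simp
  have "(\<lambda>k. integral {t0..T} (\<lambda>s. norm (remainder x (w k) s)) / norm (w k) * norm e) \<longlonglongrightarrow> 0 * norm e"
    by (intro tendsto_mult tendsto_const remainder_integral_tendsto_0 T w w0)
  moreover have "integral {t0..T} (\<lambda>s. norm (remainder x (w k) s)) / norm (w k) * norm e = \<rho> k" for k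
    using c0[of k] e by (simp add: \<rho>_def wn)
  ultimately have \<rho>: "\<rho> \<longlonglongrightarrow> 0" by simp
  have cauchy_bound: "norm (q k t - q l t) \<le> (\<rho> k + \<rho> l) * exp (L * (T - t0))" if t: "t \<in> {t0..T}" for k l t
  proof -
    let ?\<rho> = "\<lambda>s. c k * norm (remainder x (w k) s) + c l * norm (remainder x (w l) s)"
    have "norm (q k t - q l t) \<le> integral {t0..T} ?\<rho> * exp (L * (T - t0))"
    proof (rule gronwall_inhomogeneous[where g = "\<lambda>s. g k s - g l s" and e = "\<lambda>t. q k t - q l t", OF _ _ _ _ _ t])
      show "((\<lambda>s. g k s - g l s) has_integral (q k r - q l r)) {t0..r}" if "r \<in> {t0..T}" for r
        using has_integral_diff[OF q_int[of r k] q_int[of r l]] that by simp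
      fix s assume s: "s \<in> {t0..T}"
      have "g k s - g l s = J s (\<Phi> s x) *v (q k s - q l s) + (c k *\<^sub>R remainder x (w k) s - c l *\<^sub>R remainder x (w l) s)"
        by (simp add: g_eq matrix_vector_mult_diff_distrib)
      then have "norm (g k s - g l s) \<le> norm (J s (\<Phi> s x) *v (q k s - q l s))
          + norm (c k *\<^sub>R remainder x (w k) s - c l *\<^sub>R remainder x (w l) s)"
        by (simp add: norm_triangle_ineq)
      also have "\<dots> \<le> L * norm (q k s - q l s) + (norm (c k *\<^sub>R remainder x (w k) s) + norm (c l *\<^sub>R remainder x (w l) s))"
        by (intro add_mono L(2) s R(2) norm_triangle_ineq4)
      finally show "norm (g k s - g l s) \<le> L * norm (q k s - q l s) + ?\<rho> s"
        using c0[of k] c0[of l] by simp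
    qed (use L c0[of k] c0[of l] in \<open>auto intro!: integrable_add \<rho>_int\<close>)
    also have "integral {t0..T} ?\<rho> = \<rho> k + \<rho> l"
      unfolding \<rho>_def by (rule Henstock_Kurzweil_Integration.integral_add[OF \<rho>_int \<rho>_int])
    finally show ?thesis .
  qed
  have "Cauchy (\<lambda>k. q k t)" if t: "t \<in> {t0..T}" for t
  proof (rule CauchyI)
    fix \<epsilon> :: real assume \<epsilon>: "0 < \<epsilon>"
    define \<epsilon>' where "\<epsilon>' = \<epsilon> / (2 * exp (L * (T - t0)))"
    have "0 < \<epsilon>'" using \<epsilon> by (simp add: \<epsilon>'_def)
    from LIMSEQ_D[OF \<rho> this] obtain M where M: "\<And>k. M \<le> k \<Longrightarrow> \<bar>\<rho> k\<bar> < \<epsilon>'" by auto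
    have "norm (q k t - q l t) < \<epsilon>" if "M \<le> k" "M \<le> l" for k l
    proof -
      have "(\<rho> k + \<rho> l) * exp (L * (T - t0)) < (2 * \<epsilon>') * exp (L * (T - t0))"
        using M[OF that(1)] M[OF that(2)] by (intro mult_strict_right_mono) auto
      also have "\<dots> = \<epsilon>" by (simp add: \<epsilon>'_def)
      finally show ?thesis using cauchy_bound[OF t, of k l] by linarith
    qed
    then show "\<exists>M. \<forall>k\<ge>M. \<forall>l\<ge>M. norm (q k t - q l t) < \<epsilon>" by blast
  qed
  then have lim: "(\<lambda>k. q k t) \<longlonglongrightarrow> lim (\<lambda>k. q k t)" if "t \<in> {t0..T}" for t
    using that by (simp add: Cauchy_convergent_iff convergent_LIMSEQ_iff)
  define y where "y t = lim (\<lambda>k. q k t)" for t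
  show ?thesis
  proof (rule that)
    fix t assume t: "t \<in> {t0..T}"
    \<comment> \<open>A bound independent of \<open>k\<close> allows the limit to be taken under the
      integral, which is how \<open>y\<close> inherits the equation.\<close>
    have dom: "norm (g k s) \<le> C * norm e" if s: "s \<in> {t0..t}" for k s
    proof -
      have "norm (g k s) \<le> c k * (C * norm (w k))"
        using C(3)[of s k] c0[of k] s t by (simp add: g_def)
      then show ?thesis using c0[of k] by (simp add: wn)
    qed
    have conv: "(\<lambda>k. g k s) \<longlonglongrightarrow> J s (\<Phi> s x) *v y s" if s: "s \<in> {t0..t}" for s
    proof -
      have "(\<lambda>k. norm (remainder x (w k) s) / norm (w k) * norm e) \<longlonglongrightarrow> 0 * norm e"
        by (intro tendsto_mult tendsto_const remainder_tendsto_0 w w0) (use s in auto)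
      moreover have "norm (remainder x (w k) s) / norm (w k) * norm e = norm (c k *\<^sub>R remainder x (w k) s)" for k
        using c0[of k] e by (simp add: wn)
      ultimately have "(\<lambda>k. norm (c k *\<^sub>R remainder x (w k) s)) \<longlonglongrightarrow> 0" by simp
      then have "(\<lambda>k. c k *\<^sub>R remainder x (w k) s) \<longlonglongrightarrow> 0" by (rule tendsto_norm_zero_cancel)
      moreover have "(\<lambda>k. J s (\<Phi> s x) *v q k s) \<longlonglongrightarrow> J s (\<Phi> s x) *v y s"
        unfolding y_def
        by (rule bounded_linear.tendsto[OF matrix_vector_mul_bounded_linear lim]) (use s t in auto)
      ultimately have "(\<lambda>k. J s (\<Phi> s x) *v q k s + c k *\<^sub>R remainder x (w k) s) \<longlonglongrightarrow> J s (\<Phi> s x) *v y s + 0"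
        by (intro tendsto_add)
      then show ?thesis by (simp add: g_eq)
    qed
    have gi: "g k integrable_on {t0..t}" for k
      using q_int[of t k] t by auto
    have i1: "(\<lambda>s. J s (\<Phi> s x) *v y s) integrable_on {t0..t}"
      by (rule dominated_convergence(1)[where h = "\<lambda>_. C * norm e", OF gi _ dom conv]) auto
    have i2: "(\<lambda>k. integral {t0..t} (g k)) \<longlonglongrightarrow> integral {t0..t} (\<lambda>s. J s (\<Phi> s x) *v y s)"
      by (rule dominated_convergence(2)[where h = "\<lambda>_. C * norm e", OF gi _ dom conv]) auto
    have "integral {t0..t} (g k) = q k t - e" for k
      using q_int[of t k] t by (intro integral_unique) auto
    then have "(\<lambda>k. q k t - e) \<longlonglongrightarrow> integral {t0..t} (\<lambda>s. J s (\<Phi> s x) *v y s)" using i2 by simp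
    moreover have "(\<lambda>k. q k t - e) \<longlonglongrightarrow> y t - e"
      unfolding y_def by (intro tendsto_diff tendsto_const lim t)
    ultimately have "integral {t0..t} (\<lambda>s. J s (\<Phi> s x) *v y s) = y t - e" by (rule LIMSEQ_unique)
    then show "((\<lambda>s. J s (\<Phi> s x) *v y s) has_integral (y t - e)) {t0..t}"
      using integrable_integral[OF i1] by simp
  qed
qed

text \<open>The principal fundamental matrix of the linearised equation along the trajectory of
  \<open>x\<close>. Describing it by its action on every vector keeps all integrals
  vector-valued.\<close>

definition variational_matrix :: "real^'n \<Rightarrow> real \<Rightarrow> (real \<Rightarrow> real^'n^'n) \<Rightarrow> bool" where
  "variational_matrix x T Y \<longleftrightarrow> (\<forall>t\<in>{t0..T}. \<forall>w.
     ((\<lambda>s. J s (\<Phi> s x) *v (Y s *v w)) has_integral (Y t *v w - w)) {t0..t})"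

lemma variational_matrix_exists:
  assumes T: "t0 \<le> T"
  obtains Y where "variational_matrix x T Y"
proof -
  have "\<exists>y. \<forall>t\<in>{t0..T}. ((\<lambda>s. J s (\<Phi> s x) *v y s) has_integral (y t - axis j 1)) {t0..t}" for j
  proof -
    have "axis j 1 \<noteq> (0 :: real^'n)" by (simp add: axis_eq_0_iff)
    then show ?thesis by (rule variational_solution_exists[OF T, where x = x]) blast
  qed
  then have "\<exists>y. \<forall>j. \<forall>t\<in>{t0..T}. ((\<lambda>s. J s (\<Phi> s x) *v y j s) has_integral (y j t - axis j 1)) {t0..t}"
    by (intro choice allI)
  then obtain y where y: "\<And>j t. t \<in> {t0..T} \<Longrightarrow> ((\<lambda>s. J s (\<Phi> s x) *v y j s) has_integral (y j t - axis j 1)) {t0..t}"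
    by blast
  \<comment> \<open>The columns are the solutions that start at the unit vectors.\<close>
  define Y where "Y t = (\<chi> i j. y j t $ i)" for t
  have Yv: "Y t *v w = (\<Sum>j\<in>UNIV. w $ j *\<^sub>R y j t)" for t w
    by (simp add: vec_eq_iff Y_def matrix_vector_mult_def mult.commute)
  have "((\<lambda>s. J s (\<Phi> s x) *v (Y s *v w)) has_integral (Y t *v w - w)) {t0..t}" if t: "t \<in> {t0..T}" for t w
  proof -
    have "((\<lambda>s. \<Sum>j\<in>UNIV. w $ j *\<^sub>R (J s (\<Phi> s x) *v y j s)) has_integral (\<Sum>j\<in>UNIV. w $ j *\<^sub>R (y j t - axis j 1))) {t0..t}"
      by (intro has_integral_sum has_integral_cmul y t) auto
    moreover have "(\<Sum>j\<in>UNIV. w $ j *\<^sub>R (J s (\<Phi> s x) *v y j s)) = J s (\<Phi> s x) *v (Y s *v w)" for s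
      unfolding Yv by (simp add: linear_sum[OF matrix_vector_mul_linear] matrix_vector_mult_scaleR)
    moreover have "(\<Sum>j\<in>UNIV. w $ j *\<^sub>R (y j t - axis j 1)) = Y t *v w - w"
      unfolding Yv using basis_expansion[of w]
      by (simp add: scaleR_diff_right sum_subtractf scalar_mult_eq_scaleR)
    ultimately show ?thesis by simp
  qed
  then have "variational_matrix x T Y" by (simp add: variational_matrix_def)
  then show ?thesis by (rule that)
qed

lemma variational_matrix_initial:
  assumes Y: "variational_matrix x T Y" and T: "t0 \<le> T"
  shows "Y t0 = mat 1"
proof -
  have "Y t0 *v w = mat 1 *v w" for w
  proof -
    have "((\<lambda>s. J s (\<Phi> s x) *v (Y s *v w)) has_integral (Y t0 *v w - w)) {t0}"
      using bspec[OF Y[unfolded variational_matrix_def], of t0] T by simp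
    then have "Y t0 *v w - w = 0" by (rule has_integral_unique[OF _ has_integral_refl(2)])
    then show ?thesis by simp
  qed
  then show ?thesis by (simp add: matrix_eq)
qed

lemma variational_matrix_increment:
  assumes Y: "variational_matrix x T Y" and uv: "t0 \<le> u" "u \<le> v" "v \<le> T"
  shows "((\<lambda>s. J s (\<Phi> s x) *v (Y s *v w)) has_integral (Y v *v w - Y u *v w)) {u..v}"
proof (rule has_integral_increment[where \<delta> = "\<lambda>t. Y t *v w" and a = t0 and b = T])
  have "Y t0 = mat 1" using variational_matrix_initial[OF Y] uv by simp
  then show "((\<lambda>s. J s (\<Phi> s x) *v (Y s *v w)) has_integral (Y t *v w - Y t0 *v w)) {t0..t}" if "t \<in> {t0..T}" for t
    using Y that by (simp add: variational_matrix_def)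
qed (use uv in auto)

text \<open>The deviation from linearity starts at \<open>0\<close> and solves the linearised
  equation with the remainder as forcing. Gronwall's inequality bounds it by the integral of the
  remainder, which is of smaller order than the displacement.\<close>

lemma flow_has_derivative:
  assumes Y: "variational_matrix x T Y" and t: "t \<in> {t0..T}"
  shows "((\<lambda>z. \<Phi> t z) has_derivative (\<lambda>w. Y t *v w)) (at x)"
proof -
  have T: "t0 \<le> T" using t by simp
  obtain R where R: "0 < R" "\<And>t. t \<in> {t0..T} \<Longrightarrow> norm (\<Phi> t x) \<le> R"
    by (rule solution_from_bounded[OF flow_solution, where x = x and T = T]) blast
  obtain L where L: "0 < L" "\<And>t v w. t \<in> {t0..T} \<Longrightarrow> norm v \<le> R \<Longrightarrow> norm (J t v *v w) \<le> L * norm w"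
    by (rule J_bound[where T = T and r = R]) blast
  have bound: "norm (\<Phi> t (x + w) - \<Phi> t x - Y t *v w)
      \<le> integral {t0..T} (\<lambda>s. norm (remainder x w s)) * exp (L * (T - t0))" for w
  proof (rule gronwall_inhomogeneous[where e = "\<lambda>t. \<Phi> t (x + w) - \<Phi> t x - Y t *v w" and
        g = "\<lambda>s. f s (\<Phi> s (x + w)) - f s (\<Phi> s x) - J s (\<Phi> s x) *v (Y s *v w)", OF _ _ _ _ _ t])
    fix r assume r: "r \<in> {t0..T}"
    then have r0: "t0 \<le> r" by simp
    have "((\<lambda>s. J s (\<Phi> s x) *v (Y s *v w)) has_integral (Y r *v w - w)) {t0..r}"
      using Y r by (simp add: variational_matrix_def)
    from has_integral_diff[OF has_integral_diff[OF flow_increment[OF order_refl r0, of "x + w"]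
          flow_increment[OF order_refl r0, of x]] this]
    show "((\<lambda>s. f s (\<Phi> s (x + w)) - f s (\<Phi> s x) - J s (\<Phi> s x) *v (Y s *v w)) has_integral
        (\<Phi> r (x + w) - \<Phi> r x - Y r *v w)) {t0..r}"
      by (simp add: flow_initial algebra_simps)
  next
    fix s assume s: "s \<in> {t0..T}"
    have "f s (\<Phi> s (x + w)) - f s (\<Phi> s x) - J s (\<Phi> s x) *v (Y s *v w)
        = J s (\<Phi> s x) *v (\<Phi> s (x + w) - \<Phi> s x - Y s *v w) + remainder x w s"
      by (simp add: remainder_def matrix_vector_mult_diff_distrib)
    then show "norm (f s (\<Phi> s (x + w)) - f s (\<Phi> s x) - J s (\<Phi> s x) *v (Y s *v w))
        \<le> L * norm (\<Phi> s (x + w) - \<Phi> s x - Y s *v w) + norm (remainder x w s)"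
      using norm_triangle_ineq[of "J s (\<Phi> s x) *v (\<Phi> s (x + w) - \<Phi> s x - Y s *v w)" "remainder x w s"]
        L(2)[OF s R(2)[OF s], of "\<Phi> s (x + w) - \<Phi> s x - Y s *v w"] by simp
  qed (use L remainder_norm_integrable[OF T] in auto)
  have "(\<lambda>k. norm (\<Phi> t (x + w k) - \<Phi> t x - Y t *v w k) / norm (w k)) \<longlonglongrightarrow> 0"
    if w0: "\<And>k. w k \<noteq> 0" and w: "w \<longlonglongrightarrow> 0" for w :: "nat \<Rightarrow> real^'n"
  proof (rule Lim_null_comparison)
    have "(\<lambda>k. integral {t0..T} (\<lambda>s. norm (remainder x (w k) s)) / norm (w k) * exp (L * (T - t0)))
        \<longlonglongrightarrow> 0 * exp (L * (T - t0))"
      by (intro tendsto_mult tendsto_const remainder_integral_tendsto_0 T w w0)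
    then show "(\<lambda>k. integral {t0..T} (\<lambda>s. norm (remainder x (w k) s)) / norm (w k) * exp (L * (T - t0))) \<longlonglongrightarrow> 0"
      by simp
    show "\<forall>\<^sub>F k in sequentially. norm (norm (\<Phi> t (x + w k) - \<Phi> t x - Y t *v w k) / norm (w k))
        \<le> integral {t0..T} (\<lambda>s. norm (remainder x (w k) s)) / norm (w k) * exp (L * (T - t0))"
      using divide_right_mono[OF bound, of "norm (w k)" for k] by (intro always_eventually allI) simp
  qed
  then have "(\<lambda>w. norm (\<Phi> t (x + w) - \<Phi> t x - Y t *v w) / norm w) \<midarrow>0\<rightarrow> 0"
    unfolding LIMSEQ_SEQ_conv[symmetric] by blast
  then show ?thesis by (simp add: has_derivative_at)
qed

end

text \<open>For bijective \<sigma> a simultaneous relabelling of rows and columns, hence compatible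
  with products, trace and identity. It moves the determinant to the index type in which volumes are
  computed.\<close>

definition reindex_matrix :: "('m \<Rightarrow> 'n) \<Rightarrow> 'a^'n^'n \<Rightarrow> 'a^'m^'m" where
  "reindex_matrix \<sigma> A = (\<chi> i j. A $ \<sigma> i $ \<sigma> j)"

lemma reindex_matrix_mult:
  fixes \<sigma> :: "'m::finite \<Rightarrow> 'n::finite" and A B :: "'a::semiring_1^'n^'n"
  assumes "bij \<sigma>"
  shows "reindex_matrix \<sigma> (A ** B) = reindex_matrix \<sigma> A ** reindex_matrix \<sigma> B"
  unfolding reindex_matrix_def matrix_matrix_mult_def
  using sum.reindex_bij_betw[OF assms, of "\<lambda>k. A $ i $ k * B $ k $ j" for i j]
  by (simp add: vec_eq_iff)

lemma reindex_matrix_add: "reindex_matrix \<sigma> (A + B) = reindex_matrix \<sigma> A + reindex_matrix \<sigma> B"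
  by (simp add: reindex_matrix_def vec_eq_iff)

lemma reindex_matrix_mat_1: "bij \<sigma> \<Longrightarrow> reindex_matrix \<sigma> (mat 1) = mat 1"
  by (auto simp: reindex_matrix_def mat_def vec_eq_iff dest: bij_is_inj injD)

lemma trace_reindex_matrix:
  fixes \<sigma> :: "'m::finite \<Rightarrow> 'n::finite" and A :: "'a::semiring_1^'n^'n"
  shows "bij \<sigma> \<Longrightarrow> trace (reindex_matrix \<sigma> A) = trace A"
  unfolding reindex_matrix_def trace_def
  using sum.reindex_bij_betw[of \<sigma> UNIV UNIV "\<lambda>i. A $ i $ i"] by simp

lemma norm_matrix_le_entries:
  fixes A :: "real^'m^'n"
  assumes "\<And>i j. \<bar>A $ i $ j\<bar> \<le> \<beta>"
  shows "norm A \<le> real CARD('n) * (real CARD('m) * \<beta>)"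
proof -
  have row: "norm (A $ i) \<le> real CARD('m) * \<beta>" for i
    using norm_le_l1_cart[of "A $ i"] sum_bounded_above[of UNIV "\<lambda>j. \<bar>A $ i $ j\<bar>" \<beta>] assms by simp
  have "norm A \<le> (\<Sum>i\<in>UNIV. norm (A $ i))"
    unfolding norm_vec_def by (rule L2_set_le_sum) simp
  also have "\<dots> \<le> real CARD('n) * (real CARD('m) * \<beta>)"
    using sum_bounded_above[of UNIV "\<lambda>i. norm (A $ i)"] row by simp
  finally show ?thesis .
qed

text \<open>The variational equation is given by its action on vectors; this brings the trace into
  that form.\<close>

lemma trace_eq_sum_axis:
  fixes A :: "real^'n^'n"
  shows "trace A = (\<Sum>i\<in>UNIV. (A *v axis i 1) $ i)"
  by (simp add: trace_def matrix_vector_mul_component inner_axis)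

section \<open>Growth of the Jacobian determinant\<close>

context C1_system begin

text \<open>Liouville's formula as an inequality. Writing \<open>Y v = (1 + B) ** Y u\<close> with \<open>B\<close> of order
  \<open>v - u\<close> avoids differentiating \<open>Y\<close>, which need not be differentiable since the Jacobian is merely
  measurable in time.\<close>

lemma det_variational_matrix_growth:
  fixes \<sigma> :: "'m::finite \<Rightarrow> 'n"
  assumes Y: "variational_matrix x T Y" and ab: "t0 \<le> a" "a \<le> b" "b \<le> T" and \<sigma>: "bij \<sigma>"
    and tr: "\<And>s. s \<in> {a..b} \<Longrightarrow> c \<le> trace (J s (\<Phi> s x))"
  shows "\<bar>det (reindex_matrix \<sigma> (Y a))\<bar> * exp (c * (b - a)) \<le> \<bar>det (reindex_matrix \<sigma> (Y b))\<bar>"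
proof (rule exponential_growth_of_increments[OF ab(2)])
  fix \<eta> :: real assume \<eta>: "0 < \<eta>"
  obtain R where R: "0 < R" "\<And>t. t \<in> {t0..T} \<Longrightarrow> norm (\<Phi> t x) \<le> R"
    by (rule solution_from_bounded[OF flow_solution, where x = x and T = T]) blast
  obtain L where L: "0 < L" "\<And>t v w. t \<in> {t0..T} \<Longrightarrow> norm v \<le> R \<Longrightarrow> norm (J t v *v w) \<le> L * norm w"
    by (rule J_bound[where T = T and r = R]) blast
  have JL: "norm (J s (\<Phi> s x) *v w) \<le> L * norm w" if "s \<in> {t0..T}" for s w
    by (intro L(2) R(2) that)
  define E where "E = exp (L * (T - t0))"
  have E: "0 < E" by (simp add: E_def)
  \<comment> \<open>The first bound controls \<open>Y s ** W\<close> below, the second makes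
    \<open>Y u\<close> invertible.\<close>
  have cmp: "norm (Y v *v w) \<le> E * norm (Y u *v w)" "norm (Y u *v w) \<le> E * norm (Y v *v w)"
    if uv: "t0 \<le> u" "u \<le> v" "v \<le> T" for u v w
  proof -
    have inc: "((\<lambda>s. J s (\<Phi> s x) *v (Y s *v w)) has_integral (Y t *v w - Y u *v w)) {u..t}" if "t \<in> {u..v}" for t
      by (rule variational_matrix_increment[OF Y]) (use that uv in auto)
    have bd: "norm (J s (\<Phi> s x) *v (Y s *v w)) \<le> L * norm (Y s *v w)" if "s \<in> {u..v}" for s
      by (rule JL) (use that uv in auto)
    have e: "exp (L * (v - u)) \<le> E" using L uv unfolding E_def by (auto intro!: mult_left_mono)
    have "norm (Y v *v w) \<le> norm (Y u *v w) * exp (L * (v - u))"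
      by (rule gronwall_forward[where \<delta> = "\<lambda>t. Y t *v w" and b = v, OF inc bd]) (use L uv in auto)
    also have "\<dots> \<le> norm (Y u *v w) * E" by (intro mult_left_mono e) auto
    finally show "norm (Y v *v w) \<le> E * norm (Y u *v w)" by (simp add: mult.commute)
    have "norm (Y u *v w) \<le> norm (Y v *v w) * exp (L * (v - u))"
      by (rule gronwall_backward[where \<delta> = "\<lambda>t. Y t *v w" and b = v, OF inc bd]) (use L uv in auto)
    also have "\<dots> \<le> norm (Y v *v w) * E" by (intro mult_left_mono e) auto
    finally show "norm (Y u *v w) \<le> E * norm (Y v *v w)" by (simp add: mult.commute)
  qed
  define n where "n = real CARD('n)"
  define m where "m = real CARD('m)"
  have nm: "0 < n" "0 < m" by (auto simp: n_def m_def)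
  \<comment> \<open>Chosen so that \<open>\<eta>'\<close> times the bound on the reindexed
    \<open>B\<close> is \<open>\<eta> / 2 * (v - u)\<close>.\<close>
  define \<eta>' where "\<eta>' = \<eta> / (2 * (m * (m * (L * E))))"
  have \<eta>': "0 < \<eta>'" using \<eta> nm L E by (simp add: \<eta>'_def)
  obtain d where d: "0 < d"
    "\<And>B :: real^'m^'m. norm B < d \<Longrightarrow> 1 + trace B - \<eta>' * norm B \<le> \<bar>det (mat 1 + B)\<bar>"
    by (rule det_perturb_identity_lower[OF \<eta>', where 'n = 'm]) blast
  \<comment> \<open>The first bound puts the reindexed \<open>B\<close> in the range of the
    determinant expansion, the second keeps the error of the trace at most
    \<open>\<eta> / 2 * (v - u)\<close>.\<close>
  define D where "D = min (d / (m * (m * (L * E)))) (\<eta> / (2 * (n * L * L * E)))"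
  have D: "0 < D" using d(1) \<eta> nm L E by (simp add: D_def)
  have "\<bar>det (reindex_matrix \<sigma> (Y u))\<bar> * (1 + (c - \<eta>) * (v - u)) \<le> \<bar>det (reindex_matrix \<sigma> (Y v))\<bar>"
    if uv: "a \<le> u" "u \<le> v" "v \<le> b" "v - u < D" for u v
  proof -
    have u0: "t0 \<le> u" and vT: "v \<le> T" using uv ab by auto
    have "w = 0" if "Y u *v w = 0" for w
      using cmp(2)[of t0 u w] that u0 uv vT variational_matrix_initial[OF Y] by auto
    then obtain W where "W ** Y u = mat 1" using matrix_left_invertible_ker[of "Y u"] by blast
    then have W: "W ** Y u = mat 1" "Y u ** W = mat 1" by (auto simp: matrix_left_right_inverse)
    \<comment> \<open>\<open>Y v ** W\<close> is the transition matrix from time \<open>u\<close> to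
      time \<open>v\<close>; \<open>B\<close> is its deviation from the identity.\<close>
    define B where "B = Y v ** W - mat 1"
    have B_int: "((\<lambda>s. J s (\<Phi> s x) *v (Y s *v (W *v w))) has_integral B *v w) {u..v}" for w
    proof -
      have "Y v *v (W *v w) - Y u *v (W *v w) = B *v w"
        using W(2) by (simp add: B_def matrix_vector_mul_assoc matrix_vector_mult_diff_rdistrib)
      then show ?thesis using variational_matrix_increment[OF Y u0 uv(2) vT, of "W *v w"] by simp
    qed
    have Zs: "norm (Y s *v (W *v w)) \<le> E * norm w" if "s \<in> {u..v}" for s w
      using cmp(1)[of u s "W *v w"] that u0 vT W(2) by (simp add: matrix_vector_mul_assoc)
    have JZ: "norm (J s (\<Phi> s x) *v (Y s *v (W *v w))) \<le> L * (E * norm w)" if s: "s \<in> {u..v}" for s w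
    proof -
      have "norm (J s (\<Phi> s x) *v (Y s *v (W *v w))) \<le> L * norm (Y s *v (W *v w))"
        by (rule JL) (use s u0 vT in auto)
      also have "\<dots> \<le> L * (E * norm w)" by (intro mult_left_mono Zs s) (use L in auto)
      finally show ?thesis .
    qed
    have Zd: "norm (Y s *v (W *v w) - w) \<le> L * (E * norm w) * (v - u)" if s: "s \<in> {u..v}" for s w
    proof -
      have "norm (Y s *v (W *v w) - Y u *v (W *v w)) \<le> L * (E * norm w) * measure lborel {u..s}"
      proof (rule has_integral_bound_real[where S = "{}"])
        show "((\<lambda>s. J s (\<Phi> s x) *v (Y s *v (W *v w))) has_integral (Y s *v (W *v w) - Y u *v (W *v w))) {u..s}"
          by (rule variational_matrix_increment[OF Y]) (use s u0 vT in auto)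
      qed (use L E JZ s in auto)
      also have "\<dots> \<le> L * (E * norm w) * (v - u)" using s L E by (auto intro!: mult_left_mono)
      finally show ?thesis using W(2) by (simp add: matrix_vector_mul_assoc)
    qed
    have "\<bar>B $ i $ j\<bar> \<le> L * E * (v - u)" for i j
    proof -
      have "norm (B *v axis j 1) \<le> L * (E * norm (axis j (1::real) :: real^'n)) * measure lborel {u..v}"
        by (rule has_integral_bound_real[OF _ _ B_int, where S = "{}"])
           (use L E JZ[of _ "axis j 1"] in auto)
      then have "norm (column j B) \<le> L * E * (v - u)"
        using uv by (simp add: matrix_vector_mult_basis)
      then show ?thesis using component_le_norm_cart[of "column j B" i] by (simp add: column_def)
    qed
    then have RB: "norm (reindex_matrix \<sigma> B) \<le> m * (m * (L * E * (v - u)))"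
      unfolding m_def by (intro norm_matrix_le_entries) (simp add: reindex_matrix_def)
    have "v - u < d / (m * (m * (L * E)))" using uv(4) by (simp add: D_def)
    then have "m * (m * (L * E * (v - u))) < d" using nm L E by (simp add: field_simps)
    with RB have RBd: "norm (reindex_matrix \<sigma> B) < d" by linarith
    \<comment> \<open>The trace of \<open>B\<close> is the integral of
      \<open>trace (J s (\<Phi> s x) ** Y s ** W)\<close>. Replacing \<open>Y s ** W\<close> by the
      identity costs \<open>L * L * E * (v - u)\<close> in each of the \<open>n\<close> diagonal
      entries.\<close>
    have trB: "(c - n * L * L * E * (v - u)) * (v - u) \<le> trace B"
    proof -
      have i1: "((\<lambda>s. \<Sum>i\<in>UNIV. (J s (\<Phi> s x) *v (Y s *v (W *v axis i 1))) $ i) has_integral trace B) {u..v}"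
        unfolding trace_eq_sum_axis
        by (intro has_integral_sum has_integral_linear[OF B_int bounded_linear_vec_nth, unfolded o_def]) auto
      have i2: "((\<lambda>s. c - n * L * L * E * (v - u)) has_integral (c - n * L * L * E * (v - u)) * (v - u)) {u..v}"
        using has_integral_const_real[of "c - n * L * L * E * (v - u)" u v] uv by (simp add: mult.commute)
      show ?thesis
      proof (rule has_integral_le[OF i2 i1])
        fix s assume s: "s \<in> {u..v}"
        have sT: "s \<in> {t0..T}" using s u0 vT by auto
        let ?r = "\<lambda>i. J s (\<Phi> s x) *v (Y s *v (W *v axis i 1) - axis i 1)"
        have "- (L * L * E * (v - u)) \<le> ?r i $ i" for i
        proof -
          have "norm (?r i) \<le> L * norm (Y s *v (W *v axis i 1) - axis i 1)" by (rule JL[OF sT])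
          also have "\<dots> \<le> L * (L * (E * norm (axis i (1::real) :: real^'n)) * (v - u))"
            by (intro mult_left_mono Zd s) (use L in auto)
          finally show ?thesis using component_le_norm_cart[of "?r i" i] by (simp add: mult.assoc)
        qed
        then have "(\<Sum>i\<in>(UNIV :: 'n set). - (L * L * E * (v - u))) \<le> (\<Sum>i\<in>UNIV. ?r i $ i)"
          by (intro sum_mono)
        moreover have "(\<Sum>i\<in>UNIV. (J s (\<Phi> s x) *v (Y s *v (W *v axis i 1))) $ i)
            = trace (J s (\<Phi> s x)) + (\<Sum>i\<in>UNIV. ?r i $ i)"
          unfolding trace_eq_sum_axis sum.distrib[symmetric] by (simp add: matrix_vector_mult_diff_distrib)
        moreover have "c \<le> trace (J s (\<Phi> s x))" using s uv by (intro tr) auto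
        ultimately show "c - n * L * L * E * (v - u) \<le> (\<Sum>i\<in>UNIV. (J s (\<Phi> s x) *v (Y s *v (W *v axis i 1))) $ i)"
          by (simp add: n_def mult.assoc)
      qed
    qed
    have h0: "0 \<le> v - u" using uv by simp
    have "v - u \<le> \<eta> / (2 * (n * L * L * E))" using uv(4) by (simp add: D_def)
    then have "n * L * L * E * (v - u) \<le> \<eta> / 2" using nm L E by (simp add: field_simps)
    from mult_right_mono[OF this h0] have err1: "n * L * L * E * (v - u) * (v - u) \<le> \<eta> / 2 * (v - u)" .
    have "\<eta>' * norm (reindex_matrix \<sigma> B) \<le> \<eta>' * (m * (m * (L * E * (v - u))))"
      using RB \<eta>' by (intro mult_left_mono) auto
    also have "\<dots> = \<eta> / 2 * (v - u)" using nm L E by (simp add: \<eta>'_def)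
    finally have err2: "\<eta>' * norm (reindex_matrix \<sigma> B) \<le> \<eta> / 2 * (v - u)" .
    have "1 + (c - \<eta>) * (v - u) \<le> 1 + trace B - \<eta>' * norm (reindex_matrix \<sigma> B)"
      using trB err1 err2 by (simp add: algebra_simps)
    also have "\<dots> \<le> \<bar>det (mat 1 + reindex_matrix \<sigma> B)\<bar>"
      using d(2)[OF RBd] by (simp add: trace_reindex_matrix[OF \<sigma>])
    finally have "\<bar>det (reindex_matrix \<sigma> (Y u))\<bar> * (1 + (c - \<eta>) * (v - u))
        \<le> \<bar>det (reindex_matrix \<sigma> (Y u))\<bar> * \<bar>det (mat 1 + reindex_matrix \<sigma> B)\<bar>"
      by (intro mult_left_mono) auto
    also have "\<dots> = \<bar>det (reindex_matrix \<sigma> (Y v))\<bar>"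
    proof -
      have "Y v = (mat 1 + B) ** Y u" using W(1) by (simp add: B_def matrix_mul_assoc[symmetric])
      then have "reindex_matrix \<sigma> (Y v) = (mat 1 + reindex_matrix \<sigma> B) ** reindex_matrix \<sigma> (Y u)"
        by (simp add: reindex_matrix_mult[OF \<sigma>] reindex_matrix_add reindex_matrix_mat_1[OF \<sigma>])
      then show ?thesis by (simp add: det_mul abs_mult mult.commute)
    qed
    finally show ?thesis .
  qed
  then show "\<exists>d>0. \<forall>u v. a \<le> u \<longrightarrow> u \<le> v \<longrightarrow> v \<le> b \<longrightarrow> v - u < d \<longrightarrow>
      \<bar>det (reindex_matrix \<sigma> (Y u))\<bar> * (1 + (c - \<eta>) * (v - u)) \<le> \<bar>det (reindex_matrix \<sigma> (Y v))\<bar>"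
    using D by blast
qed simp

end

subsection \<open>Volume growth and the lower bound\<close>

text \<open>The change-of-variables theorems of the library need a well-ordered index type. The following
  type has the same number of elements as an arbitrary finite type and is well-ordered.\<close>

typedef ('a::finite) ordered_index = "{..<CARD('a)}"
  by (rule exI[of _ 0]) simp

instantiation ordered_index :: (finite) wellorder
begin

definition less_eq_ordered_index :: "'a ordered_index \<Rightarrow> 'a ordered_index \<Rightarrow> bool" where
  "i \<le> j \<longleftrightarrow> Rep_ordered_index i \<le> Rep_ordered_index j"

definition less_ordered_index :: "'a ordered_index \<Rightarrow> 'a ordered_index \<Rightarrow> bool" where
  "i < j \<longleftrightarrow> Rep_ordered_index i < Rep_ordered_index j"

instance
proof
  fix P :: "'a ordered_index \<Rightarrow> bool" and i
  assume *: "\<And>i. (\<And>j. j < i \<Longrightarrow> P j) \<Longrightarrow> P i"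
  show "P i"
  proof (induction "Rep_ordered_index i" arbitrary: i rule: less_induct)
    case less
    show ?case by (rule *) (use less in \<open>simp add: less_ordered_index_def\<close>)
  qed
qed (auto simp: less_eq_ordered_index_def less_ordered_index_def Rep_ordered_index_inject[symmetric])

end

instance ordered_index :: (finite) finite
proof
  have "finite (Rep_ordered_index ` (UNIV :: 'a ordered_index set))"
    by (simp add: type_definition.Rep_range[OF type_definition_ordered_index])
  then show "finite (UNIV :: 'a ordered_index set)"
    by (rule finite_imageD) (simp add: inj_on_def Rep_ordered_index_inject)
qed

lemma card_ordered_index: "CARD('a::finite ordered_index) = CARD('a)"
  by (simp add: type_definition.card[OF type_definition_ordered_index])

lemma ordered_index_bij:
  obtains \<sigma> :: "'n::finite ordered_index \<Rightarrow> 'n" where "bij \<sigma>"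
proof -
  obtain \<sigma> where "bij_betw \<sigma> (UNIV :: 'n ordered_index set) (UNIV :: 'n set)"
    using finite_same_card_bij[OF finite finite card_ordered_index] by blast
  then show ?thesis by (rule that)
qed

text \<open>For bijective \<sigma> a linear isometry, so that balls are carried to balls of the same
  radius.\<close>

definition reindex_vec :: "('m \<Rightarrow> 'n) \<Rightarrow> 'a^'n \<Rightarrow> 'a^'m" where
  "reindex_vec \<sigma> x = (\<chi> i. x $ \<sigma> i)"

lemma reindex_vec_inverse:
  assumes "bij \<sigma>"
  shows "reindex_vec (inv \<sigma>) (reindex_vec \<sigma> x) = x" "reindex_vec \<sigma> (reindex_vec (inv \<sigma>) y) = y"
  by (simp_all add: reindex_vec_def vec_eq_iff surj_f_inv_f[OF bij_is_surj[OF assms]] inv_f_f[OF bij_is_inj[OF assms]])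

lemma norm_reindex_vec:
  fixes x :: "real^'n"
  assumes "bij (\<sigma> :: 'm::finite \<Rightarrow> 'n)"
  shows "norm (reindex_vec \<sigma> x) = norm x"
  using sum.reindex_bij_betw[OF assms, of "\<lambda>i. (norm (x $ i))\<^sup>2"]
  by (simp add: norm_vec_def L2_set_def reindex_vec_def)

lemma bounded_linear_reindex_vec:
  assumes "bij (\<sigma> :: 'm::finite \<Rightarrow> 'n)"
  shows "bounded_linear (reindex_vec \<sigma> :: real^'n \<Rightarrow> real^'m)"
proof (rule bounded_linear_intro[where K = 1])
  show "norm (reindex_vec \<sigma> x) \<le> norm x * 1" for x :: "real^'n"
    by (simp add: norm_reindex_vec[OF assms])
qed (simp_all add: reindex_vec_def vec_eq_iff)

lemma reindex_vec_diff:
  fixes x y :: "real^'n"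
  shows "reindex_vec \<sigma> (x - y) = reindex_vec \<sigma> x - reindex_vec \<sigma> y"
  by (simp add: reindex_vec_def vec_eq_iff)

text \<open>The relabelling permutes the unit vectors, so conjugation by it relabels rows and
  columns by the same bijection.\<close>

lemma matrix_reindex:
  fixes A :: "real^'n^'n"
  assumes "bij (\<sigma> :: 'm::finite \<Rightarrow> 'n)"
  shows "matrix (\<lambda>w. reindex_vec \<sigma> (A *v reindex_vec (inv \<sigma>) w)) = reindex_matrix \<sigma> A"
proof -
  have *: "reindex_vec (inv \<sigma>) (axis j 1) = axis (\<sigma> j) (1 :: real)" for j
    by (auto simp: reindex_vec_def axis_def vec_eq_iff surj_f_inv_f[OF bij_is_surj[OF assms]]
        inv_f_f[OF bij_is_inj[OF assms]])
  have "matrix (\<lambda>w. reindex_vec \<sigma> (A *v reindex_vec (inv \<sigma>) w)) $ i $ j = reindex_matrix \<sigma> A $ i $ j" for i j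
  proof -
    have "matrix (\<lambda>w. reindex_vec \<sigma> (A *v reindex_vec (inv \<sigma>) w)) $ i $ j
        = reindex_vec \<sigma> (A *v reindex_vec (inv \<sigma>) (axis j 1)) $ i"
      by (simp add: matrix_def)
    also have "\<dots> = (A *v axis (\<sigma> j) 1) $ \<sigma> i" by (simp only: *) (simp add: reindex_vec_def)
    also have "\<dots> = reindex_matrix \<sigma> A $ i $ j"
      by (simp add: matrix_vector_mult_basis column_def reindex_matrix_def)
    finally show ?thesis .
  qed
  then show ?thesis by (simp add: vec_eq_iff)
qed

section \<open>Volume of the reachable set\<close>

context C1_system begin

text \<open>Change of variables for the flow, transported to the index type \<open>'m\<close>. The
  lower Lipschitz estimate supplies injectivity, without which the integral of the determinant could
  exceed the volume of the image.\<close>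

lemma measure_flow_image_lower_bound:
  fixes \<sigma> :: "'m::{finite,wellorder} \<Rightarrow> 'n"
  assumes K: "compact K" and T: "t0 \<le> T" and \<sigma>: "bij \<sigma>"
    and det: "\<And>x Y. x \<in> K \<Longrightarrow> variational_matrix x T Y \<Longrightarrow> \<kappa> \<le> \<bar>det (reindex_matrix \<sigma> (Y T))\<bar>"
  shows "\<kappa> * measure lebesgue (reindex_vec \<sigma> ` K) \<le> measure lebesgue (reindex_vec \<sigma> ` \<Phi> T ` K)"
proof -
  let ?P = "reindex_vec \<sigma> :: real^'n \<Rightarrow> real^'m::_" and ?Q = "reindex_vec (inv \<sigma>) :: real^'m::_ \<Rightarrow> real^'n"
  have P: "bounded_linear ?P" and Q: "bounded_linear ?Q"
    using \<sigma> by (auto intro: bounded_linear_reindex_vec bij_imp_bij_inv)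
  have QP: "?Q (?P x) = x" and PQ: "?P (?Q y) = y" for x y
    using reindex_vec_inverse[OF \<sigma>] by auto
  define F where "F y = ?P (\<Phi> T (?Q y))" for y
  define S where "S = ?P ` K"
  have SQ: "?Q y \<in> K" if "y \<in> S" for y using that by (auto simp: S_def QP)
  have "\<exists>Y. variational_matrix x T Y" for x by (rule variational_matrix_exists[OF T, where x = x]) blast
  then have "\<exists>Y. \<forall>x. variational_matrix x T (Y x)" by (intro choice allI)
  then obtain Y where Y: "\<And>x. variational_matrix x T (Y x)" by blast
  define F' where "F' y = (\<lambda>w. ?P (Y (?Q y) T *v ?Q w))" for y
  have dF: "(F has_derivative F' y) (at y within S)" for y
  proof (rule has_derivative_at_withinI)
    have "((\<lambda>z. \<Phi> T z) has_derivative (\<lambda>w. Y (?Q y) T *v w)) (at (?Q y))"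
      by (rule flow_has_derivative[OF Y]) (use T in auto)
    from has_derivative_compose[OF bounded_linear_imp_has_derivative[OF Q] this]
    show "(F has_derivative F' y) (at y)"
      unfolding F_def F'_def by (rule bounded_linear.has_derivative[OF P])
  qed
  have mat: "matrix (F' y) = reindex_matrix \<sigma> (Y (?Q y) T)" for y
    unfolding F'_def by (rule matrix_reindex[OF \<sigma>])
  have comp_S: "compact S"
    unfolding S_def by (intro compact_continuous_image K linear_continuous_on P)
  have inj: "inj_on F S"
  proof (rule inj_onI)
    fix y z assume y: "y \<in> S" and z: "z \<in> S" and eq: "F y = F z"
    have "?Q (F y) = ?Q (F z)" by (simp only: eq)
    then have e: "\<Phi> T (?Q y) = \<Phi> T (?Q z)" by (simp only: F_def QP)
    obtain C where "\<And>x y t. x \<in> K \<Longrightarrow> y \<in> K \<Longrightarrow> t \<in> {t0..T} \<Longrightarrow> norm (y - x) \<le> C * norm (\<Phi> t y - \<Phi> t x)"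
      by (rule flow_lipschitz[OF K T]) blast
    from this[of "?Q z" "?Q y" T] have "?Q y = ?Q z" using SQ y z T by (simp add: e)
    then have "?P (?Q y) = ?P (?Q z)" by (simp only:)
    then show "y = z" by (simp only: PQ)
  qed
  have img: "F ` S = reindex_vec \<sigma> ` \<Phi> T ` K" by (auto simp: F_def S_def QP image_image)
  have "continuous_on S F"
    unfolding continuous_on_eq_continuous_within using has_derivative_continuous[OF dF] by blast
  then have FS: "F ` S \<in> lmeasurable" by (intro lmeasurable_compact compact_continuous_image comp_S)
  have S: "S \<in> lmeasurable" by (rule lmeasurable_compact[OF comp_S])
  then have S': "S \<in> sets lebesgue" by (rule fmeasurableD)
  \<comment> \<open>Integrability comes from the finite volume of the image, so the dependence of
    the determinant on the initial state is not examined.\<close>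
  have int: "(\<lambda>y. \<bar>det (matrix (F' y))\<bar>) integrable_on S"
    using measurable_differentiable_image_eq[OF S' dF inj] FS by blast
  have "\<kappa> * measure lebesgue S = integral S (\<lambda>_. \<kappa>)"
    using lmeasure_integral[OF S] by (simp add: integral_mult_right[symmetric] del: integral_mult_right)
  also have "\<dots> \<le> integral S (\<lambda>y. \<bar>det (matrix (F' y))\<bar>)"
  proof (rule Henstock_Kurzweil_Integration.integral_le[OF integrable_on_const[OF S] int])
    show "\<kappa> \<le> \<bar>det (matrix (F' y))\<bar>" if "y \<in> S" for y
      unfolding mat by (rule det[OF SQ[OF that] Y])
  qed
  also have "\<dots> = measure lebesgue (F ` S)"
    by (rule measure_differentiable_image_eq[OF S' dF inj int, symmetric])
  finally have "\<kappa> * measure lebesgue S \<le> measure lebesgue (F ` S)" .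
  then show ?thesis unfolding img unfolding S_def .
qed

text \<open>Of an entropy ball only the final time is used: there its points lie within
  \<open>\<epsilon>\<close> of the centre in \<open>N\<close>, hence within
  \<open>\<epsilon> / p\<close> in the Euclidean norm.\<close>

lemma measure_le_min_spanning_card:
  fixes \<sigma> :: "'m::finite \<Rightarrow> 'n"
  assumes K: "compact K" and K0: "K \<noteq> {}" and N: "is_norm N" and p: "0 < p" "\<And>z. p * norm z \<le> N z" and \<epsilon>: "0 < \<epsilon>"
    and T: "0 \<le> T" and \<sigma>: "bij \<sigma>"
  shows "measure lebesgue (reindex_vec \<sigma> ` \<Phi> (t0 + T) ` K)
    \<le> real (min_spanning_card N f t0 \<epsilon> T K) * measure lebesgue (ball (0 :: real^'m) (\<epsilon> / p))"
proof -
  obtain E where E: "finite E" "spanning N f t0 \<epsilon> T K E" "card E = min_spanning_card N f t0 \<epsilon> T K"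
    by (rule min_spanning_card_attained[OF N K K0 \<epsilon> T])
  have T': "t0 \<le> t0 + T" using T by simp
  let ?B = "\<lambda>x. ball (reindex_vec \<sigma> (\<Phi> (t0 + T) x)) (\<epsilon> / p)"
  have "reindex_vec \<sigma> (\<Phi> (t0 + T) y) \<in> (\<Union>x\<in>E. ?B x)" if y: "y \<in> K" for y
  proof -
    from y obtain x where x: "x \<in> E" "y \<in> entropy_ball N f t0 x \<epsilon> T" using E(2) unfolding spanning_def by blast
    have "p * norm (\<Phi> (t0 + T) y - \<Phi> (t0 + T) x) \<le> N (\<Phi> (t0 + T) y - \<Phi> (t0 + T) x)" by (rule p)
    also have "\<dots> < \<epsilon>" by (rule entropy_ballD[OF N x(2)]) (use T in auto)
    finally have "norm (reindex_vec \<sigma> (\<Phi> (t0 + T) y) - reindex_vec \<sigma> (\<Phi> (t0 + T) x)) < \<epsilon> / p"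
      using p(1) by (simp add: reindex_vec_diff[symmetric] norm_reindex_vec[OF \<sigma>] field_simps)
    then have "reindex_vec \<sigma> (\<Phi> (t0 + T) y) \<in> ?B x" by (simp add: dist_norm norm_minus_commute)
    then show ?thesis using x(1) by blast
  qed
  then have sub: "reindex_vec \<sigma> ` \<Phi> (t0 + T) ` K \<subseteq> (\<Union>x\<in>E. ?B x)" by blast
  have cont: "continuous_on K (\<Phi> (t0 + T))"
  proof -
    obtain C where C: "1 \<le> C" "\<And>x y t. x \<in> K \<Longrightarrow> y \<in> K \<Longrightarrow> t \<in> {t0..t0 + T} \<Longrightarrow> norm (\<Phi> t y - \<Phi> t x) \<le> C * norm (y - x)"
      by (rule flow_lipschitz[OF K T']) blast
    then have "C-lipschitz_on K (\<Phi> (t0 + T))" using T by (intro lipschitz_onI) (auto simp: dist_norm)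
    then show ?thesis by (rule lipschitz_on_continuous_on)
  qed
  have "compact (reindex_vec \<sigma> ` \<Phi> (t0 + T) ` K)"
    by (rule compact_continuous_image[OF linear_continuous_on[OF bounded_linear_reindex_vec[OF \<sigma>]]
          compact_continuous_image[OF cont K]])
  then have meas: "reindex_vec \<sigma> ` \<Phi> (t0 + T) ` K \<in> sets lebesgue"
    by (intro fmeasurableD lmeasurable_compact)
  have "(\<Union>x\<in>E. ?B x) \<in> lmeasurable"
    by (intro fmeasurable.finite_UN E) auto
  from measure_mono_fmeasurable[OF sub meas this]
  have "measure lebesgue (reindex_vec \<sigma> ` \<Phi> (t0 + T) ` K) \<le> measure lebesgue (\<Union>x\<in>E. ?B x)" .
  also have "\<dots> \<le> (\<Sum>x\<in>E. measure lebesgue (?B x))"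
    by (intro measure_UNION_le E) auto
  also have "\<dots> = real (card E) * measure lebesgue (ball (0 :: real^'m) (\<epsilon> / p))"
    using \<epsilon> p(1) by (simp add: content_ball)
  finally show ?thesis by (simp add: E(3))
qed

lemma topological_entropy_ge:
  assumes K: "compact K" and int: "interior K \<noteq> {}" and N: "is_norm N" and c: "ereal c < chi_check f t0 K"
  shows "ereal c \<le> topological_entropy N f t0 K"
proof -
  have K0: "K \<noteq> {}" using int interior_subset by blast
  obtain \<sigma> :: "'n ordered_index \<Rightarrow> 'n" where \<sigma>: "bij \<sigma>" by (rule ordered_index_bij)
  obtain p where p: "0 < p" "\<And>z. p * norm z \<le> N z" using norm_le_is_norm[OF N] by blast
  from less_LiminfD[OF c[unfolded chi_check_def]] obtain a where a:
    "\<And>t. a \<le> t \<Longrightarrow> ereal c < (INF v\<in>(\<lambda>x. \<Phi> t x) ` K. ereal (trace (J t v)))"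
    by (auto simp: eventually_at_top_linorder)
  define T1 where "T1 = max a t0"
  have T1: "t0 \<le> T1" by (simp add: T1_def)
  have tr1: "c \<le> trace (J t (\<Phi> t x))" if "T1 \<le> t" "x \<in> K" for t x
  proof -
    have "ereal c < (INF v\<in>(\<lambda>x. \<Phi> t x) ` K. ereal (trace (J t v)))"
      using that(1) by (intro a) (simp add: T1_def)
    also have "\<dots> \<le> ereal (trace (J t (\<Phi> t x)))" using that(2) by (intro INF_lower imageI)
    finally show ?thesis by simp
  qed
  obtain R where R: "0 < R" "\<And>x t. x \<in> K \<Longrightarrow> t \<in> {t0..T1} \<Longrightarrow> norm (\<Phi> t x) \<le> R"
    by (rule flow_bounded[OF K T1]) blast
  obtain L where L: "0 < L" "\<And>t v w. t \<in> {t0..T1} \<Longrightarrow> norm v \<le> R \<Longrightarrow> norm (J t v *v w) \<le> L * norm w"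
    by (rule J_bound[where T = T1 and r = R]) blast
  \<comment> \<open>Before \<open>T1\<close>, \<open>chi_check\<close> says nothing; the bound on
    the Jacobian still bounds the trace from below by a constant.\<close>
  define c1 where "c1 = - (real CARD('n) * L)"
  have tr0: "c1 \<le> trace (J t (\<Phi> t x))" if t: "t \<in> {t0..T1}" and x: "x \<in> K" for t x
  proof -
    have "- L \<le> (J t (\<Phi> t x) *v axis i 1) $ i" for i
      using component_le_norm_cart[of "J t (\<Phi> t x) *v axis i 1" i] L(2)[OF t R(2)[OF x t], of "axis i 1"] by simp
    then have "(\<Sum>i\<in>(UNIV :: 'n set). - L) \<le> (\<Sum>i\<in>UNIV. (J t (\<Phi> t x) *v axis i 1) $ i)"
      by (intro sum_mono)
    then show ?thesis by (simp add: trace_eq_sum_axis c1_def)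
  qed
  define \<kappa> where "\<kappa> T = exp (c1 * (T1 - t0)) * exp (c * (T - T1))" for T
  have det: "\<kappa> T \<le> \<bar>det (reindex_matrix \<sigma> (Y T))\<bar>"
    if x: "x \<in> K" and Y: "variational_matrix x T Y" and T: "T1 \<le> T" for x T Y
  proof -
    have "\<bar>det (reindex_matrix \<sigma> (Y t0))\<bar> * exp (c1 * (T1 - t0)) \<le> \<bar>det (reindex_matrix \<sigma> (Y T1))\<bar>"
      by (rule det_variational_matrix_growth[OF Y order_refl T1 T \<sigma>]) (use tr0 x in auto)
    moreover have "Y t0 = mat 1" using variational_matrix_initial[OF Y] T1 T by simp
    ultimately have "exp (c1 * (T1 - t0)) \<le> \<bar>det (reindex_matrix \<sigma> (Y T1))\<bar>"
      by (simp add: reindex_matrix_mat_1[OF \<sigma>])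
    then have "\<kappa> T \<le> \<bar>det (reindex_matrix \<sigma> (Y T1))\<bar> * exp (c * (T - T1))"
      unfolding \<kappa>_def by (intro mult_right_mono) auto
    also have "\<dots> \<le> \<bar>det (reindex_matrix \<sigma> (Y T))\<bar>"
      by (rule det_variational_matrix_growth[OF Y T1 T order_refl \<sigma>]) (use tr1 x in auto)
    finally show ?thesis .
  qed
  define V where "V = measure lebesgue (reindex_vec \<sigma> ` K)"
  \<comment> \<open>This is where the interior of \<open>K\<close> enters.\<close>
  have V: "0 < V"
  proof -
    obtain z r where z: "0 < r" "ball z r \<subseteq> K" using int unfolding mem_interior ex_in_conv[symmetric] by blast
    have "ball (reindex_vec \<sigma> z) r \<subseteq> reindex_vec \<sigma> ` K"
    proof
      fix y assume y: "y \<in> ball (reindex_vec \<sigma> z) r"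
      have "norm (z - reindex_vec (inv \<sigma>) y) = norm (reindex_vec \<sigma> (z - reindex_vec (inv \<sigma>) y))"
        by (simp add: norm_reindex_vec[OF \<sigma>])
      also have "\<dots> < r" using y by (simp add: reindex_vec_diff reindex_vec_inverse[OF \<sigma>] dist_norm)
      finally have "reindex_vec (inv \<sigma>) y \<in> K" using z(2) by (auto simp: dist_norm)
      then show "y \<in> reindex_vec \<sigma> ` K" by (intro image_eqI) (simp_all add: reindex_vec_inverse[OF \<sigma>])
    qed
    moreover have "reindex_vec \<sigma> ` K \<in> lmeasurable"
      by (intro lmeasurable_compact compact_continuous_image K linear_continuous_on bounded_linear_reindex_vec \<sigma>)
    ultimately have "measure lebesgue (ball (reindex_vec \<sigma> z) r) \<le> V"
      unfolding V_def by (intro measure_mono_fmeasurable) auto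
    moreover have "0 < measure lebesgue (ball (reindex_vec \<sigma> z) r)" using z(1) by (simp add: content_ball)
    ultimately show ?thesis by linarith
  qed
  define B where "B = measure lebesgue (ball (0 :: real^'n ordered_index) (1 / p))"
  have B: "0 < B" using p(1) by (simp add: B_def content_ball)
  \<comment> \<open>Collects all that is independent of \<open>T\<close>; the last factor accounts
    for the rate \<open>c\<close> acting from \<open>T1\<close> and not from
    \<open>t0\<close>.\<close>
  define D where "D = V / B * exp (c1 * (T1 - t0)) * exp (c * (t0 - T1))"
  have D: "0 < D" using V B by (simp add: D_def)
  \<comment> \<open>Counting by volume works at any fixed scale, and the entropy is a supremum over
    scales, so the scale \<open>1\<close> is as good as any.\<close>
  have "ereal c \<le> growth_rate N K 1"
  proof (rule growth_rate_ge[OF N K K0 D])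
    fix T assume "T1 - t0 \<le> T"
    then have T: "T1 \<le> t0 + T" "0 \<le> T" using T1 by auto
    have "\<kappa> (t0 + T) * V \<le> measure lebesgue (reindex_vec \<sigma> ` \<Phi> (t0 + T) ` K)"
      unfolding V_def by (rule measure_flow_image_lower_bound[OF K _ \<sigma>]) (use det T T1 in auto)
    also have "\<dots> \<le> real (min_spanning_card N f t0 1 T K) * B"
      unfolding B_def by (rule measure_le_min_spanning_card[OF K K0 N p _ T(2) \<sigma>]) simp
    finally have "\<kappa> (t0 + T) * V / B \<le> real (min_spanning_card N f t0 1 T K)"
      using B by (simp add: pos_divide_le_eq)
    moreover have "D * exp (c * T) = \<kappa> (t0 + T) * V / B"
      by (simp add: D_def \<kappa>_def mult.assoc algebra_simps flip: exp_add)
    ultimately show "D * exp (c * T) \<le> real (min_spanning_card N f t0 1 T K)" by simp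
  qed
  also have "\<dots> \<le> topological_entropy N f t0 K"
    unfolding topological_entropy_eq_SUP[OF N K K0] by (rule SUP_upper) simp
  finally show ?thesis .
qed

text \<open>\<open>chi_check\<close> may be infinite and is therefore approached from below, where
  only real values need an argument.\<close>

lemma topological_entropy_lower_bound:
  assumes K: "compact K" and int: "interior K \<noteq> {}" and N: "is_norm N"
  shows "max (chi_check f t0 K) 0 \<le> topological_entropy N f t0 K"
proof (rule max.boundedI)
  show "chi_check f t0 K \<le> topological_entropy N f t0 K"
  proof (rule dense_le)
    fix z assume z: "z < chi_check f t0 K"
    show "z \<le> topological_entropy N f t0 K"
    proof (cases z)
      case (real c)
      then show ?thesis using topological_entropy_ge[OF K int N] z by simp
    qed (use z in auto)
  qed
  show "0 \<le> topological_entropy N f t0 K"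
    by (rule topological_entropy_nonneg[OF N K]) (use int interior_subset in blast)
qed

end

theorem theorem1:
  fixes f :: "real \<Rightarrow> real^'n \<Rightarrow> real^'n"
    and t0 :: real
    and K :: "(real^'n) set"
    and N :: "real^'n \<Rightarrow> real"
    and \<nu> :: "real^'n \<Rightarrow> real"
  assumes "\<And>x. piecewise_continuous_from t0 (\<lambda>t. f t x)"
    and "C1_in_state t0 f"
    and "forward_complete f t0"
    and "compact K" and "interior K \<noteq> {}"
    and "is_norm N" and "is_norm \<nu>"
  shows "topological_entropy N f t0 K \<le> ereal (real CARD('n)) * max (mu_hat \<nu> f t0 K) 0
       \<and> topological_entropy N f t0 K \<ge> max (chi_check f t0 K) 0"
proof -
  interpret C1_system f t0 by unfold_locales (use assms in auto)
  have "K \<noteq> {}" using assms(5) interior_subset by blast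
  with assms show ?thesis
    by (intro conjI topological_entropy_upper_bound topological_entropy_lower_bound)
qed

end
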